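(* Let $S$ be a commutative Noetherian ring, $\mathfrak{a}$ an ideal of $S$, and $K$ an $S$-module (not necessarily finitely generated). Then for each non-negative integer $t$ there exist a submodule $L$ of $\operatorname{Ext}^t_S(S/\mathfrak{a},K)$ and, for each $0\le j<t$, a submodule $L_j$ of $\operatorname{Ext}^{t-j+1}_S(S/\mathfrak{a},H^j_{\mathfrak{a}}(K))$, such that $$\operatorname{Ass}_S(H^t_{\mathfrak{a}}(K))\subseteq \bigcup_{0\le j<t}\operatorname{Ass}_S\big(\operatorname{Ext}^{t-j+1}_S(S/\mathfrak{a},H^j_{\mathfrak{a}}(K))/L_j\big)\ \cup\ \operatorname{Ass}_S\big(\operatorname{Ext}^t_S(S/\mathfrak{a},K)/L\big).$$
   Context: $H^j_{\mathfrak{a}}(K)$ denotes the $j$th local cohomology module of $K$ with respect to $\mathfrak{a}$, and $\operatorname{Ass}_S$ the set of associated primes. *)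

theory Defs
  imports "HOL-Algebra.Algebra"
begin

text \<open>
  Modules are records over a ring \<open>R\<close> in the sense of \<open>HOL-Algebra.Module\<close>; the fields \<open>mult\<close> and
  \<open>one\<close>, which that record type inherits from rings, play no role for modules.
\<close>

definition module_hom ::
  "('a, 'r) ring_scheme \<Rightarrow> ('a, 'm) module \<Rightarrow> ('a, 'n) module \<Rightarrow> ('m \<Rightarrow> 'n) set" where
  "module_hom R M N = {f \<in> carrier M \<rightarrow> carrier N.
     (\<forall>x\<in>carrier M. \<forall>y\<in>carrier M. f (x \<oplus>\<^bsub>M\<^esub> y) = f x \<oplus>\<^bsub>N\<^esub> f y) \<and>
     (\<forall>r\<in>carrier R. \<forall>x\<in>carrier M. f (r \<odot>\<^bsub>M\<^esub> x) = r \<odot>\<^bsub>N\<^esub> f x)}"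

definition kernel_of :: "('a, 'm) module \<Rightarrow> ('a, 'n) module \<Rightarrow> ('m \<Rightarrow> 'n) \<Rightarrow> 'm set" where
  "kernel_of M N f = {x \<in> carrier M. f x = \<zero>\<^bsub>N\<^esub>}"

definition quotient_module :: "('a, 'm) module \<Rightarrow> 'm set \<Rightarrow> ('a, 'm set) module" where
  "quotient_module M N =
     \<lparr>carrier = a_rcosets\<^bsub>M\<^esub> N, monoid.mult = undefined, one = undefined, ring.zero = N, add = set_add M,
      smult = (\<lambda>r C. \<Union>x\<in>C. N +>\<^bsub>M\<^esub> (r \<odot>\<^bsub>M\<^esub> x))\<rparr>"

definition regular_module :: "('a, 'r) ring_scheme \<Rightarrow> ('a, 'a) module" where
  "regular_module R =
     \<lparr>carrier = carrier R, monoid.mult = monoid.mult R, one = one R, ring.zero = ring.zero R,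
      add = add R, smult = monoid.mult R\<rparr>"

text \<open>
  Homomorphisms are only determined on the carrier, so the elements of the Hom module are made
  canonical by requiring them to be extensional.
\<close>

definition Hom_module ::
  "('a, 'r) ring_scheme \<Rightarrow> ('a, 'm) module \<Rightarrow> ('a, 'n) module \<Rightarrow> ('a, 'm \<Rightarrow> 'n) module" where
  "Hom_module R M N =
     \<lparr>carrier = module_hom R M N \<inter> extensional (carrier M), monoid.mult = undefined, one = undefined,
      ring.zero = (\<lambda>x\<in>carrier M. \<zero>\<^bsub>N\<^esub>),
      add = (\<lambda>f g. \<lambda>x\<in>carrier M. f x \<oplus>\<^bsub>N\<^esub> g x),
      smult = (\<lambda>r f. \<lambda>x\<in>carrier M. r \<odot>\<^bsub>N\<^esub> f x)\<rparr>"

definition annihilator :: "('a, 'r) ring_scheme \<Rightarrow> ('a, 'm) module \<Rightarrow> 'm \<Rightarrow> 'a set" where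
  "annihilator R M x = {r \<in> carrier R. r \<odot>\<^bsub>M\<^esub> x = \<zero>\<^bsub>M\<^esub>}"

definition associated_primes :: "('a, 'r) ring_scheme \<Rightarrow> ('a, 'm) module \<Rightarrow> 'a set set" where
  "associated_primes R M = {p. primeideal p R \<and> (\<exists>x\<in>carrier M. p = annihilator R M x)}"

text \<open>
  HOL cannot quantify over types inside a definition, so the test modules in the usual lifting
  property must have their carriers in some fixed types.  These are chosen large enough not to
  lose anything.  For injectivity, \<open>'a + 'c\<close> contains copies of \<open>R\<close> and all its ideals, so by
  Baer's criterion the lifting property then holds for test modules over every type.
  For projectivity, \<open>'f \<Rightarrow> 'a\<close> contains the free module on the elements of \<open>P\<close>, which maps onto
  \<open>P\<close>; hence \<open>P\<close> is a direct summand of a free module and again the lifting property holds for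
  test modules over every type.
\<close>

definition injective_module :: "('a, 'r) ring_scheme \<Rightarrow> ('a, 'c) module \<Rightarrow> bool" where
  "injective_module R E \<longleftrightarrow> module R E \<and>
     (\<forall>(A :: ('a, 'a + 'c) module) (B :: ('a, 'a + 'c) module) f g.
        module R A \<and> module R B \<and> f \<in> module_hom R A B \<and> inj_on f (carrier A) \<and>
        g \<in> module_hom R A E \<longrightarrow>
        (\<exists>h\<in>module_hom R B E. \<forall>x\<in>carrier A. h (f x) = g x))"

definition projective_module :: "('a, 'r) ring_scheme \<Rightarrow> ('a, 'f) module \<Rightarrow> bool" where
  "projective_module R P \<longleftrightarrow> module R P \<and>
     (\<forall>(A :: ('a, 'f \<Rightarrow> 'a) module) (B :: ('a, 'f) module) f g.
        module R A \<and> module R B \<and> f \<in> module_hom R A B \<and> f ` carrier A = carrier B \<and>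
        g \<in> module_hom R P B \<longrightarrow>
        (\<exists>h\<in>module_hom R P A. \<forall>x\<in>carrier P. f (h x) = g x))"

text \<open>Exactness of \<open>0 \<rightarrow> M \<rightarrow> E 0 \<rightarrow> E 1 \<rightarrow> \<dots>\<close> with augmentation \<open>\<epsilon> : M \<rightarrow> E 0\<close> and \<open>d n : E n \<rightarrow> E (n + 1)\<close>.\<close>

definition injective_resolution ::
  "('a, 'r) ring_scheme \<Rightarrow> ('a, 'm) module \<Rightarrow> (nat \<Rightarrow> ('a, 'c) module) \<Rightarrow> (nat \<Rightarrow> 'c \<Rightarrow> 'c) \<Rightarrow>
   ('m \<Rightarrow> 'c) \<Rightarrow> bool" where
  "injective_resolution R M E d \<epsilon> \<longleftrightarrow>
     (\<forall>n. injective_module R (E n)) \<and>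
     \<epsilon> \<in> module_hom R M (E 0) \<and>
     (\<forall>n. d n \<in> module_hom R (E n) (E (Suc n))) \<and>
     inj_on \<epsilon> (carrier M) \<and>
     \<epsilon> ` carrier M = kernel_of (E 0) (E 1) (d 0) \<and>
     (\<forall>n. d n ` carrier (E n) = kernel_of (E (Suc n)) (E (Suc (Suc n))) (d (Suc n)))"

text \<open>Exactness of \<open>\<dots> \<rightarrow> P 1 \<rightarrow> P 0 \<rightarrow> M \<rightarrow> 0\<close> with augmentation \<open>\<pi> : P 0 \<rightarrow> M\<close> and \<open>\<delta> n : P (n + 1) \<rightarrow> P n\<close>.\<close>

definition projective_resolution ::
  "('a, 'r) ring_scheme \<Rightarrow> ('a, 'm) module \<Rightarrow> (nat \<Rightarrow> ('a, 'f) module) \<Rightarrow> (nat \<Rightarrow> 'f \<Rightarrow> 'f) \<Rightarrow>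
   ('f \<Rightarrow> 'm) \<Rightarrow> bool" where
  "projective_resolution R M P \<delta> \<pi> \<longleftrightarrow>
     (\<forall>n. projective_module R (P n)) \<and>
     \<pi> \<in> module_hom R (P 0) M \<and>
     (\<forall>n. \<delta> n \<in> module_hom R (P (Suc n)) (P n)) \<and>
     \<pi> ` carrier (P 0) = carrier M \<and>
     \<delta> 0 ` carrier (P 1) = kernel_of (P 0) M \<pi> \<and>
     (\<forall>n. \<delta> (Suc n) ` carrier (P (Suc (Suc n))) = kernel_of (P (Suc n)) (P n) (\<delta> n))"

text \<open>Cohomology of a cochain complex \<open>C 0 \<rightarrow> C 1 \<rightarrow> \<dots>\<close> with \<open>d n : C n \<rightarrow> C (n + 1)\<close>.\<close>

definition coboundaries :: "(nat \<Rightarrow> ('a, 'c) module) \<Rightarrow> (nat \<Rightarrow> 'c \<Rightarrow> 'c) \<Rightarrow> nat \<Rightarrow> 'c set" where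
  "coboundaries C d n = (case n of 0 \<Rightarrow> {\<zero>\<^bsub>C 0\<^esub>} | Suc m \<Rightarrow> d m ` carrier (C m))"

definition cohomology ::
  "(nat \<Rightarrow> ('a, 'c) module) \<Rightarrow> (nat \<Rightarrow> 'c \<Rightarrow> 'c) \<Rightarrow> nat \<Rightarrow> ('a, 'c set) module" where
  "cohomology C d n =
     quotient_module ((C n)\<lparr>carrier := kernel_of (C n) (C (Suc n)) (d n)\<rparr>) (coboundaries C d n)"

text \<open>
  \<open>Ext\<^sup>n(M, N)\<close> as the \<open>n\<close>th right derived functor of \<open>Hom(_, N)\<close>, computed from a projective
  resolution \<open>(P, \<delta>)\<close> of \<open>M\<close>.
\<close>

definition Ext_module ::
  "('a, 'r) ring_scheme \<Rightarrow> (nat \<Rightarrow> ('a, 'f) module) \<Rightarrow> (nat \<Rightarrow> 'f \<Rightarrow> 'f) \<Rightarrow> nat \<Rightarrow> ('a, 'n) module \<Rightarrow>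
   ('a, ('f \<Rightarrow> 'n) set) module" where
  "Ext_module R P \<delta> n N =
     cohomology (\<lambda>i. Hom_module R (P i) N) (\<lambda>i f. compose (carrier (P (Suc i))) f (\<delta> i)) n"

primrec ideal_power :: "('a, 'r) ring_scheme \<Rightarrow> 'a set \<Rightarrow> nat \<Rightarrow> 'a set" where
  "ideal_power R I 0 = carrier R"
| "ideal_power R I (Suc n) = I \<cdot>\<^bsub>R\<^esub> ideal_power R I n"

definition torsion_module ::
  "('a, 'r) ring_scheme \<Rightarrow> 'a set \<Rightarrow> ('a, 'm) module \<Rightarrow> ('a, 'm) module" where
  "torsion_module R I M =
     M\<lparr>carrier := {x \<in> carrier M. \<exists>n. \<forall>r\<in>ideal_power R I n. r \<odot>\<^bsub>M\<^esub> x = \<zero>\<^bsub>M\<^esub>}\<rparr>"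

text \<open>
  The \<open>n\<close>th local cohomology module of \<open>K\<close> with respect to \<open>I\<close>, as the \<open>n\<close>th right derived functor of
  the \<open>I\<close>-torsion functor, computed from an injective resolution \<open>(E, d)\<close> of \<open>K\<close>.
\<close>

definition local_cohomology ::
  "('a, 'r) ring_scheme \<Rightarrow> 'a set \<Rightarrow> (nat \<Rightarrow> ('a, 'c) module) \<Rightarrow> (nat \<Rightarrow> 'c \<Rightarrow> 'c) \<Rightarrow> nat \<Rightarrow>
   ('a, 'c set) module" where
  "local_cohomology R I E d n = cohomology (\<lambda>i. torsion_module R I (E i)) d n"

text \<open>
  Derived functors are determined only up to isomorphism, so results about them are to be stated for
  arbitrary resolutions, over an arbitrary carrier type.  Resolutions exist over sufficiently large
  types: an injective resolution of a module over type \<open>'b\<close> exists over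
  \<open>(nat + 'a) list \<Rightarrow> 'b + nat\<close> (embed a module in a divisible group \<open>D\<close> and then in \<open>Hom\<^sub>\<int>(R, D)\<close>, which
  does not leave this cardinality), and for Noetherian \<open>R\<close> a resolution of \<open>R/I\<close> by free modules of
  finite rank exists over \<open>nat \<Rightarrow> 'a\<close>.
\<close>

end

theory Submission
  imports Defs
begin

text \<open>
  Let \<open>I\<^sup>j = \<Gamma>\<^sub>\<aa>(E\<^sup>j)\<close>, so that \<open>H\<^sup>j\<^sub>\<aa>(K) = H\<^sup>j(I)\<close>.  The theorem reads off the edge map of the spectral sequence
  \<open>Ext\<^sup>i(S/\<aa>, H\<^sup>j\<^sub>\<aa>(K)) \<Rightarrow> Ext\<^sup>i\<^sup>+\<^sup>j(S/\<aa>, K)\<close>, here replaced by a zigzag in the double complex \<open>Hom(P\<^sub>i, I\<^sup>j)\<close>.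
  If \<open>p = ann x\<close> is an associated prime of \<open>H\<^sup>t\<^sub>\<aa>(K)\<close>, then \<open>\<aa> x = 0\<close>, and \<open>x\<close> gives a map
  \<open>u : P\<^sub>0 \<rightarrow> S/\<aa> \<rightarrow> H\<^sup>t\<^sub>\<aa>(K)\<close>.  Lift \<open>u\<close> to \<open>f\<^sub>0 : P\<^sub>0 \<rightarrow> I\<^sup>t\<close> and try to find \<open>f\<^sub>i\<^sub>+\<^sub>1 : P\<^sub>i\<^sub>+\<^sub>1 \<rightarrow> I\<^sup>t\<^sup>-\<^sup>i\<^sup>-\<^sup>1\<close> with
  \<open>d f\<^sub>i\<^sub>+\<^sub>1 = f\<^sub>i \<delta>\<close>.  The obstruction to step \<open>s\<close> is the class of \<open>f\<^sub>s \<delta>\<close> in \<open>Ext\<^sup>s\<^sup>+\<^sup>1(S/\<aa>, H\<^sup>t\<^sup>-\<^sup>s\<^sub>\<aa>(K))\<close>, well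
  defined modulo the submodule of those classes that arise from zigzags starting at \<open>0\<close>.  A zigzag that reaches the
  end is a cocycle of the total complex and hence a class in \<open>Ext\<^sup>t(S/\<aa>, K)\<close>, again modulo the zigzags starting at
  \<open>0\<close>.  Every nonzero multiple of \<open>u\<close> has annihilator \<open>p\<close>, so \<open>p\<close> is an associated prime of the quotient at the last
  stage reached by some nonzero multiple.
\<close>

section \<open>Homomorphisms and quotients of modules\<close>

text \<open>Zigzags live in \<Gamma>(E), but it is E that resolves K. So the class in Ext(S/a, K) is
  formed in the total complex of Hom(P, E), and the crux is the way back: a zigzag that bounds there
  must start in a boundary of \<Gamma>(E). The reason is that Ext(S/a, E/\<Gamma>(E)) vanishes: in
  degree 0 because E/\<Gamma>(E) has no nonzero element killed by a, in positive degrees because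
  \<Gamma>(E) and E are injective. Injectivity of \<Gamma>(E) rests on the Noetherian hypothesis.
  The obstruction stages before the last draw only on projectivity of the P_i.

  Passing to multiples of u is forced: u may be obstructed at a stage that r u passes for some r
  outside p.

  Projectivity and injectivity are given for test modules over particular types, while the maps to
  be lifted or extended connect modules over many types. Hence the detour through a splitting of a
  free module and through Baer's criterion, which turn both properties into statements about all
  types.\<close>

lemma module_homD:
  assumes "f \<in> module_hom R M N"
  shows "x \<in> carrier M \<Longrightarrow> f x \<in> carrier N"
    and "x \<in> carrier M \<Longrightarrow> y \<in> carrier M \<Longrightarrow> f (x \<oplus>\<^bsub>M\<^esub> y) = f x \<oplus>\<^bsub>N\<^esub> f y"
    and "r \<in> carrier R \<Longrightarrow> x \<in> carrier M \<Longrightarrow> f (r \<odot>\<^bsub>M\<^esub> x) = r \<odot>\<^bsub>N\<^esub> f x"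
  using assms by (auto simp: module_hom_def)

lemma module_homI:
  assumes "\<And>x. x \<in> carrier M \<Longrightarrow> f x \<in> carrier N"
    and "\<And>x y. x \<in> carrier M \<Longrightarrow> y \<in> carrier M \<Longrightarrow> f (x \<oplus>\<^bsub>M\<^esub> y) = f x \<oplus>\<^bsub>N\<^esub> f y"
    and "\<And>r x. r \<in> carrier R \<Longrightarrow> x \<in> carrier M \<Longrightarrow> f (r \<odot>\<^bsub>M\<^esub> x) = r \<odot>\<^bsub>N\<^esub> f x"
  shows "f \<in> module_hom R M N"
  using assms by (auto simp: module_hom_def)

lemma module_hom_comp:
  assumes "f \<in> module_hom R M N" "g \<in> module_hom R N L"
  shows "(\<lambda>x. g (f x)) \<in> module_hom R M L"
  using assms by (auto simp: module_hom_def Pi_iff)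

lemma module_hom_zero:
  fixes R (structure)
  assumes "module R M" "module R N" "f \<in> module_hom R M N"
  shows "f \<zero>\<^bsub>M\<^esub> = \<zero>\<^bsub>N\<^esub>"
proof -
  interpret M: module R M by fact
  interpret N: module R N by fact
  have "f (\<zero> \<odot>\<^bsub>M\<^esub> \<zero>\<^bsub>M\<^esub>) = \<zero> \<odot>\<^bsub>N\<^esub> f \<zero>\<^bsub>M\<^esub>"
    by (rule module_homD(3)[OF assms(3)]) auto
  then show ?thesis using module_homD(1)[OF assms(3), of "\<zero>\<^bsub>M\<^esub>"] by simp
qed

lemma const_zero_module_hom:
  assumes "module R N"
  shows "(\<lambda>x. \<zero>\<^bsub>N\<^esub>) \<in> module_hom R M N"
proof -
  interpret N: module R N by fact
  show ?thesis by (auto simp: module_hom_def)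
qed

text \<open>Sums, multiples and differences in one operation, so that each set of cocycles or
  zigzags below has a single closure proof. Differences have the coefficients \<one> and \<ominus>
  \<one>.\<close>

definition lin_comb ::
  "('a, 'm) module \<Rightarrow> 'a \<Rightarrow> ('x \<Rightarrow> 'm) \<Rightarrow> 'a \<Rightarrow> ('x \<Rightarrow> 'm) \<Rightarrow> 'x \<Rightarrow> 'm" where
  "lin_comb N r f s g x = r \<odot>\<^bsub>N\<^esub> f x \<oplus>\<^bsub>N\<^esub> s \<odot>\<^bsub>N\<^esub> g x"

lemma lin_comb_module_hom:
  assumes "module R M" "module R N" "f \<in> module_hom R M N" "g \<in> module_hom R M N"
    and "r \<in> carrier R" "s \<in> carrier R"
  shows "lin_comb N r f s g \<in> module_hom R M N"
proof -
  interpret M: module R M by fact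
  interpret N: module R N by fact
  note f = module_homD[OF assms(3)] and g = module_homD[OF assms(4)]
  show ?thesis
  proof (rule module_homI)
    fix x assume "x \<in> carrier M"
    then show "lin_comb N r f s g x \<in> carrier N" using f g assms by (simp add: lin_comb_def)
  next
    fix x y assume "x \<in> carrier M" "y \<in> carrier M"
    then show "lin_comb N r f s g (x \<oplus>\<^bsub>M\<^esub> y) = lin_comb N r f s g x \<oplus>\<^bsub>N\<^esub> lin_comb N r f s g y"
      using f g assms by (simp add: lin_comb_def N.smult_r_distr N.M.a_ac)
  next
    fix c x assume "c \<in> carrier R" "x \<in> carrier M"
    then show "lin_comb N r f s g (c \<odot>\<^bsub>M\<^esub> x) = c \<odot>\<^bsub>N\<^esub> lin_comb N r f s g x"
      using f g assms
      by (simp add: lin_comb_def N.smult_r_distr N.smult_assoc1[symmetric] M.R.m_comm)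
  qed
qed

lemma smult_module_hom:
  assumes "module R M" "module R N" "f \<in> module_hom R M N" "r \<in> carrier R"
  shows "(\<lambda>x. r \<odot>\<^bsub>N\<^esub> f x) \<in> module_hom R M N"
proof -
  interpret M: module R M by fact
  interpret N: module R N by fact
  show ?thesis
    by (rule module_homI) (use module_homD[OF assms(3)] assms(4) in
        \<open>auto simp: N.smult_r_distr N.smult_assoc1[symmetric] M.R.m_comm\<close>)
qed

lemma module_hom_lin_comb:
  assumes "module R M" "h \<in> module_hom R M N" "r \<in> carrier R" "s \<in> carrier R"
    and "f x \<in> carrier M" "g x \<in> carrier M"
  shows "h (lin_comb M r f s g x) = lin_comb N r (\<lambda>x. h (f x)) s (\<lambda>x. h (g x)) x"
proof -
  interpret M: module R M by fact
  show ?thesis using assms module_homD[OF assms(2)] by (simp add: lin_comb_def)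
qed

lemma module_hom_minus:
  assumes "module R M" "module R N" "f \<in> module_hom R M N" "x \<in> carrier M"
  shows "f (\<ominus>\<^bsub>M\<^esub> x) = \<ominus>\<^bsub>N\<^esub> f x"
proof -
  interpret M: module R M by fact
  interpret N: module R N by fact
  show ?thesis using assms(4) module_homD[OF assms(3)]
    by (metis M.R.a_inv_closed M.R.one_closed M.smult_l_minus M.smult_one N.smult_l_minus N.smult_one)
qed

section \<open>Submodules and quotient modules\<close>

lemma submodule_lin_combI:
  fixes R (structure)
  assumes "module R M" "T \<subseteq> carrier M" "\<zero>\<^bsub>M\<^esub> \<in> T"
    and comb: "\<And>r x s y. r \<in> carrier R \<Longrightarrow> s \<in> carrier R \<Longrightarrow> x \<in> T \<Longrightarrow> y \<in> T \<Longrightarrow>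
      r \<odot>\<^bsub>M\<^esub> x \<oplus>\<^bsub>M\<^esub> s \<odot>\<^bsub>M\<^esub> y \<in> T"
  shows "submodule T R M"
proof -
  interpret M: module R M by fact
  have smult: "r \<odot>\<^bsub>M\<^esub> x \<in> T" if "r \<in> carrier R" "x \<in> T" for r x
    using comb[of r "\<zero>" x x] that assms(2) by (auto simp: subset_eq)
  show ?thesis
  proof (rule M.submoduleI)
    show "\<ominus>\<^bsub>M\<^esub> x \<in> T" if "x \<in> T" for x
      using smult[of "\<ominus> \<one>" x] that assms(2) by (auto simp: subset_eq M.smult_l_minus)
    show "x \<oplus>\<^bsub>M\<^esub> y \<in> T" if "x \<in> T" "y \<in> T" for x y
      using comb[of "\<one>" "\<one>" x y] that assms(2) by (auto simp: subset_eq)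
  qed (use assms smult in auto)
qed

lemma submodule_zero:
  assumes "submodule N R M"
  shows "\<zero>\<^bsub>M\<^esub> \<in> N"
  using subgroup.one_closed[OF submodule.axioms(1)[OF assms]] by simp

lemma submodule_abelian_subgroup:
  assumes "module R M" "submodule N R M"
  shows "abelian_subgroup N M"
proof -
  interpret M: module R M by fact
  show ?thesis
    by (rule abelian_subgroupI3)
      (use assms in \<open>auto simp: submodule_def additive_subgroup_def M.abelian_group_axioms\<close>)
qed

text \<open>\<open>quotient_module\<close> is built from sets of elements; these rules reduce
  computations in it to representatives.\<close>

lemma quotient_coset:
  assumes "module R M" "submodule N R M"
  shows "x \<in> carrier M \<Longrightarrow> N +>\<^bsub>M\<^esub> x \<in> carrier (quotient_module M N)"
    and "carrier (quotient_module M N) = (\<lambda>x. N +>\<^bsub>M\<^esub> x) ` carrier M"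
    and "x \<in> carrier M \<Longrightarrow> y \<in> carrier M \<Longrightarrow>
      (N +>\<^bsub>M\<^esub> x) \<oplus>\<^bsub>quotient_module M N\<^esub> (N +>\<^bsub>M\<^esub> y) = N +>\<^bsub>M\<^esub> (x \<oplus>\<^bsub>M\<^esub> y)"
    and "r \<in> carrier R \<Longrightarrow> x \<in> carrier M \<Longrightarrow>
      r \<odot>\<^bsub>quotient_module M N\<^esub> (N +>\<^bsub>M\<^esub> x) = N +>\<^bsub>M\<^esub> (r \<odot>\<^bsub>M\<^esub> x)"
    and "x \<in> carrier M \<Longrightarrow> N +>\<^bsub>M\<^esub> x = \<zero>\<^bsub>quotient_module M N\<^esub> \<longleftrightarrow> x \<in> N"
    and "x \<in> carrier M \<Longrightarrow> y \<in> carrier M \<Longrightarrow> N +>\<^bsub>M\<^esub> x = N +>\<^bsub>M\<^esub> y \<longleftrightarrow> x \<ominus>\<^bsub>M\<^esub> y \<in> N"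
proof -
  interpret M: module R M by fact
  interpret N: abelian_subgroup N M by (rule submodule_abelian_subgroup[OF assms])
  have eq: "N +>\<^bsub>M\<^esub> x = N +>\<^bsub>M\<^esub> y \<longleftrightarrow> x \<ominus>\<^bsub>M\<^esub> y \<in> N"
    if "x \<in> carrier M" "y \<in> carrier M" for x y
    using that
    by (metis N.a_rcos_module N.a_rcos_self N.a_repr_independence' a_minus_def)
  then show "x \<in> carrier M \<Longrightarrow> y \<in> carrier M \<Longrightarrow> N +>\<^bsub>M\<^esub> x = N +>\<^bsub>M\<^esub> y \<longleftrightarrow> x \<ominus>\<^bsub>M\<^esub> y \<in> N" .
  show c: "carrier (quotient_module M N) = (\<lambda>x. N +>\<^bsub>M\<^esub> x) ` carrier M"
    by (auto simp: quotient_module_def A_RCOSETS_def')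
  then show "x \<in> carrier M \<Longrightarrow> N +>\<^bsub>M\<^esub> x \<in> carrier (quotient_module M N)" by auto
  show "x \<in> carrier M \<Longrightarrow> y \<in> carrier M \<Longrightarrow>
      (N +>\<^bsub>M\<^esub> x) \<oplus>\<^bsub>quotient_module M N\<^esub> (N +>\<^bsub>M\<^esub> y) = N +>\<^bsub>M\<^esub> (x \<oplus>\<^bsub>M\<^esub> y)"
    by (simp add: quotient_module_def N.a_rcos_sum)
  show "x \<in> carrier M \<Longrightarrow> N +>\<^bsub>M\<^esub> x = \<zero>\<^bsub>quotient_module M N\<^esub> \<longleftrightarrow> x \<in> N"
    by (simp add: quotient_module_def)
      (metis N.a_rcos_const N.a_rcos_self)
  show "r \<odot>\<^bsub>quotient_module M N\<^esub> (N +>\<^bsub>M\<^esub> x) = N +>\<^bsub>M\<^esub> (r \<odot>\<^bsub>M\<^esub> x)"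
    if r: "r \<in> carrier R" and x: "x \<in> carrier M" for r x
  proof -
    \<comment> \<open>The scalar multiple is a union over all representatives \<open>y\<close>;
      since \<open>N\<close> is closed under scalars, every member of the union is the same
      coset.\<close>
    have "N +>\<^bsub>M\<^esub> (r \<odot>\<^bsub>M\<^esub> y) = N +>\<^bsub>M\<^esub> (r \<odot>\<^bsub>M\<^esub> x)" if y: "y \<in> N +>\<^bsub>M\<^esub> x" for y
    proof -
      have yc: "y \<in> carrier M" using y x N.a_elemrcos_carrier by blast
      then have "y \<ominus>\<^bsub>M\<^esub> x \<in> N" using y x by (simp add: N.a_rcos_module a_minus_def)
      then have "r \<odot>\<^bsub>M\<^esub> (y \<ominus>\<^bsub>M\<^esub> x) \<in> N" using submodule.smult_closed[OF assms(2)] r by blast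
      then show ?thesis using eq r x yc
        by (simp add: a_minus_def M.smult_r_distr M.smult_r_minus)
    qed
    moreover have "x \<in> N +>\<^bsub>M\<^esub> x" using x by (rule N.a_rcos_self)
    ultimately have "(\<Union>y\<in>N +>\<^bsub>M\<^esub> x. N +>\<^bsub>M\<^esub> (r \<odot>\<^bsub>M\<^esub> y)) = N +>\<^bsub>M\<^esub> (r \<odot>\<^bsub>M\<^esub> x)"
      by (metis (no_types, lifting) UN_constant_eq)
    then show ?thesis by (simp add: quotient_module_def)
  qed
qed

lemma quotient_module_module:
  assumes "module R M" "submodule N R M"
  shows "module R (quotient_module M N)"
proof -
  interpret M: module R M by fact
  interpret N: abelian_subgroup N M by (rule submodule_abelian_subgroup[OF assms])
  let ?Q = "quotient_module M N"
  note q = quotient_coset[OF assms]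
  have zero: "\<zero>\<^bsub>?Q\<^esub> = N +>\<^bsub>M\<^esub> \<zero>\<^bsub>M\<^esub>"
    using q(5)[of "\<zero>\<^bsub>M\<^esub>"] N.zero_closed by simp
  have ab: "abelian_group ?Q"
  proof (rule abelian_groupI)
    fix U assume "U \<in> carrier ?Q"
    then obtain x where x: "x \<in> carrier M" "U = N +>\<^bsub>M\<^esub> x" by (auto simp: q(2))
    then have "(N +>\<^bsub>M\<^esub> (\<ominus>\<^bsub>M\<^esub> x)) \<oplus>\<^bsub>?Q\<^esub> U = \<zero>\<^bsub>?Q\<^esub>"
      by (simp add: q(3) zero M.l_neg)
    with x show "\<exists>V\<in>carrier ?Q. V \<oplus>\<^bsub>?Q\<^esub> U = \<zero>\<^bsub>?Q\<^esub>" by (auto simp: q(2))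
  next
    fix U V assume "U \<in> carrier ?Q" "V \<in> carrier ?Q"
    then show "U \<oplus>\<^bsub>?Q\<^esub> V \<in> carrier ?Q" by (auto simp: q(2,3))
    show "U \<oplus>\<^bsub>?Q\<^esub> V = V \<oplus>\<^bsub>?Q\<^esub> U"
      using \<open>U \<in> carrier ?Q\<close> \<open>V \<in> carrier ?Q\<close> by (auto simp: q(2,3) M.M.a_comm)
  next
    fix U V W assume "U \<in> carrier ?Q" "V \<in> carrier ?Q" "W \<in> carrier ?Q"
    then show "U \<oplus>\<^bsub>?Q\<^esub> V \<oplus>\<^bsub>?Q\<^esub> W = U \<oplus>\<^bsub>?Q\<^esub> (V \<oplus>\<^bsub>?Q\<^esub> W)"
      by (auto simp: q(2,3) M.M.a_assoc)
  next
    fix U assume "U \<in> carrier ?Q"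
    then show "\<zero>\<^bsub>?Q\<^esub> \<oplus>\<^bsub>?Q\<^esub> U = U" by (auto simp: q(2,3) zero)
  qed (auto simp: q(2) zero)
  show ?thesis
    by (rule moduleI[OF M.is_cring ab])
      (auto simp: q(2-4) M.smult_l_distr M.smult_r_distr M.smult_assoc1)
qed

lemma coset_module_hom:
  assumes "module R M" "submodule N R M"
  shows "(\<lambda>x. N +>\<^bsub>M\<^esub> x) \<in> module_hom R M (quotient_module M N)"
  by (rule module_homI) (simp_all add: quotient_coset[OF assms])

text \<open>(M/B)/(T/B) is M/T, where the class of \<open>u\<close> has annihilator {r. r u \<in>
  T}. With cocycles as \<open>M\<close> and coboundaries as \<open>B\<close>, finding a submodule
  \<open>L\<close> of an Ext module becomes finding a submodule \<open>T\<close> of the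
  cocycles.\<close>

lemma associated_primes_quotient_quotient:
  assumes M: "module R M" and B: "submodule B R M" and T: "submodule T R M" and "B \<subseteq> T"
  defines "L \<equiv> (\<lambda>x. B +>\<^bsub>M\<^esub> x) ` T"
  shows "submodule L R (quotient_module M B)"
    and "u \<in> carrier M \<Longrightarrow> primeideal p R \<Longrightarrow> p = {r \<in> carrier R. r \<odot>\<^bsub>M\<^esub> u \<in> T} \<Longrightarrow>
      p \<in> associated_primes R (quotient_module (quotient_module M B) L)"
proof -
  interpret M: module R M by fact
  let ?Q = "quotient_module M B"
  have Q: "module R ?Q" by (rule quotient_module_module[OF M B])
  interpret Q: module R ?Q by fact
  note q = quotient_coset[OF M B]
  have Tc: "T \<subseteq> carrier M" using M.submoduleE(1)[OF T] .
  have zT: "\<zero>\<^bsub>M\<^esub> \<in> T" by (rule submodule_zero[OF T])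
  show L: "submodule L R ?Q"
  proof (rule submodule_lin_combI[OF Q])
    show "L \<subseteq> carrier ?Q" using Tc q(1) by (auto simp: L_def)
    have "\<zero>\<^bsub>?Q\<^esub> = B +>\<^bsub>M\<^esub> \<zero>\<^bsub>M\<^esub>" using coset_module_hom[OF M B] module_hom_zero[OF M Q] by metis
    then show "\<zero>\<^bsub>?Q\<^esub> \<in> L" using zT by (auto simp: L_def)
  next
    fix r x s y assume *: "r \<in> carrier R" "s \<in> carrier R" "x \<in> L" "y \<in> L"
    then obtain x' y' where "x' \<in> T" "y' \<in> T" "x = B +>\<^bsub>M\<^esub> x'" "y = B +>\<^bsub>M\<^esub> y'"
      by (auto simp: L_def)
    moreover have "r \<odot>\<^bsub>M\<^esub> x' \<oplus>\<^bsub>M\<^esub> s \<odot>\<^bsub>M\<^esub> y' \<in> T"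
      using calculation * M.submoduleE(4,5)[OF T] by auto
    ultimately show "r \<odot>\<^bsub>?Q\<^esub> x \<oplus>\<^bsub>?Q\<^esub> s \<odot>\<^bsub>?Q\<^esub> y \<in> L"
      using * Tc by (auto simp: L_def q subset_eq)
  qed
  \<comment> \<open>Because \<open>B \<subseteq> T\<close>, membership of a coset in
    \<open>L\<close> does not depend on the representative.\<close>
  have L_iff: "B +>\<^bsub>M\<^esub> x \<in> L \<longleftrightarrow> x \<in> T" if x: "x \<in> carrier M" for x
  proof
    assume "B +>\<^bsub>M\<^esub> x \<in> L"
    then obtain y where y: "y \<in> T" "B +>\<^bsub>M\<^esub> x = B +>\<^bsub>M\<^esub> y" by (auto simp: L_def)
    then have "x \<ominus>\<^bsub>M\<^esub> y \<in> T" using q(6) x Tc \<open>B \<subseteq> T\<close> by blast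
    then have "(x \<ominus>\<^bsub>M\<^esub> y) \<oplus>\<^bsub>M\<^esub> y \<in> T" using y M.submoduleE(5)[OF T] by blast
    moreover have "(x \<ominus>\<^bsub>M\<^esub> y) \<oplus>\<^bsub>M\<^esub> y = x"
      using x y Tc by (auto simp: a_minus_def M.M.a_assoc M.l_neg subset_eq)
    ultimately show "x \<in> T" by simp
  qed (auto simp: L_def)
  note q' = quotient_coset[OF Q L]
  show "p \<in> associated_primes R (quotient_module ?Q L)"
    if u: "u \<in> carrier M" and p: "primeideal p R" "p = {r \<in> carrier R. r \<odot>\<^bsub>M\<^esub> u \<in> T}"
  proof -
    have "annihilator R (quotient_module ?Q L) (L +>\<^bsub>?Q\<^esub> (B +>\<^bsub>M\<^esub> u)) = p"
      unfolding annihilator_def p(2)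
      using u L_iff by (intro Collect_cong conj_cong refl) (simp add: q'(4,5) q(1,4))
    moreover have "L +>\<^bsub>?Q\<^esub> (B +>\<^bsub>M\<^esub> u) \<in> carrier (quotient_module ?Q L)" using u q(1) q'(1) by blast
    ultimately show ?thesis using p(1) unfolding associated_primes_def by blast
  qed
qed

section \<open>Ext modules and their associated primes\<close>

lemma restrict_eq_iff: "restrict f A = restrict g A \<longleftrightarrow> (\<forall>x\<in>A. f x = g x)"
  by (auto simp: restrict_def fun_eq_iff)

lemma Hom_module_module:
  fixes R (structure)
  assumes "module R M" "module R N"
  shows "module R (Hom_module R M N)"
proof -
  interpret M: module R M by fact
  interpret N: module R N by fact
  let ?H = "Hom_module R M N"
  have mem: "f \<in> carrier ?H \<longleftrightarrow> f \<in> module_hom R M N \<and> f \<in> extensional (carrier M)" for f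
    by (simp add: Hom_module_def)
  have restr: "restrict f (carrier M) \<in> carrier ?H" if "f \<in> module_hom R M N" for f
    using that by (auto simp: mem module_hom_def)
  have add: "(\<lambda>x\<in>carrier M. f x \<oplus>\<^bsub>N\<^esub> g x) \<in> carrier ?H"
    if "f \<in> module_hom R M N" "g \<in> module_hom R M N" for f g
    by (rule restr, rule module_homI)
      (use module_homD[OF that(1)] module_homD[OF that(2)] in
        \<open>auto simp: N.M.a_ac N.smult_r_distr\<close>)
  have smult: "(\<lambda>x\<in>carrier M. r \<odot>\<^bsub>N\<^esub> f x) \<in> carrier ?H"
    if "f \<in> module_hom R M N" "r \<in> carrier R" for f r
    by (rule restr[OF smult_module_hom[OF assms that]])
  have zero: "(\<lambda>x\<in>carrier M. \<zero>\<^bsub>N\<^esub>) \<in> carrier ?H"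
    using restr[OF const_zero_module_hom[OF assms(2)]] by simp
  have ab: "abelian_group ?H"
  proof (rule abelian_groupI)
    fix f g assume "f \<in> carrier ?H" "g \<in> carrier ?H"
    then have "f \<in> module_hom R M N" "g \<in> module_hom R M N" by (auto simp: mem)
    note fg = this module_homD(1)[OF this(1)] module_homD(1)[OF this(2)]
    show "f \<oplus>\<^bsub>?H\<^esub> g \<in> carrier ?H" using add[OF fg(1,2)] by (simp add: Hom_module_def)
    show "f \<oplus>\<^bsub>?H\<^esub> g = g \<oplus>\<^bsub>?H\<^esub> f"
      using fg(3,4) by (auto simp: Hom_module_def N.M.a_comm intro!: restrict_ext)
  next
    show "\<zero>\<^bsub>?H\<^esub> \<in> carrier ?H" using zero by (simp add: Hom_module_def)
  next
    fix f g h assume "f \<in> carrier ?H" "g \<in> carrier ?H" "h \<in> carrier ?H"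
    then have "\<And>x. x \<in> carrier M \<Longrightarrow> f x \<in> carrier N" "\<And>x. x \<in> carrier M \<Longrightarrow> g x \<in> carrier N"
      "\<And>x. x \<in> carrier M \<Longrightarrow> h x \<in> carrier N" by (auto simp: mem module_hom_def)
    then show "f \<oplus>\<^bsub>?H\<^esub> g \<oplus>\<^bsub>?H\<^esub> h = f \<oplus>\<^bsub>?H\<^esub> (g \<oplus>\<^bsub>?H\<^esub> h)"
      by (auto simp: Hom_module_def N.M.a_assoc intro!: restrict_ext)
  next
    fix f assume "f \<in> carrier ?H"
    then have f: "f \<in> module_hom R M N" "f \<in> extensional (carrier M)" by (auto simp: mem)
    note fc = module_homD(1)[OF f(1)]
    show "\<zero>\<^bsub>?H\<^esub> \<oplus>\<^bsub>?H\<^esub> f = f"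
      by (rule extensionalityI[OF _ f(2)]) (auto simp: Hom_module_def fc)
    let ?g = "\<lambda>x\<in>carrier M. (\<ominus> \<one>) \<odot>\<^bsub>N\<^esub> f x"
    have "?g \<oplus>\<^bsub>?H\<^esub> f = \<zero>\<^bsub>?H\<^esub>"
      by (auto simp: Hom_module_def fc N.smult_l_minus N.M.l_neg intro!: restrict_ext)
    moreover have "?g \<in> carrier ?H" by (rule smult[OF f(1)]) simp
    ultimately show "\<exists>g\<in>carrier ?H. g \<oplus>\<^bsub>?H\<^esub> f = \<zero>\<^bsub>?H\<^esub>" by blast
  qed
  have fc: "f x \<in> carrier N" if "f \<in> carrier ?H" "x \<in> carrier M" for f x
    using that by (auto simp: mem module_hom_def)
  show ?thesis
  proof (rule moduleI[OF M.is_cring ab])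
    fix r f assume "r \<in> carrier R" "f \<in> carrier ?H"
    then show "r \<odot>\<^bsub>?H\<^esub> f \<in> carrier ?H" using smult[of f r] by (simp add: Hom_module_def)
  next
    fix f assume "f \<in> carrier ?H"
    then show "\<one> \<odot>\<^bsub>?H\<^esub> f = f"
      by (intro extensionalityI[of _ "carrier M"]) (auto simp: mem fc, auto simp: Hom_module_def fc[simplified Hom_module_def])
  qed (auto simp: Hom_module_def fc[simplified Hom_module_def]
      N.smult_l_distr N.smult_r_distr N.smult_assoc1 intro!: restrict_ext)
qed

section \<open>Kernels, images and cohomology\<close>

lemma kernel_submodule:
  assumes "module R M" "module R N" "f \<in> module_hom R M N"
  shows "submodule (kernel_of M N f) R M"
proof -
  interpret M: module R M by fact
  interpret N: module R N by fact
  show ?thesis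
    by (rule submodule_lin_combI[OF assms(1)])
      (use module_homD[OF assms(3)] module_hom_zero[OF assms] in \<open>auto simp: kernel_of_def\<close>)
qed

lemma image_submodule:
  assumes "module R M" "module R N" "f \<in> module_hom R M N"
  shows "submodule (f ` carrier M) R N"
proof -
  interpret M: module R M by fact
  interpret N: module R N by fact
  note f = module_homD[OF assms(3)]
  show ?thesis
  proof (rule submodule_lin_combI[OF assms(2)])
    show "\<zero>\<^bsub>N\<^esub> \<in> f ` carrier M" using module_hom_zero[OF assms] M.zero_closed by (metis imageI)
    show "r \<odot>\<^bsub>N\<^esub> x \<oplus>\<^bsub>N\<^esub> s \<odot>\<^bsub>N\<^esub> y \<in> f ` carrier M"
      if "r \<in> carrier R" "s \<in> carrier R" "x \<in> f ` carrier M" "y \<in> f ` carrier M" for r x s y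
    proof -
      obtain x' y' where "x' \<in> carrier M" "y' \<in> carrier M" "x = f x'" "y = f y'"
        using \<open>x \<in> f ` carrier M\<close> \<open>y \<in> f ` carrier M\<close> by blast
      then have "r \<odot>\<^bsub>N\<^esub> x \<oplus>\<^bsub>N\<^esub> s \<odot>\<^bsub>N\<^esub> y = f (r \<odot>\<^bsub>M\<^esub> x' \<oplus>\<^bsub>M\<^esub> s \<odot>\<^bsub>M\<^esub> y')"
        using that f by simp
      then show ?thesis using that \<open>x' \<in> carrier M\<close> \<open>y' \<in> carrier M\<close> by auto
    qed
  qed (use f in auto)
qed

text \<open>\<open>cohomology\<close> divides a record whose carrier has been cut down to a kernel,
  so the coboundaries must be a submodule of that record and not only of the ambient module.\<close>

lemma submodule_restrict_carrier:
  assumes "module R M" "submodule A R M" "submodule B R M" "A \<subseteq> B"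
  shows "submodule A R (M\<lparr>carrier := B\<rparr>)"
proof -
  interpret M: module R M by fact
  show ?thesis
    by (rule submodule_lin_combI[OF submodule.submodule_is_module[OF assms(3,1)]])
      (use assms(4) submodule_zero[OF assms(2)] M.submoduleE[OF assms(2)] in auto)
qed

lemma cohomology_submodules:
  assumes "\<And>i. module R (C i)" "\<And>i. d i \<in> module_hom R (C i) (C (Suc i))"
    and "\<And>i. \<forall>x\<in>carrier (C i). d (Suc i) (d i x) = \<zero>\<^bsub>C (Suc (Suc i))\<^esub>"
  shows "submodule (kernel_of (C n) (C (Suc n)) (d n)) R (C n)"
    and "submodule (coboundaries C d n) R (C n)"
    and "coboundaries C d n \<subseteq> kernel_of (C n) (C (Suc n)) (d n)"
    and "module R ((C n)\<lparr>carrier := kernel_of (C n) (C (Suc n)) (d n)\<rparr>)"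
    and "submodule (coboundaries C d n) R ((C n)\<lparr>carrier := kernel_of (C n) (C (Suc n)) (d n)\<rparr>)"
proof -
  let ?K = "kernel_of (C n) (C (Suc n)) (d n)"
  show K: "submodule ?K R (C n)" by (rule kernel_submodule[OF assms(1,1,2)])
  show B: "submodule (coboundaries C d n) R (C n)"
  proof (cases n)
    case 0
    interpret C: module R "C 0" by (rule assms)
    show ?thesis by (auto simp: 0 coboundaries_def intro: submodule_lin_combI[OF assms(1)])
  next
    case (Suc m)
    then show ?thesis using image_submodule[OF assms(1,1,2)] by (simp add: coboundaries_def)
  qed
  show sub: "coboundaries C d n \<subseteq> ?K"
  proof (cases n)
    case 0
    interpret C: module R "C 0" by (rule assms)
    show ?thesis using module_hom_zero[OF assms(1,1,2)] by (simp add: 0 coboundaries_def kernel_of_def)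
  next
    case (Suc m)
    then show ?thesis using module_homD(1)[OF assms(2)] assms(3) by (auto simp: coboundaries_def kernel_of_def)
  qed
  show "module R ((C n)\<lparr>carrier := ?K\<rparr>)" by (rule submodule.submodule_is_module[OF K assms(1)])
  show "submodule (coboundaries C d n) R ((C n)\<lparr>carrier := ?K\<rparr>)"
    by (rule submodule_restrict_carrier[OF assms(1) B K sub])
qed

definition ext_cocycles ::
  "('a, 'r) ring_scheme \<Rightarrow> (nat \<Rightarrow> ('a, 'f) module) \<Rightarrow> (nat \<Rightarrow> 'f \<Rightarrow> 'f) \<Rightarrow> nat \<Rightarrow> ('a, 'n) module \<Rightarrow>
   ('f \<Rightarrow> 'n) set" where
  "ext_cocycles R P \<delta> n N =
     {u \<in> module_hom R (P n) N. \<forall>x\<in>carrier (P (Suc n)). u (\<delta> n x) = \<zero>\<^bsub>N\<^esub>}"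

text \<open>Cocycles are not required to be extensional here, so that they can be written as plain
  \<open>\<lambda>\<close>-terms; hence the congruence assumption on \<open>T\<close>.\<close>

lemma Ext_associated_primes:
  assumes P: "\<And>i. module R (P i)" "\<And>i. \<delta> i \<in> module_hom R (P (Suc i)) (P i)"
    and PP: "\<And>i. \<forall>x\<in>carrier (P (Suc (Suc i))). \<delta> i (\<delta> (Suc i) x) = \<zero>\<^bsub>P i\<^esub>"
    and N: "module R N"
    and T_cocycle: "T \<subseteq> ext_cocycles R P \<delta> n N"
    and T_zero: "(\<lambda>x. \<zero>\<^bsub>N\<^esub>) \<in> T"
    and T_comb: "\<And>r u s v. r \<in> carrier R \<Longrightarrow> s \<in> carrier R \<Longrightarrow> u \<in> T \<Longrightarrow> v \<in> T \<Longrightarrow>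
      lin_comb N r u s v \<in> T"
    and T_cong: "\<And>u v. u \<in> T \<Longrightarrow> v \<in> module_hom R (P n) N \<Longrightarrow>
      (\<And>x. x \<in> carrier (P n) \<Longrightarrow> u x = v x) \<Longrightarrow> v \<in> T"
    and T_cobound: "\<And>m v. n = Suc m \<Longrightarrow> v \<in> module_hom R (P m) N \<Longrightarrow> (\<lambda>x. v (\<delta> m x)) \<in> T"
  obtains L where "submodule L R (Ext_module R P \<delta> n N)"
    and "\<And>u p. u \<in> ext_cocycles R P \<delta> n N \<Longrightarrow> primeideal p R \<Longrightarrow>
      p = {r \<in> carrier R. (\<lambda>x. r \<odot>\<^bsub>N\<^esub> u x) \<in> T} \<Longrightarrow>
      p \<in> associated_primes R (quotient_module (Ext_module R P \<delta> n N) L)"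
proof -
  interpret N: module R N by fact
  let ?C = "\<lambda>i. Hom_module R (P i) N"
  let ?d = "\<lambda>i f. compose (carrier (P (Suc i))) f (\<delta> i)"
  let ?B = "coboundaries ?C ?d n"
  let ?Z = "(?C n)\<lparr>carrier := kernel_of (?C n) (?C (Suc n)) (?d n)\<rparr>"
  have memC: "f \<in> carrier (?C i) \<longleftrightarrow> f \<in> module_hom R (P i) N \<and> f \<in> extensional (carrier (P i))" for f i
    by (simp add: Hom_module_def)
  have C: "module R (?C i)" for i by (rule Hom_module_module[OF P(1) N])
  have restr: "restrict f (carrier (P i)) \<in> carrier (?C i)" if "f \<in> module_hom R (P i) N" for f i
  proof -
    interpret P: module R "P i" by (rule P)
    show ?thesis using that by (auto simp: memC module_hom_def)
  qed
  have comp: "?d i f = (\<lambda>x\<in>carrier (P (Suc i)). f (\<delta> i x))" for i f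
    by (simp add: compose_def)
  note \<delta> = module_homD[OF P(2)]
  have d: "?d i \<in> module_hom R (?C i) (?C (Suc i))" for i
  proof (rule module_homI)
    fix f assume "f \<in> carrier (?C i)"
    then show "?d i f \<in> carrier (?C (Suc i))"
      unfolding comp by (intro restr module_hom_comp[OF P(2)]) (simp add: memC)
  qed (auto simp: comp Hom_module_def \<delta> intro!: restrict_ext)
  have dd: "\<forall>f\<in>carrier (?C i). ?d (Suc i) (?d i f) = \<zero>\<^bsub>?C (Suc (Suc i))\<^esub>" for i
    using module_hom_zero[OF P(1) N, of _ i]
    by (auto simp: comp memC \<delta> PP Hom_module_def intro!: restrict_ext)
  note co = cohomology_submodules[of R ?C ?d n, OF C d dd]
  have memZ: "f \<in> carrier ?Z \<longleftrightarrow> f \<in> ext_cocycles R P \<delta> n N \<and> f \<in> extensional (carrier (P n))" for f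
    by (auto simp: kernel_of_def memC ext_cocycles_def comp Hom_module_def restrict_eq_iff)
  \<comment> \<open>\<open>Hom_module\<close> has only extensional elements. By
    \<open>T_cong\<close>, restricting to the carrier of \<open>P n\<close> sends \<open>T\<close>
    into \<open>T'\<close> and does not affect membership in \<open>T\<close>.\<close>
  define T' where "T' = {f \<in> T. f \<in> extensional (carrier (P n))}"
  have T_hom: "f \<in> module_hom R (P n) N" if "f \<in> T" for f
    using that T_cocycle by (auto simp: ext_cocycles_def)
  have restr_hom: "restrict f (carrier (P n)) \<in> module_hom R (P n) N" if "f \<in> module_hom R (P n) N" for f
    using restr[OF that] by (simp add: memC)
  have restrT: "restrict f (carrier (P n)) \<in> T'" if "f \<in> T" for f
    using T_cong[OF that restr_hom[OF T_hom[OF that]]] by (simp add: T'_def)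
  have T': "submodule T' R ?Z"
  proof (rule submodule_lin_combI[OF co(4)])
    show "T' \<subseteq> carrier ?Z" using T_cocycle by (auto simp only: memZ T'_def)
    show "\<zero>\<^bsub>?Z\<^esub> \<in> T'" using restrT[OF T_zero] by (simp add: Hom_module_def)
    fix r f s g assume "r \<in> carrier R" "s \<in> carrier R" "f \<in> T'" "g \<in> T'"
    then have "restrict (lin_comb N r f s g) (carrier (P n)) \<in> T'"
      by (intro restrT T_comb) (auto simp: T'_def)
    moreover have "r \<odot>\<^bsub>?Z\<^esub> f \<oplus>\<^bsub>?Z\<^esub> s \<odot>\<^bsub>?Z\<^esub> g = restrict (lin_comb N r f s g) (carrier (P n))"
      by (auto simp: Hom_module_def lin_comb_def intro!: restrict_ext)
    ultimately show "r \<odot>\<^bsub>?Z\<^esub> f \<oplus>\<^bsub>?Z\<^esub> s \<odot>\<^bsub>?Z\<^esub> g \<in> T'" by simp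
  qed
  have BT: "?B \<subseteq> T'"
  proof (cases n)
    case 0
    then show ?thesis using restrT[OF T_zero] by (simp add: coboundaries_def Hom_module_def)
  next
    case (Suc m)
    then show ?thesis using restrT[OF T_cobound[OF Suc]]
      by (auto simp: coboundaries_def comp memC)
  qed
  \<comment> \<open>Here \<open>M\<close> is the module of extensional cocycles, so that the
    required \<open>L\<close> is \<open>T'\<close> modulo coboundaries.\<close>
  note main = associated_primes_quotient_quotient[OF co(4,5) T' BT]
  show thesis
  proof (rule that)
    show "submodule ((\<lambda>x. ?B +>\<^bsub>?Z\<^esub> x) ` T') R (Ext_module R P \<delta> n N)"
      unfolding Ext_module_def cohomology_def by (rule main(1))
    fix u p assume u: "u \<in> ext_cocycles R P \<delta> n N" and p: "primeideal p R"
      "p = {r \<in> carrier R. (\<lambda>x. r \<odot>\<^bsub>N\<^esub> u x) \<in> T}"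
    have uh: "u \<in> module_hom R (P n) N" using u by (simp add: ext_cocycles_def)
    let ?u = "restrict u (carrier (P n))"
    have uZ: "?u \<in> carrier ?Z"
      unfolding memZ using u restr_hom[OF uh] \<delta>(1) by (auto simp: ext_cocycles_def)
    have "r \<odot>\<^bsub>?Z\<^esub> ?u \<in> T' \<longleftrightarrow> (\<lambda>x. r \<odot>\<^bsub>N\<^esub> u x) \<in> T" if r: "r \<in> carrier R" for r
    proof -
      note hom = smult_module_hom[OF P(1) N uh r]
      have eq: "r \<odot>\<^bsub>?Z\<^esub> ?u = restrict (\<lambda>x. r \<odot>\<^bsub>N\<^esub> u x) (carrier (P n))"
        by (auto simp: Hom_module_def intro!: restrict_ext)
      show ?thesis unfolding eq using restrT T_cong[OF _ hom] by (auto simp: T'_def)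
    qed
    then have "p = {r \<in> carrier R. r \<odot>\<^bsub>?Z\<^esub> ?u \<in> T'}" unfolding p(2) by blast
    then show "p \<in> associated_primes R (quotient_module (Ext_module R P \<delta> n N) ((\<lambda>x. ?B +>\<^bsub>?Z\<^esub> x) ` T'))"
      unfolding Ext_module_def cohomology_def by (rule main(2)[OF uZ p(1)])
  qed
qed

section \<open>Projective modules\<close>

text \<open>Functions of finite support. With \<open>Y\<close> the carrier of a module over the type
  \<open>'f\<close>, this has the type \<open>'f \<Rightarrow> 'a\<close> of the test modules
  \<open>A\<close> in \<open>projective_module\<close>.\<close>

definition free_module :: "('a, 'r) ring_scheme \<Rightarrow> 'y set \<Rightarrow> ('a, 'y \<Rightarrow> 'a) module" where
  "free_module R Y =
     \<lparr>carrier = {c. (\<forall>y. c y \<in> carrier R) \<and> finite {y. c y \<noteq> \<zero>\<^bsub>R\<^esub>} \<and> {y. c y \<noteq> \<zero>\<^bsub>R\<^esub>} \<subseteq> Y},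
      monoid.mult = undefined, one = undefined, ring.zero = (\<lambda>y. \<zero>\<^bsub>R\<^esub>),
      add = (\<lambda>c c' y. c y \<oplus>\<^bsub>R\<^esub> c' y), smult = (\<lambda>r c y. r \<otimes>\<^bsub>R\<^esub> c y)\<rparr>"

definition free_eval ::
  "('a, 'r) ring_scheme \<Rightarrow> ('a, 'n) module \<Rightarrow> ('y \<Rightarrow> 'n) \<Rightarrow> ('y \<Rightarrow> 'a) \<Rightarrow> 'n" where
  "free_eval R N b c = finsum N (\<lambda>y. c y \<odot>\<^bsub>N\<^esub> b y) {y. c y \<noteq> \<zero>\<^bsub>R\<^esub>}"

lemma free_module_module:
  fixes R (structure)
  assumes "cring R"
  shows "module R (free_module R Y)"
proof -
  interpret R: cring R by fact
  let ?F = "free_module R Y"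
  have add: "c \<oplus>\<^bsub>?F\<^esub> c' \<in> carrier ?F" if "c \<in> carrier ?F" "c' \<in> carrier ?F" for c c'
  proof -
    have "{y. c y \<oplus> c' y \<noteq> \<zero>} \<subseteq> {y. c y \<noteq> \<zero>} \<union> {y. c' y \<noteq> \<zero>}"
      by auto
    with that show ?thesis by (auto simp: free_module_def intro: finite_subset)
  qed
  have smult: "r \<odot>\<^bsub>?F\<^esub> c \<in> carrier ?F" if "r \<in> carrier R" "c \<in> carrier ?F" for r c
  proof -
    have "{y. r \<otimes> c y \<noteq> \<zero>} \<subseteq> {y. c y \<noteq> \<zero>}" using that by auto
    with that show ?thesis by (auto simp: free_module_def intro: finite_subset)
  qed
  have ab: "abelian_group ?F"
  proof (rule abelian_groupI)
    fix c assume c: "c \<in> carrier ?F"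
    have "(\<ominus> \<one>) \<odot>\<^bsub>?F\<^esub> c \<oplus>\<^bsub>?F\<^esub> c = \<zero>\<^bsub>?F\<^esub>"
      using c by (auto simp: free_module_def R.l_minus R.l_neg)
    moreover have "(\<ominus> \<one>) \<odot>\<^bsub>?F\<^esub> c \<in> carrier ?F" using c by (intro smult) auto
    ultimately show "\<exists>c'\<in>carrier ?F. c' \<oplus>\<^bsub>?F\<^esub> c = \<zero>\<^bsub>?F\<^esub>" by blast
  qed (simp_all only: add, auto simp: free_module_def R.a_ac)
  show ?thesis
    by (rule moduleI[OF assms ab])
      (simp_all only: smult, auto simp: free_module_def R.l_distr R.r_distr R.m_assoc)
qed

text \<open>The support of a function changes under addition and scalar multiplication. Terms
  outside it vanish, so sums over different supports can be compared over one common finite set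
  \<open>W\<close>.\<close>

lemma free_eval_eq:
  fixes R (structure)
  assumes "module R N" "c \<in> carrier (free_module R Y)" "b \<in> Y \<rightarrow> carrier N"
    and "finite W" "W \<subseteq> Y" "{y. c y \<noteq> \<zero>} \<subseteq> W"
  shows "free_eval R N b c = finsum N (\<lambda>y. c y \<odot>\<^bsub>N\<^esub> b y) W"
proof -
  interpret N: module R N by fact
  have b: "y \<in> W \<Longrightarrow> b y \<in> carrier N" for y using assms(3,5) by auto
  show ?thesis unfolding free_eval_def
    by (rule N.M.add.finprod_mono_neutral_cong_left)
      (use assms(2,4,6) b in \<open>auto simp: free_module_def\<close>)
qed

lemma free_eval_module_hom:
  fixes R (structure)
  assumes "module R N" "b \<in> Y \<rightarrow> carrier N"
  shows "free_eval R N b \<in> module_hom R (free_module R Y) N"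
proof -
  interpret N: module R N by fact
  let ?F = "free_module R Y"
  interpret F: module R ?F by (rule free_module_module) (rule N.is_cring)
  let ?s = "\<lambda>c. {y. c y \<noteq> \<zero>}"
  have c: "c y \<in> carrier R" "finite (?s c)" "?s c \<subseteq> Y" if "c \<in> carrier ?F" for c y
    using that by (auto simp: free_module_def)
  have b0: "b y \<in> carrier N" if "c \<in> carrier ?F" "c y \<noteq> \<zero>" for c y
    using that c(3) assms(2) by auto
  have eq: "free_eval R N b c = finsum N (\<lambda>y. c y \<odot>\<^bsub>N\<^esub> b y) W"
    if "c \<in> carrier ?F" "finite W" "W \<subseteq> Y" "?s c \<subseteq> W" for c W
    by (rule free_eval_eq) fact+
  show ?thesis
  proof (rule module_homI)
    fix c assume "c \<in> carrier ?F"
    then show "free_eval R N b c \<in> carrier N"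
      unfolding free_eval_def using c b0 by (auto intro!: N.M.finsum_closed)
  next
    fix c c' assume cc: "c \<in> carrier ?F" "c' \<in> carrier ?F"
    let ?W = "?s c \<union> ?s c'"
    have W: "finite ?W" "?W \<subseteq> Y" using c cc by auto
    then have b: "b y \<in> carrier N" if "y \<in> ?W" for y using that assms(2) by auto
    have eqs: "free_eval R N b c = finsum N (\<lambda>y. c y \<odot>\<^bsub>N\<^esub> b y) ?W"
      "free_eval R N b c' = finsum N (\<lambda>y. c' y \<odot>\<^bsub>N\<^esub> b y) ?W"
      by (rule eq; use cc W in auto)+
    have "free_eval R N b (c \<oplus>\<^bsub>?F\<^esub> c') = finsum N (\<lambda>y. (c \<oplus>\<^bsub>?F\<^esub> c') y \<odot>\<^bsub>N\<^esub> b y) ?W"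
    proof (rule eq)
      show "c \<oplus>\<^bsub>?F\<^esub> c' \<in> carrier ?F" using cc by simp
    qed (use W in \<open>auto simp: free_module_def\<close>)
    also have "\<dots> = finsum N (\<lambda>y. c y \<odot>\<^bsub>N\<^esub> b y \<oplus>\<^bsub>N\<^esub> c' y \<odot>\<^bsub>N\<^esub> b y) ?W"
      by (rule N.M.finsum_cong') (use b c(1) cc in \<open>auto simp: free_module_def N.smult_l_distr\<close>)
    also have "\<dots> = finsum N (\<lambda>y. c y \<odot>\<^bsub>N\<^esub> b y) ?W \<oplus>\<^bsub>N\<^esub> finsum N (\<lambda>y. c' y \<odot>\<^bsub>N\<^esub> b y) ?W"
      by (rule N.M.finsum_addf) (use b c(1) cc in auto)
    finally show "free_eval R N b (c \<oplus>\<^bsub>?F\<^esub> c') = free_eval R N b c \<oplus>\<^bsub>N\<^esub> free_eval R N b c'"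
      unfolding eqs .
  next
    fix r c assume r: "r \<in> carrier R" and cc: "c \<in> carrier ?F"
    have b: "b y \<in> carrier N" if "y \<in> ?s c" for y using that assms(2) c(3)[OF cc] by auto
    have "free_eval R N b (r \<odot>\<^bsub>?F\<^esub> c) = finsum N (\<lambda>y. (r \<odot>\<^bsub>?F\<^esub> c) y \<odot>\<^bsub>N\<^esub> b y) (?s c)"
    proof (rule eq)
      show "r \<odot>\<^bsub>?F\<^esub> c \<in> carrier ?F" using r cc by simp
    qed (use c(2,3)[OF cc] r in \<open>auto simp: free_module_def\<close>)
    also have "\<dots> = finsum N (\<lambda>y. r \<odot>\<^bsub>N\<^esub> (c y \<odot>\<^bsub>N\<^esub> b y)) (?s c)"
      by (rule N.M.finsum_cong') (use b c(1)[OF cc] r in \<open>auto simp: free_module_def N.smult_assoc1\<close>)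
    also have "\<dots> = r \<odot>\<^bsub>N\<^esub> finsum N (\<lambda>y. c y \<odot>\<^bsub>N\<^esub> b y) (?s c)"
      by (rule N.finsum_smult_ldistr[symmetric]) (use b c[OF cc] r in auto)
    finally show "free_eval R N b (r \<odot>\<^bsub>?F\<^esub> c) = r \<odot>\<^bsub>N\<^esub> free_eval R N b c"
      unfolding free_eval_def .
  qed
qed

lemma module_hom_finsum:
  assumes "module R M" "module R N" "\<phi> \<in> module_hom R M N" "finite W" "g \<in> W \<rightarrow> carrier M"
  shows "\<phi> (finsum M g W) = finsum N (\<lambda>y. \<phi> (g y)) W"
proof -
  interpret M: module R M by fact
  interpret N: module R N by fact
  show ?thesis using assms(4,5)
  proof induction
    case empty
    then show ?case using module_hom_zero[OF assms(1-3)] by simp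
  next
    case (insert y W)
    then have "finsum M g W \<in> carrier M" by auto
    then show ?case using insert module_homD[OF assms(3)] by (auto simp: Pi_iff)
  qed
qed

lemma free_eval_comp:
  fixes R (structure)
  assumes "module R M" "module R N" "\<phi> \<in> module_hom R M N" "b \<in> Y \<rightarrow> carrier M"
    and "c \<in> carrier (free_module R Y)"
  shows "\<phi> (free_eval R M b c) = free_eval R N (\<lambda>y. \<phi> (b y)) c"
proof -
  interpret M: module R M by fact
  interpret N: module R N by fact
  have *: "c y \<in> carrier R" "c y \<noteq> \<zero> \<Longrightarrow> b y \<in> carrier M" "finite {y. c y \<noteq> \<zero>}" for y
    using assms(4,5) by (auto simp: free_module_def)
  have "\<phi> (free_eval R M b c) = finsum N (\<lambda>y. \<phi> (c y \<odot>\<^bsub>M\<^esub> b y)) {y. c y \<noteq> \<zero>}"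
    unfolding free_eval_def by (rule module_hom_finsum[OF assms(1-3)]) (use * in auto)
  also have "\<dots> = free_eval R N (\<lambda>y. \<phi> (b y)) c"
    unfolding free_eval_def
    by (rule N.M.finsum_cong') (use * module_homD[OF assms(3)] in auto)
  finally show ?thesis .
qed

text \<open>The test modules in the definition of projectivity suffice to split the canonical surjection
  from the free module on the elements of \<open>Q\<close>; a map out of \<open>Q\<close> is then lifted on basis elements.\<close>

lemma projective_lift:
  fixes R (structure) and Q :: "('a, 'f) module" and A :: "('a, 'm) module" and B :: "('a, 'n) module"
  assumes Q: "projective_module R Q" and A: "module R A" and B: "module R B"
    and \<phi>: "\<phi> \<in> module_hom R A B" and g: "g \<in> module_hom R Q B"
    and sub: "\<And>x. x \<in> carrier Q \<Longrightarrow> g x \<in> \<phi> ` carrier A"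
  obtains h where "h \<in> module_hom R Q A" "\<And>x. x \<in> carrier Q \<Longrightarrow> \<phi> (h x) = g x"
proof -
  have Qm: "module R Q" using Q by (simp add: projective_module_def)
  interpret Q: module R Q by fact
  let ?F = "free_module R (carrier Q)"
  have F: "module R ?F" by (rule free_module_module) (rule Q.is_cring)
  interpret F: module R ?F by fact
  let ?p = "free_eval R Q (\<lambda>x. x)"
  have p: "?p \<in> module_hom R ?F Q" by (rule free_eval_module_hom[OF Qm]) auto
  have onto: "?p ` carrier ?F = carrier Q"
  proof
    show "?p ` carrier ?F \<subseteq> carrier Q" using module_homD(1)[OF p] by auto
    show "carrier Q \<subseteq> ?p ` carrier ?F"
    proof
      fix x assume x: "x \<in> carrier Q"
      \<comment> \<open>The basis vector at \<open>x\<close>.\<close>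
      let ?c = "\<lambda>y. if y = x then \<one> else \<zero>"
      have c: "?c \<in> carrier ?F" using x by (auto simp: free_module_def)
      have "?p ?c = finsum Q (\<lambda>y. ?c y \<odot>\<^bsub>Q\<^esub> y) {x}"
        by (rule free_eval_eq[OF Qm c]) (use x in auto)
      also have "\<dots> = x" using x by simp
      finally show "x \<in> ?p ` carrier ?F" using c by (metis imageI)
    qed
  qed
  have id: "(\<lambda>x. x) \<in> module_hom R Q Q" by (rule module_homI) auto
  \<comment> \<open>The identity of \<open>Q\<close> is lifted along \<open>?p\<close>, with
    \<open>Q\<close> itself as the target of the test pair. This makes \<open>s\<close> a section of
    \<open>?p\<close>.\<close>
  obtain s where s: "s \<in> module_hom R Q ?F" "\<And>x. x \<in> carrier Q \<Longrightarrow> ?p (s x) = x"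
    using Q F Qm p onto id unfolding projective_module_def by blast
  define a where "a x = (SOME y. y \<in> carrier A \<and> \<phi> y = g x)" for x
  have a: "a x \<in> carrier A" "\<phi> (a x) = g x" if "x \<in> carrier Q" for x
  proof -
    have "\<exists>y. y \<in> carrier A \<and> \<phi> y = g x" using sub[OF that] by (metis imageE)
    then show "a x \<in> carrier A" "\<phi> (a x) = g x" unfolding a_def by (metis (mono_tags, lifting) someI)+
  qed
  \<comment> \<open>The basis element at \<open>y\<close> is sent to a chosen preimage
    \<open>a y\<close> of \<open>g y\<close>. Applying \<open>\<phi>\<close> gives the linear
    extension of \<open>g\<close>, which is \<open>g\<close> after \<open>?p\<close>, and
    \<open>?p\<close> undoes \<open>s\<close>.\<close>
  let ?h = "\<lambda>x. free_eval R A a (s x)"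
  have "?h \<in> module_hom R Q A"
    by (rule module_hom_comp[OF s(1)]) (rule free_eval_module_hom[OF A], use a in auto)
  moreover have "\<phi> (?h x) = g x" if x: "x \<in> carrier Q" for x
  proof -
    have sx: "s x \<in> carrier ?F" by (rule module_homD(1)[OF s(1) x])
    have "\<phi> (?h x) = free_eval R B (\<lambda>y. \<phi> (a y)) (s x)"
      by (rule free_eval_comp[OF A B \<phi> _ sx]) (use a in auto)
    also have "\<dots> = free_eval R B g (s x)"
    proof -
      interpret B: module R B by fact
      show ?thesis unfolding free_eval_def
        by (rule B.M.finsum_cong')
          (use sx a(2) module_homD(1)[OF g] in \<open>auto simp: free_module_def subset_eq\<close>)
    qed
    also have "\<dots> = g (?p (s x))"
      by (rule free_eval_comp[OF Qm B g _ sx, symmetric]) auto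
    finally show ?thesis using s(2)[OF x] by simp
  qed
  ultimately show thesis by (rule that)
qed

section \<open>Baer's criterion\<close>

text \<open>A map from an ideal to \<open>E\<close> extends to the whole ring exactly if it is
  multiplication by some \<open>e\<close>, the value of the extension at one. Stated in this way
  with a function \<open>\<phi>\<close> constrained only on \<open>J\<close>, injectivity involves
  no test module and no type for one.\<close>

definition baer_module :: "('a, 'r) ring_scheme \<Rightarrow> ('a, 'c) module \<Rightarrow> bool" where
  "baer_module R E \<longleftrightarrow>
     (\<forall>J \<phi>. ideal J R \<and> \<phi> \<in> J \<rightarrow> carrier E \<and>
        (\<forall>x\<in>J. \<forall>y\<in>J. \<phi> (x \<oplus>\<^bsub>R\<^esub> y) = \<phi> x \<oplus>\<^bsub>E\<^esub> \<phi> y) \<and>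
        (\<forall>r\<in>carrier R. \<forall>x\<in>J. \<phi> (r \<otimes>\<^bsub>R\<^esub> x) = r \<odot>\<^bsub>E\<^esub> \<phi> x) \<longrightarrow>
        (\<exists>e\<in>carrier E. \<forall>x\<in>J. \<phi> x = x \<odot>\<^bsub>E\<^esub> e))"

lemma ideal_lin_combI:
  fixes R (structure)
  assumes "cring R" "J \<subseteq> carrier R" "\<zero> \<in> J"
    and comb: "\<And>r x s y. r \<in> carrier R \<Longrightarrow> s \<in> carrier R \<Longrightarrow> x \<in> J \<Longrightarrow> y \<in> J \<Longrightarrow>
      r \<otimes> x \<oplus> s \<otimes> y \<in> J"
  shows "ideal J R"
proof -
  interpret R: cring R by fact
  have J: "x \<in> J \<Longrightarrow> x \<in> carrier R" for x using assms(2) by auto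
  have smult: "r \<otimes> x \<in> J" if "r \<in> carrier R" "x \<in> J" for r x
    using comb[of r \<zero> x x] that J by simp
  show ?thesis
  proof (rule idealI)
    show "subgroup J (add_monoid R)"
    proof (rule group.subgroupI[OF R.a_group])
      fix x y assume xy: "x \<in> J" "y \<in> J"
      show "inv\<^bsub>add_monoid R\<^esub> x \<in> J"
        using smult[of "\<ominus> \<one>" x] xy J by (simp add: R.l_minus a_inv_def[symmetric])
      show "x \<otimes>\<^bsub>add_monoid R\<^esub> y \<in> J" using comb[of \<one> \<one> x y] xy J by simp
    qed (use assms in auto)
    show "r \<otimes> x \<in> J" "x \<otimes> r \<in> J" if "x \<in> J" "r \<in> carrier R" for x r
      using smult[OF that(2,1)] R.m_comm[OF that(2) J[OF that(1)]] by simp_all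
  qed (rule R.ring_axioms)
qed

text \<open>The lifting property is applied to the inclusion of \<open>J\<close> in the ring.
  \<open>mk\<close> copies both into the test type by \<open>Inl\<close>, and \<open>e\<close> is
  the value of the extension at one.\<close>

lemma injective_module_baer:
  fixes R :: "('a, 'r) ring_scheme" (structure) and E :: "('a, 'c) module"
  assumes "injective_module R E"
  shows "baer_module R E"
  unfolding baer_module_def
proof (intro allI impI, elim conjE)
  fix J \<phi> assume J: "ideal J R" and \<phi>: "\<phi> \<in> J \<rightarrow> carrier E"
    "\<forall>x\<in>J. \<forall>y\<in>J. \<phi> (x \<oplus> y) = \<phi> x \<oplus>\<^bsub>E\<^esub> \<phi> y"
    "\<forall>r\<in>carrier R. \<forall>x\<in>J. \<phi> (r \<otimes> x) = r \<odot>\<^bsub>E\<^esub> \<phi> x"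
  have E: "module R E" using assms by (simp add: injective_module_def)
  interpret E: module R E by fact
  interpret J: ideal J R by fact
  define mk where "mk = (\<lambda>I. \<lparr>carrier = Inl ` I, monoid.mult = undefined, one = undefined,
    ring.zero = Inl \<zero>, add = (\<lambda>x y. Inl (projl x \<oplus> projl y)),
    smult = (\<lambda>r x. Inl (r \<otimes> projl x))\<rparr> :: ('a, 'a + 'c) module)"
  have mk: "module R (mk I)" if "ideal I R" for I
  proof -
    interpret I: ideal I R by fact
    note c = I.Icarr
    have ab: "abelian_group (mk I)"
    proof (rule abelian_groupI)
      fix x assume "x \<in> carrier (mk I)"
      then obtain y where y: "y \<in> I" "x = Inl y" by (auto simp: mk_def)
      then have "Inl (\<ominus> y) \<oplus>\<^bsub>mk I\<^esub> x = \<zero>\<^bsub>mk I\<^esub>" using c by (simp add: mk_def E.R.l_neg)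
      then show "\<exists>y\<in>carrier (mk I). y \<oplus>\<^bsub>mk I\<^esub> x = \<zero>\<^bsub>mk I\<^esub>" using y by (auto simp: mk_def)
    qed (auto simp: mk_def E.R.a_assoc c, use c E.R.a_comm in auto)
    show ?thesis
      by (rule moduleI[OF E.is_cring ab])
        (auto simp: mk_def c I.I_l_closed E.R.l_distr E.R.r_distr E.R.m_assoc)
  qed
  have cR: "ideal (carrier R) R" by (rule E.R.oneideal)
  have "(\<lambda>x. x) \<in> module_hom R (mk J) (mk (carrier R))"
    by (auto simp: module_hom_def mk_def)
  moreover have "(\<lambda>x. \<phi> (projl x)) \<in> module_hom R (mk J) E"
    using \<phi> by (auto simp: module_hom_def mk_def)
  moreover have "inj_on (\<lambda>x. x) (carrier (mk J))" by simp
  ultimately have "\<exists>h\<in>module_hom R (mk (carrier R)) E. \<forall>x\<in>carrier (mk J). h x = \<phi> (projl x)"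
    using assms mk[OF J] mk[OF cR] unfolding injective_module_def by blast
  then obtain h where h: "h \<in> module_hom R (mk (carrier R)) E"
    "\<forall>x\<in>carrier (mk J). h x = \<phi> (projl x)" by blast
  let ?e = "h (Inl \<one>)"
  have "\<phi> x = x \<odot>\<^bsub>E\<^esub> ?e" if x: "x \<in> J" for x
  proof -
    have "h (x \<odot>\<^bsub>mk (carrier R)\<^esub> Inl \<one>) = x \<odot>\<^bsub>E\<^esub> ?e"
      using module_homD(3)[OF h(1), of x "Inl \<one>"] x by (auto simp: mk_def)
    then show ?thesis using h(2) x by (auto simp: mk_def)
  qed
  moreover have "?e \<in> carrier E" using module_homD(1)[OF h(1), of "Inl \<one>"] by (auto simp: mk_def)
  ultimately show "\<exists>e\<in>carrier E. \<forall>x\<in>J. \<phi> x = x \<odot>\<^bsub>E\<^esub> e" by blast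
qed

text \<open>Zorn's lemma is applied to graphs of partial homomorphisms \<open>B \<rightarrow> E\<close>, that is,
  submodules of \<open>B \<times> E\<close> meeting \<open>0 \<times> E\<close> trivially.\<close>

lemma baer_extend:
  fixes R (structure)
  assumes baer: "baer_module R E" and A: "module R A" and B: "module R B" and E: "module R E"
    and \<theta>: "\<theta> \<in> module_hom R A B" and g: "g \<in> module_hom R A E"
    and ker: "\<And>x. x \<in> carrier A \<Longrightarrow> \<theta> x = \<zero>\<^bsub>B\<^esub> \<Longrightarrow> g x = \<zero>\<^bsub>E\<^esub>"
  obtains h where "h \<in> module_hom R B E" "\<And>x. x \<in> carrier A \<Longrightarrow> h (\<theta> x) = g x"
proof -
  interpret A: module R A by fact
  interpret B: module R B by fact
  interpret E: module R E by fact
  note \<theta>' = module_homD[OF \<theta>] and g' = module_homD[OF g]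
  define closed where "closed G \<longleftrightarrow> (\<forall>r\<in>carrier R. \<forall>s\<in>carrier R. \<forall>x e y f. (x, e) \<in> G \<longrightarrow> (y, f) \<in> G \<longrightarrow>
      (r \<odot>\<^bsub>B\<^esub> x \<oplus>\<^bsub>B\<^esub> s \<odot>\<^bsub>B\<^esub> y, r \<odot>\<^bsub>E\<^esub> e \<oplus>\<^bsub>E\<^esub> s \<odot>\<^bsub>E\<^esub> f) \<in> G)" for G
  define G0 where "G0 = (\<lambda>x. (\<theta> x, g x)) ` carrier A"
  \<comment> \<open>As \<open>G\<close> is closed under linear combinations, the last condition
    makes it single-valued. Hypothesis \<open>ker\<close> is what puts the starting graph
    \<open>G0\<close> into this family.\<close>
  define \<G> where "\<G> = {G. G \<subseteq> carrier B \<times> carrier E \<and> G0 \<subseteq> G \<and> closed G \<and> (\<forall>e. (\<zero>\<^bsub>B\<^esub>, e) \<in> G \<longrightarrow> e = \<zero>\<^bsub>E\<^esub>)}"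
  have "closed G0"
    unfolding closed_def
  proof (intro ballI allI impI)
    fix r s x e y f assume rs: "r \<in> carrier R" "s \<in> carrier R" and "(x, e) \<in> G0" "(y, f) \<in> G0"
    then obtain a b where "a \<in> carrier A" "b \<in> carrier A" "x = \<theta> a" "e = g a" "y = \<theta> b" "f = g b"
      by (auto simp: G0_def)
    then show "(r \<odot>\<^bsub>B\<^esub> x \<oplus>\<^bsub>B\<^esub> s \<odot>\<^bsub>B\<^esub> y, r \<odot>\<^bsub>E\<^esub> e \<oplus>\<^bsub>E\<^esub> s \<odot>\<^bsub>E\<^esub> f) \<in> G0"
      unfolding G0_def using rs \<theta>' g'
      by (intro image_eqI[of _ _ "r \<odot>\<^bsub>A\<^esub> a \<oplus>\<^bsub>A\<^esub> s \<odot>\<^bsub>A\<^esub> b"]) auto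
  qed
  then have G0: "G0 \<in> \<G>"
    using \<theta>' g' ker by (auto simp: \<G>_def G0_def)
  have "\<exists>G\<in>\<G>. \<forall>G'\<in>\<G>. G \<subseteq> G' \<longrightarrow> G' = G"
  proof (rule subset_Zorn_nonempty)
    show "\<G> \<noteq> {}" using G0 by blast
    fix \<C> assume ne: "\<C> \<noteq> {}" and ch: "subset.chain \<G> \<C>"
    have sub: "\<C> \<subseteq> \<G>" and lin: "\<And>G G'. G \<in> \<C> \<Longrightarrow> G' \<in> \<C> \<Longrightarrow> G \<subseteq> G' \<or> G' \<subseteq> G"
      using ch by (auto simp: subset_chain_def)
    have "closed (\<Union>\<C>)"
      unfolding closed_def
    proof (intro ballI allI impI)
      fix r s x e y f assume rs: "r \<in> carrier R" "s \<in> carrier R" and "(x, e) \<in> \<Union>\<C>" "(y, f) \<in> \<Union>\<C>"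
      then obtain G1 G2 where "G1 \<in> \<C>" "(x, e) \<in> G1" "G2 \<in> \<C>" "(y, f) \<in> G2" by blast
      then obtain G where "G \<in> \<C>" "(x, e) \<in> G" "(y, f) \<in> G" using lin[of G1 G2] by blast
      moreover have "closed G" using \<open>G \<in> \<C>\<close> sub by (auto simp: \<G>_def)
      ultimately show "(r \<odot>\<^bsub>B\<^esub> x \<oplus>\<^bsub>B\<^esub> s \<odot>\<^bsub>B\<^esub> y, r \<odot>\<^bsub>E\<^esub> e \<oplus>\<^bsub>E\<^esub> s \<odot>\<^bsub>E\<^esub> f) \<in> \<Union>\<C>"
        using rs unfolding closed_def by blast
    qed
    then show "\<Union>\<C> \<in> \<G>" using sub ne unfolding \<G>_def by blast
  qed
  then obtain G where G: "G \<in> \<G>" and max: "\<And>G'. G' \<in> \<G> \<Longrightarrow> G \<subseteq> G' \<Longrightarrow> G' = G" by blast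
  have Gc: "(x, e) \<in> G \<Longrightarrow> x \<in> carrier B \<and> e \<in> carrier E" for x e using G by (auto simp: \<G>_def)
  have Gcomb: "(r \<odot>\<^bsub>B\<^esub> x \<oplus>\<^bsub>B\<^esub> s \<odot>\<^bsub>B\<^esub> y, r \<odot>\<^bsub>E\<^esub> e \<oplus>\<^bsub>E\<^esub> s \<odot>\<^bsub>E\<^esub> f) \<in> G"
    if "r \<in> carrier R" "s \<in> carrier R" "(x, e) \<in> G" "(y, f) \<in> G" for r s x e y f
    using G that unfolding \<G>_def closed_def by blast
  have G00: "(\<zero>\<^bsub>B\<^esub>, \<zero>\<^bsub>E\<^esub>) \<in> G"
  proof -
    have "(\<theta> \<zero>\<^bsub>A\<^esub>, g \<zero>\<^bsub>A\<^esub>) \<in> G0" unfolding G0_def by blast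
    then show ?thesis
      using G module_hom_zero[OF A B \<theta>] module_hom_zero[OF A E g] by (auto simp: \<G>_def)
  qed
  have Gz: "(\<zero>\<^bsub>B\<^esub>, e) \<in> G \<Longrightarrow> e = \<zero>\<^bsub>E\<^esub>" for e using G by (auto simp: \<G>_def)
  have Gsmult: "(r \<odot>\<^bsub>B\<^esub> x, r \<odot>\<^bsub>E\<^esub> e) \<in> G" if "r \<in> carrier R" "(x, e) \<in> G" for r x e
    using Gcomb[OF that(1) A.R.zero_closed that(2,2)] Gc[OF that(2)] that(1) by simp
  have Gadd: "(x \<oplus>\<^bsub>B\<^esub> y, e \<oplus>\<^bsub>E\<^esub> f) \<in> G" if "(x, e) \<in> G" "(y, f) \<in> G" for x y e f
    using Gcomb[OF A.R.one_closed A.R.one_closed that] Gc that by simp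
  have uniq: "e = f" if xe: "(x, e) \<in> G" and xf: "(x, f) \<in> G" for x e f
  proof -
    have "((\<ominus> \<one>) \<odot>\<^bsub>B\<^esub> x, (\<ominus> \<one>) \<odot>\<^bsub>E\<^esub> f) \<in> G" by (rule Gsmult[OF _ xf]) simp
    from Gadd[OF xe this] have "(\<zero>\<^bsub>B\<^esub>, e \<ominus>\<^bsub>E\<^esub> f) \<in> G"
      using Gc[OF xe] Gc[OF xf] by (simp add: B.smult_l_minus E.smult_l_minus B.M.r_neg a_minus_def)
    then have "e \<ominus>\<^bsub>E\<^esub> f = \<zero>\<^bsub>E\<^esub>" by (rule Gz)
    then show ?thesis using Gc[OF xe] Gc[OF xf] by (simp add: a_minus_def E.M.minus_equality)
       (metis E.M.minus_equality E.M.minus_minus E.M.a_inv_closed)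
  qed
  have total: "\<exists>e. (b, e) \<in> G" if b: "b \<in> carrier B" for b
  proof -
    \<comment> \<open>The \<open>r\<close> for which the partial map is already defined at
      \<open>r b\<close>. Its values there form a homomorphism from \<open>J\<close> to
      \<open>E\<close>, and Baer's condition supplies a value \<open>e0\<close> for \<open>b\<close>
      that is consistent with them.\<close>
    define J where "J = {r \<in> carrier R. \<exists>e. (r \<odot>\<^bsub>B\<^esub> b, e) \<in> G}"
    define \<phi> where "\<phi> r = (SOME e. (r \<odot>\<^bsub>B\<^esub> b, e) \<in> G)" for r
    have \<phi>: "(r \<odot>\<^bsub>B\<^esub> b, \<phi> r) \<in> G" if "r \<in> J" for r
      using that unfolding J_def \<phi>_def by (metis (mono_tags, lifting) mem_Collect_eq someI)
    have \<phi>c: "\<phi> r \<in> carrier E" if "r \<in> J" for r using Gc[OF \<phi>[OF that]] by simp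
    have JR: "r \<in> J \<Longrightarrow> r \<in> carrier R" for r by (simp add: J_def)
    have comb: "((r \<otimes> x \<oplus> s \<otimes> y) \<odot>\<^bsub>B\<^esub> b, r \<odot>\<^bsub>E\<^esub> \<phi> x \<oplus>\<^bsub>E\<^esub> s \<odot>\<^bsub>E\<^esub> \<phi> y) \<in> G"
      if "r \<in> carrier R" "s \<in> carrier R" "x \<in> J" "y \<in> J" for r s x y
      using Gcomb[OF that(1,2) \<phi>[OF that(3)] \<phi>[OF that(4)]] that b JR
      by (simp add: B.smult_l_distr B.smult_assoc1)
    have J: "ideal J R"
    proof (rule ideal_lin_combI[OF A.is_cring])
      show "J \<subseteq> carrier R" using JR by auto
      show "\<zero> \<in> J" using G00 b by (auto simp: J_def)
      show "r \<otimes> x \<oplus> s \<otimes> y \<in> J" if "r \<in> carrier R" "s \<in> carrier R" "x \<in> J" "y \<in> J" for r s x y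
      proof -
        have "r \<otimes> x \<oplus> s \<otimes> y \<in> carrier R" using that JR by simp
        then show ?thesis using comb[OF that] unfolding J_def by blast
      qed
    qed
    interpret J: ideal J R by fact
    have add: "\<phi> (x \<oplus> y) = \<phi> x \<oplus>\<^bsub>E\<^esub> \<phi> y" if "x \<in> J" "y \<in> J" for x y
      by (rule uniq[OF \<phi>]) (use that Gadd[OF \<phi>[OF that(1)] \<phi>[OF that(2)]] b JR in \<open>auto simp: B.smult_l_distr\<close>)
    have mult: "\<phi> (r \<otimes> x) = r \<odot>\<^bsub>E\<^esub> \<phi> x" if "r \<in> carrier R" "x \<in> J" for r x
      by (rule uniq[OF \<phi>]) (use that Gsmult[OF that(1) \<phi>[OF that(2)]] b JR J.I_l_closed in \<open>auto simp: B.smult_assoc1\<close>)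
    obtain e0 where e0: "e0 \<in> carrier E" "\<And>x. x \<in> J \<Longrightarrow> \<phi> x = x \<odot>\<^bsub>E\<^esub> e0"
      using baer J \<phi>c add mult unfolding baer_module_def by (metis Pi_I)
    define G' where "G' = {(x \<oplus>\<^bsub>B\<^esub> r \<odot>\<^bsub>B\<^esub> b, e \<oplus>\<^bsub>E\<^esub> r \<odot>\<^bsub>E\<^esub> e0) |x e r. (x, e) \<in> G \<and> r \<in> carrier R}"
    have "G \<subseteq> G'"
    proof clarify
      fix x e assume "(x, e) \<in> G"
      moreover have "(x, e) = (x \<oplus>\<^bsub>B\<^esub> \<zero> \<odot>\<^bsub>B\<^esub> b, e \<oplus>\<^bsub>E\<^esub> \<zero> \<odot>\<^bsub>E\<^esub> e0)"
        using Gc[OF \<open>(x, e) \<in> G\<close>] b e0 by simp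
      ultimately show "(x, e) \<in> G'" unfolding G'_def by blast
    qed
    moreover have "closed G'"
      unfolding closed_def
    proof (intro ballI allI impI)
      fix r s x e y f assume rs: "r \<in> carrier R" "s \<in> carrier R" and "(x, e) \<in> G'" "(y, f) \<in> G'"
      then obtain x1 e1 r1 x2 e2 r2 where *: "(x1, e1) \<in> G" "r1 \<in> carrier R" "(x2, e2) \<in> G" "r2 \<in> carrier R"
        "x = x1 \<oplus>\<^bsub>B\<^esub> r1 \<odot>\<^bsub>B\<^esub> b" "e = e1 \<oplus>\<^bsub>E\<^esub> r1 \<odot>\<^bsub>E\<^esub> e0" "y = x2 \<oplus>\<^bsub>B\<^esub> r2 \<odot>\<^bsub>B\<^esub> b" "f = e2 \<oplus>\<^bsub>E\<^esub> r2 \<odot>\<^bsub>E\<^esub> e0"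
        by (auto simp: G'_def)
      let ?t = "r \<otimes> r1 \<oplus> s \<otimes> r2"
      have "r \<odot>\<^bsub>B\<^esub> x \<oplus>\<^bsub>B\<^esub> s \<odot>\<^bsub>B\<^esub> y = (r \<odot>\<^bsub>B\<^esub> x1 \<oplus>\<^bsub>B\<^esub> s \<odot>\<^bsub>B\<^esub> x2) \<oplus>\<^bsub>B\<^esub> ?t \<odot>\<^bsub>B\<^esub> b"
        "r \<odot>\<^bsub>E\<^esub> e \<oplus>\<^bsub>E\<^esub> s \<odot>\<^bsub>E\<^esub> f = (r \<odot>\<^bsub>E\<^esub> e1 \<oplus>\<^bsub>E\<^esub> s \<odot>\<^bsub>E\<^esub> e2) \<oplus>\<^bsub>E\<^esub> ?t \<odot>\<^bsub>E\<^esub> e0"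
        using * rs Gc[OF *(1)] Gc[OF *(3)] b e0
        by (simp_all add: B.smult_r_distr B.smult_l_distr B.smult_assoc1 B.M.a_ac
            E.smult_r_distr E.smult_l_distr E.smult_assoc1 E.M.a_ac)
      moreover have "(r \<odot>\<^bsub>B\<^esub> x1 \<oplus>\<^bsub>B\<^esub> s \<odot>\<^bsub>B\<^esub> x2, r \<odot>\<^bsub>E\<^esub> e1 \<oplus>\<^bsub>E\<^esub> s \<odot>\<^bsub>E\<^esub> e2) \<in> G" "?t \<in> carrier R"
        using Gcomb[OF rs *(1,3)] rs * by auto
      ultimately show "(r \<odot>\<^bsub>B\<^esub> x \<oplus>\<^bsub>B\<^esub> s \<odot>\<^bsub>B\<^esub> y, r \<odot>\<^bsub>E\<^esub> e \<oplus>\<^bsub>E\<^esub> s \<odot>\<^bsub>E\<^esub> f) \<in> G'"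
        unfolding G'_def by blast
    qed
    \<comment> \<open>If x + r b = 0, then r b = -x is in the old domain, so r lies in
      \<open>J\<close> and r e0 is the old value -e1 at r b.\<close>
    moreover have "e = \<zero>\<^bsub>E\<^esub>" if "(\<zero>\<^bsub>B\<^esub>, e) \<in> G'" for e
    proof -
      obtain x e1 r where *: "(x, e1) \<in> G" "r \<in> carrier R" "\<zero>\<^bsub>B\<^esub> = x \<oplus>\<^bsub>B\<^esub> r \<odot>\<^bsub>B\<^esub> b"
        "e = e1 \<oplus>\<^bsub>E\<^esub> r \<odot>\<^bsub>E\<^esub> e0" using \<open>(\<zero>\<^bsub>B\<^esub>, e) \<in> G'\<close> unfolding G'_def by blast
      note c = Gc[OF *(1)]
      have "\<ominus>\<^bsub>B\<^esub> x = r \<odot>\<^bsub>B\<^esub> b"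
        by (rule B.M.minus_equality) (use * c b B.M.a_comm in auto)
      then have "r \<odot>\<^bsub>B\<^esub> b = (\<ominus> \<one>) \<odot>\<^bsub>B\<^esub> x" using c by (simp add: B.smult_l_minus)
      then have m: "(r \<odot>\<^bsub>B\<^esub> b, (\<ominus> \<one>) \<odot>\<^bsub>E\<^esub> e1) \<in> G" using Gsmult[OF _ *(1), of "\<ominus> \<one>"] by simp
      then have r: "r \<in> J" using *(2) unfolding J_def by blast
      have "r \<odot>\<^bsub>E\<^esub> e0 = \<ominus>\<^bsub>E\<^esub> e1" using uniq[OF \<phi>[OF r] m] e0(2)[OF r] c by (simp add: E.smult_l_minus)
      then show ?thesis using *(4) c by (simp add: E.M.r_neg)
    qed
    moreover have "G' \<subseteq> carrier B \<times> carrier E" using Gc b e0 by (auto simp: G'_def)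
    moreover have "G0 \<subseteq> G'" using G \<open>G \<subseteq> G'\<close> unfolding \<G>_def by blast
    ultimately have "G' = G" by (intro max) (simp_all add: \<G>_def)
    moreover have "(b, e0) \<in> G'" unfolding G'_def using G00 b e0
      by (intro CollectI exI[of _ "\<zero>\<^bsub>B\<^esub>"] exI[of _ "\<zero>\<^bsub>E\<^esub>"] exI[of _ "\<one>"]) simp
    ultimately show ?thesis by blast
  qed
  define h where "h b = (SOME e. (b, e) \<in> G)" for b
  have h: "(b, h b) \<in> G" if "b \<in> carrier B" for b
    unfolding h_def using someI_ex[OF total[OF that]] .
  have "h \<in> module_hom R B E"
  proof (rule module_homI)
    show "h x \<in> carrier E" if "x \<in> carrier B" for x using Gc[OF h[OF that]] by simp
    show "h (x \<oplus>\<^bsub>B\<^esub> y) = h x \<oplus>\<^bsub>E\<^esub> h y" if "x \<in> carrier B" "y \<in> carrier B" for x y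
      by (rule uniq[OF h Gadd[OF h h]]) (use that in auto)
    show "h (r \<odot>\<^bsub>B\<^esub> x) = r \<odot>\<^bsub>E\<^esub> h x" if "r \<in> carrier R" "x \<in> carrier B" for r x
      by (rule uniq[OF h Gsmult[OF _ h]]) (use that in auto)
  qed
  moreover have "h (\<theta> x) = g x" if "x \<in> carrier A" for x
  proof -
    have "(\<theta> x, g x) \<in> G" using G that by (auto simp: \<G>_def G0_def)
    with h[OF \<theta>'(1)[OF that]] show ?thesis by (rule uniq)
  qed
  ultimately show thesis by (rule that)
qed

section \<open>Torsion over Noetherian rings\<close>

text \<open>A nonempty chain of ideals contains its own union, so Zorn's lemma applies to any
  nonempty family of ideals.\<close>

lemma noetherian_maximal_ideal:
  assumes "noetherian_ring R" "\<F> \<noteq> {}" "\<And>I. I \<in> \<F> \<Longrightarrow> ideal I R"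
  obtains I where "I \<in> \<F>" "\<And>J. J \<in> \<F> \<Longrightarrow> I \<subseteq> J \<Longrightarrow> J = I"
proof -
  interpret noetherian_ring R by fact
  have "\<exists>I\<in>\<F>. \<forall>J\<in>\<F>. I \<subseteq> J \<longrightarrow> J = I"
  proof (rule subset_Zorn_nonempty[OF assms(2)])
    fix \<C> assume ne: "\<C> \<noteq> {}" and ch: "subset.chain \<F> \<C>"
    have "subset.chain {I. ideal I R} \<C>" using ch assms(3) by (auto simp: subset_chain_def)
    then have "\<Union>\<C> \<in> \<C>" by (rule ideal_chain_is_trivial[OF ne])
    then show "\<Union>\<C> \<in> \<F>" using ch by (auto simp: subset_chain_def)
  qed
  then show thesis using that by blast
qed

section \<open>Powers of ideals\<close>

lemma ideal_power_ideal:
  assumes "cring R" "ideal I R"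
  shows "ideal (ideal_power R I n) R"
proof -
  interpret cring R by fact
  show ?thesis by (induction n) (use assms(2) oneideal ideal_prod_is_ideal in auto)
qed

lemma ideal_power_add:
  fixes R (structure)
  assumes "cring R" "ideal I R"
  shows "ideal_power R I (m + n) = ideal_power R I m \<cdot> ideal_power R I n"
proof -
  interpret cring R by fact
  note id = ideal_power_ideal[OF assms]
  show ?thesis
  proof (induction m)
    case 0
    show ?case using ideal_prod_one[OF id[of n]] ideal_prod_commute[OF id[of n] oneideal] by simp
  next
    case (Suc m)
    then show ?case using ideal_prod_assoc[OF assms(2) id id] by simp
  qed
qed

lemma nat_pow_in_ideal_power:
  fixes R (structure)
  assumes "cring R" "ideal I R" "x \<in> I"
  shows "x [^] n \<in> ideal_power R I n"
proof -
  interpret cring R by fact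
  interpret I: ideal I R by fact
  show ?thesis
  proof (induction n)
    case (Suc n)
    have "x \<otimes> x [^] n \<in> ideal_power R I (Suc n)"
      using Suc assms(3) by (simp add: ideal_prod.prod)
    then show ?case using I.Icarr[OF assms(3)] by (simp add: m_comm)
  qed simp
qed

lemma mem_ideal_add_cgenideal:
  fixes R (structure)
  shows "z \<in> c <+> PIdl u \<longleftrightarrow> (\<exists>x\<in>c. \<exists>r\<in>carrier R. z = x \<oplus> r \<otimes> u)"
  by (auto simp: set_add_def' cgenideal_def)

lemma ideal_add_cgenideal:
  fixes R (structure)
  assumes "cring R" "ideal c R" "u \<in> carrier R"
  shows "ideal (c <+> PIdl u) R" "c \<subseteq> c <+> PIdl u" "u \<in> c <+> PIdl u"
proof -
  interpret cring R by fact
  interpret c: ideal c R by fact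
  show "ideal (c <+> PIdl u) R" by (rule add_ideals[OF assms(2) cgenideal_ideal[OF assms(3)]])
  show "c \<subseteq> c <+> PIdl u"
  proof
    fix x assume x: "x \<in> c"
    then have "x = x \<oplus> \<zero> \<otimes> u" using c.Icarr assms(3) by simp
    then show "x \<in> c <+> PIdl u" unfolding mem_ideal_add_cgenideal using x by blast
  qed
  have "u = \<zero> \<oplus> \<one> \<otimes> u" using assms(3) by simp
  then show "u \<in> c <+> PIdl u" unfolding mem_ideal_add_cgenideal using c.zero_closed by blast
qed

lemma primeideal_nat_pow:
  fixes R (structure)
  assumes "cring R" "primeideal p R" "x \<in> carrier R" "x [^] (n::nat) \<in> p"
  shows "x \<in> p"
proof -
  interpret cring R by fact
  interpret p: primeideal p R by fact
  show ?thesis using assms(4)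
  proof (induction n)
    case 0
    then show ?case using p.I_notcarr p.one_imp_carrier by simp
  next
    case (Suc n)
    then show ?case using p.I_prime[of "x [^] n" x] assms(3) by auto
  qed
qed

text \<open>A maximal counterexample \<open>c\<close> would be prime.\<close>

lemma ideal_power_subset:
  fixes R (structure)
  assumes "cring R" "noetherian_ring R" "ideal I R" "ideal c R"
    and "\<And>x. x \<in> I \<Longrightarrow> \<exists>n::nat. x [^] n \<in> c"
  shows "\<exists>n. ideal_power R I n \<subseteq> c"
proof (rule ccontr)
  assume neg: "\<not> ?thesis"
  interpret cring R by fact
  interpret I: ideal I R by fact
  define \<F> where "\<F> = {c. ideal c R \<and> (\<forall>x\<in>I. \<exists>n::nat. x [^] n \<in> c) \<and> (\<nexists>n. ideal_power R I n \<subseteq> c)}"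
  have "\<F> \<noteq> {}" using assms(4,5) neg unfolding \<F>_def by blast
  then obtain c where c: "c \<in> \<F>" and max: "\<And>c'. c' \<in> \<F> \<Longrightarrow> c \<subseteq> c' \<Longrightarrow> c' = c"
    by (rule noetherian_maximal_ideal[OF assms(2)]) (auto simp: \<F>_def)
  have cid: "ideal c R" and rad: "\<And>x. x \<in> I \<Longrightarrow> \<exists>n::nat. x [^] n \<in> c"
    and npow: "\<And>n. \<not> ideal_power R I n \<subseteq> c" using c by (auto simp: \<F>_def)
  interpret c: ideal c R by (rule cid)
  have notall: "c \<noteq> carrier R" using npow[of 0] by auto
  \<comment> \<open>By maximality, adjoining any \<open>u\<close> outside \<open>c\<close> gives an
    ideal that contains a power of \<open>I\<close>. If u v \<in> c, then (c + (u)) (c + (v)) lies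
    in \<open>c\<close>, and so does the product of the two powers of \<open>I\<close>; this is how
    \<open>c\<close> is seen to be prime.\<close>
  have power: "\<exists>n. ideal_power R I n \<subseteq> c <+>\<^bsub>R\<^esub> PIdl u" if u: "u \<in> carrier R" "u \<notin> c" for u
  proof (rule ccontr)
    assume "\<not> ?thesis"
    then have "c <+>\<^bsub>R\<^esub> PIdl u \<in> \<F>"
      using ideal_add_cgenideal[OF assms(1) cid u(1)] rad unfolding \<F>_def by blast
    then show False using max ideal_add_cgenideal(2,3)[OF assms(1) cid u(1)] u(2) by blast
  qed
  have prime: "primeideal c R"
  proof (rule primeidealI[OF cid is_cring])
    show "carrier R \<noteq> c" using notall by simp
    fix u v assume uv: "u \<in> carrier R" "v \<in> carrier R" "u \<otimes> v \<in> c"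
    show "u \<in> c \<or> v \<in> c"
    proof (rule ccontr)
      assume "\<not> ?thesis"
      then obtain m n where mn: "ideal_power R I m \<subseteq> c <+>\<^bsub>R\<^esub> PIdl u" "ideal_power R I n \<subseteq> c <+>\<^bsub>R\<^esub> PIdl v"
        using power[OF uv(1)] power[OF uv(2)] by auto
      have "s \<in> c" if "s \<in> ideal_power R I m \<cdot> ideal_power R I n" for s
        using that
      proof induction
        case (prod i j)
        then have "i \<in> c <+>\<^bsub>R\<^esub> PIdl u" "j \<in> c <+>\<^bsub>R\<^esub> PIdl v" using mn by auto
        then obtain x r y t where *: "x \<in> c" "r \<in> carrier R" "i = x \<oplus> r \<otimes> u"
          "y \<in> c" "t \<in> carrier R" "j = y \<oplus> t \<otimes> v"
          unfolding mem_ideal_add_cgenideal by blast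
        have xy: "x \<in> carrier R" "y \<in> carrier R" using * c.Icarr by auto
        have "i \<otimes> j = x \<otimes> j \<oplus> ((r \<otimes> u) \<otimes> y \<oplus> (r \<otimes> t) \<otimes> (u \<otimes> v))"
          using * xy uv by algebra
        moreover have "x \<otimes> j \<in> c" "(r \<otimes> u) \<otimes> y \<in> c" "(r \<otimes> t) \<otimes> (u \<otimes> v) \<in> c"
          using * xy uv by (auto intro: c.I_l_closed c.I_r_closed)
        ultimately show ?case by simp
      qed simp
      then have "ideal_power R I (m + n) \<subseteq> c" unfolding ideal_power_add[OF assms(1,3)] by blast
      then show False using npow by blast
    qed
  qed
  have "I \<subseteq> c"
  proof
    fix x assume x: "x \<in> I"
    then obtain n :: nat where "x [^] n \<in> c" using rad by blast
    then show "x \<in> c" by (rule primeideal_nat_pow[OF assms(1) prime I.Icarr[OF x]])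
  qed
  then have "ideal_power R I 1 \<subseteq> c" using ideal_prod_one[OF assms(3)] by simp
  then show False using npow by blast
qed

text \<open>The exponent may depend on \<open>r\<close>, whereas \<open>torsion_module\<close> asks
  for one power of the whole ideal. This elementwise form makes closure under linear combinations
  and saturation immediate; \<open>torsion_module_eq\<close> shows that both agree over a Noetherian
  ring.\<close>

definition torsion :: "('a, 'r) ring_scheme \<Rightarrow> 'a set \<Rightarrow> ('a, 'm) module \<Rightarrow> 'm set" where
  "torsion R I M =
     {x \<in> carrier M. \<forall>r\<in>I. \<exists>n::nat. (r [^]\<^bsub>R\<^esub> n) \<odot>\<^bsub>M\<^esub> x = \<zero>\<^bsub>M\<^esub>}"

lemma annihilator_ideal:
  assumes "module R M" "x \<in> carrier M"
  shows "ideal (annihilator R M x) R"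
proof -
  interpret M: module R M by fact
  show ?thesis
    by (rule ideal_lin_combI[OF M.is_cring])
      (auto simp: annihilator_def assms(2) M.smult_l_distr M.smult_assoc1)
qed

text \<open>For a torsion \<open>x\<close> the annihilator contains a power of each element of
  \<open>I\<close>; being an ideal of a Noetherian ring, it contains a power of \<open>I\<close> by
  \<open>ideal_power_subset\<close>.\<close>

lemma torsion_module_eq:
  fixes R (structure)
  assumes "noetherian_ring R" "ideal I R" "module R M"
  shows "torsion_module R I M = M\<lparr>carrier := torsion R I M\<rparr>"
proof -
  interpret M: module R M by fact
  have "(\<exists>n. \<forall>r\<in>ideal_power R I n. r \<odot>\<^bsub>M\<^esub> x = \<zero>\<^bsub>M\<^esub>) \<longleftrightarrow>
      (\<forall>r\<in>I. \<exists>n::nat. (r [^] n) \<odot>\<^bsub>M\<^esub> x = \<zero>\<^bsub>M\<^esub>)" if x: "x \<in> carrier M" for x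
  proof
    assume "\<exists>n. \<forall>r\<in>ideal_power R I n. r \<odot>\<^bsub>M\<^esub> x = \<zero>\<^bsub>M\<^esub>"
    then show "\<forall>r\<in>I. \<exists>n::nat. (r [^] n) \<odot>\<^bsub>M\<^esub> x = \<zero>\<^bsub>M\<^esub>"
      using nat_pow_in_ideal_power[OF M.is_cring assms(2)] by blast
  next
    assume *: "\<forall>r\<in>I. \<exists>n::nat. (r [^] n) \<odot>\<^bsub>M\<^esub> x = \<zero>\<^bsub>M\<^esub>"
    have "\<exists>n. ideal_power R I n \<subseteq> annihilator R M x"
    proof (rule ideal_power_subset[OF M.is_cring assms(1,2) annihilator_ideal[OF assms(3) x]])
      fix r assume "r \<in> I"
      then show "\<exists>n::nat. r [^] n \<in> annihilator R M x"
        using * ideal.Icarr[OF assms(2)] by (auto simp: annihilator_def)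
    qed
    then show "\<exists>n. \<forall>r\<in>ideal_power R I n. r \<odot>\<^bsub>M\<^esub> x = \<zero>\<^bsub>M\<^esub>" by (auto simp: annihilator_def)
  qed
  then have "{x \<in> carrier M. \<exists>n. \<forall>r\<in>ideal_power R I n. r \<odot>\<^bsub>M\<^esub> x = \<zero>\<^bsub>M\<^esub>} = torsion R I M"
    unfolding torsion_def by blast
  then show ?thesis unfolding torsion_module_def by simp
qed

lemma nat_pow_smult_add:
  fixes R (structure) and m n :: nat
  assumes "module R M" "r \<in> carrier R" "x \<in> carrier M"
  shows "(r [^] (m + n)) \<odot>\<^bsub>M\<^esub> x = (r [^] m) \<odot>\<^bsub>M\<^esub> ((r [^] n) \<odot>\<^bsub>M\<^esub> x)"
proof -
  interpret M: module R M by fact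
  show ?thesis using assms by (simp add: M.R.nat_pow_mult[symmetric] M.smult_assoc1)
qed

lemma torsion_submodule:
  fixes R (structure)
  assumes "ideal I R" "module R M"
  shows "submodule (torsion R I M) R M"
proof -
  interpret M: module R M by fact
  interpret I: ideal I R by fact
  show ?thesis
  proof (rule submodule_lin_combI[OF assms(2)])
    fix r x s y assume rs: "r \<in> carrier R" "s \<in> carrier R"
      and xy: "x \<in> torsion R I M" "y \<in> torsion R I M"
    then have c: "x \<in> carrier M" "y \<in> carrier M" by (auto simp: torsion_def)
    have "\<exists>n::nat. (a [^] n) \<odot>\<^bsub>M\<^esub> (r \<odot>\<^bsub>M\<^esub> x \<oplus>\<^bsub>M\<^esub> s \<odot>\<^bsub>M\<^esub> y) = \<zero>\<^bsub>M\<^esub>" if a: "a \<in> I" for a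
    proof -
      have aR: "a \<in> carrier R" by (rule I.Icarr[OF a])
      obtain m n :: nat where mn: "(a [^] m) \<odot>\<^bsub>M\<^esub> x = \<zero>\<^bsub>M\<^esub>" "(a [^] n) \<odot>\<^bsub>M\<^esub> y = \<zero>\<^bsub>M\<^esub>"
        using xy a unfolding torsion_def by blast
      have "(a [^] (m + n)) \<odot>\<^bsub>M\<^esub> x = \<zero>\<^bsub>M\<^esub>" "(a [^] (m + n)) \<odot>\<^bsub>M\<^esub> y = \<zero>\<^bsub>M\<^esub>"
        using nat_pow_smult_add[OF assms(2) aR c(1), of n m]
          nat_pow_smult_add[OF assms(2) aR c(2), of m n] mn aR by (auto simp: add.commute)
      moreover have "b \<odot>\<^bsub>M\<^esub> (r \<odot>\<^bsub>M\<^esub> x) = r \<odot>\<^bsub>M\<^esub> (b \<odot>\<^bsub>M\<^esub> x)" "b \<odot>\<^bsub>M\<^esub> (s \<odot>\<^bsub>M\<^esub> y) = s \<odot>\<^bsub>M\<^esub> (b \<odot>\<^bsub>M\<^esub> y)"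
        if "b \<in> carrier R" for b using that rs c
        by (simp_all add: M.smult_assoc1[symmetric] M.R.m_comm)
      ultimately have "(a [^] (m + n)) \<odot>\<^bsub>M\<^esub> (r \<odot>\<^bsub>M\<^esub> x \<oplus>\<^bsub>M\<^esub> s \<odot>\<^bsub>M\<^esub> y) = \<zero>\<^bsub>M\<^esub>"
        using rs c aR by (simp add: M.smult_r_distr)
      then show ?thesis by blast
    qed
    then show "r \<odot>\<^bsub>M\<^esub> x \<oplus>\<^bsub>M\<^esub> s \<odot>\<^bsub>M\<^esub> y \<in> torsion R I M"
      using rs c by (simp add: torsion_def)
  next
    have "r [^] n \<in> carrier R" if "r \<in> I" for r and n :: nat using I.Icarr[OF that] by simp
    then show "\<zero>\<^bsub>M\<^esub> \<in> torsion R I M" by (simp add: torsion_def)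
  qed (auto simp: torsion_def)
qed

text \<open>If r^n kills r x, then r^(n+1) kills x. In other words, the quotient of \<open>M\<close>
  by its torsion has no nonzero element killed by \<open>I\<close>.\<close>

lemma torsion_saturated:
  fixes R (structure)
  assumes "ideal I R" "module R M" "x \<in> carrier M"
    and "\<And>r. r \<in> I \<Longrightarrow> r \<odot>\<^bsub>M\<^esub> x \<in> torsion R I M"
  shows "x \<in> torsion R I M"
proof -
  interpret M: module R M by fact
  interpret I: ideal I R by fact
  have "\<exists>n::nat. (r [^] n) \<odot>\<^bsub>M\<^esub> x = \<zero>\<^bsub>M\<^esub>" if r: "r \<in> I" for r
  proof -
    obtain n :: nat where "(r [^] n) \<odot>\<^bsub>M\<^esub> (r \<odot>\<^bsub>M\<^esub> x) = \<zero>\<^bsub>M\<^esub>"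
      using assms(4)[OF r] r by (auto simp: torsion_def)
    then have "(r [^] Suc n) \<odot>\<^bsub>M\<^esub> x = \<zero>\<^bsub>M\<^esub>"
      using I.Icarr[OF r] assms(3) by (simp add: M.smult_assoc1)
    then show ?thesis by blast
  qed
  then show ?thesis using assms(3) by (simp add: torsion_def)
qed

lemma torsion_hom:
  fixes R (structure)
  assumes "ideal I R" "module R M" "module R N" "f \<in> module_hom R M N" "x \<in> torsion R I M"
  shows "f x \<in> torsion R I N"
proof -
  have x: "x \<in> carrier M" using assms(5) by (simp add: torsion_def)
  interpret M: module R M by fact
  have "\<exists>n::nat. (r [^] n) \<odot>\<^bsub>N\<^esub> f x = \<zero>\<^bsub>N\<^esub>" if r: "r \<in> I" for r
  proof -
    obtain n :: nat where "(r [^] n) \<odot>\<^bsub>M\<^esub> x = \<zero>\<^bsub>M\<^esub>"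
      using assms(5) r by (auto simp: torsion_def)
    moreover have "r [^] n \<in> carrier R" using ideal.Icarr[OF assms(1) r] by simp
    ultimately have "(r [^] n) \<odot>\<^bsub>N\<^esub> f x = \<zero>\<^bsub>N\<^esub>"
      using module_homD(3)[OF assms(4), of "r [^] n" x] x module_hom_zero[OF assms(2-4)] by simp
    then show ?thesis by blast
  qed
  then show ?thesis using module_homD(1)[OF assms(4) x] by (simp add: torsion_def)
qed

text \<open>This replaces the Artin--Rees lemma: a torsion-valued \<open>\<phi> : b \<rightarrow> E\<close> is extended by zero to
  \<open>b + c\<close>, where \<open>c\<close> is maximal with \<open>b \<inter> c = ker \<phi>\<close>, and maximality forces \<open>I\<close> into the radical
  of \<open>c\<close>.\<close>

lemma baer_torsion:
  fixes R (structure)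
  assumes cring: "cring R" and noeth: "noetherian_ring R" and I: "ideal I R"
    and E: "module R E" and baer: "baer_module R E"
  shows "baer_module R (E\<lparr>carrier := torsion R I E\<rparr>)"
  unfolding baer_module_def
proof (intro allI impI, elim conjE)
  fix b \<phi> assume b: "ideal b R" and \<phi>0: "\<phi> \<in> b \<rightarrow> carrier (E\<lparr>carrier := torsion R I E\<rparr>)"
    and add0: "\<forall>x\<in>b. \<forall>y\<in>b. \<phi> (x \<oplus> y) = \<phi> x \<oplus>\<^bsub>E\<lparr>carrier := torsion R I E\<rparr>\<^esub> \<phi> y"
    and mult0: "\<forall>r\<in>carrier R. \<forall>x\<in>b. \<phi> (r \<otimes> x) = r \<odot>\<^bsub>E\<lparr>carrier := torsion R I E\<rparr>\<^esub> \<phi> x"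
  interpret E: module R E by fact
  interpret I: ideal I R by fact
  interpret b: ideal b R by fact
  have \<phi>T: "\<phi> x \<in> torsion R I E" if "x \<in> b" for x using \<phi>0 that by auto
  have \<phi>: "\<phi> x \<in> carrier E" if "x \<in> b" for x using \<phi>T[OF that] by (simp add: torsion_def)
  have add: "\<phi> (x \<oplus> y) = \<phi> x \<oplus>\<^bsub>E\<^esub> \<phi> y" if "x \<in> b" "y \<in> b" for x y using add0 that by simp
  have mult: "\<phi> (r \<otimes> x) = r \<odot>\<^bsub>E\<^esub> \<phi> x" if "r \<in> carrier R" "x \<in> b" for r x using mult0 that by simp
  have \<phi>zero: "\<phi> \<zero> = \<zero>\<^bsub>E\<^esub>" using mult[of "\<zero>" "\<zero>"] \<phi>[of "\<zero>"] b.zero_closed by simp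
  define n where "n = {x \<in> b. \<phi> x = \<zero>\<^bsub>E\<^esub>}"
  have n: "ideal n R"
  proof (rule ideal_lin_combI[OF cring])
    show "n \<subseteq> carrier R" using b.Icarr by (auto simp: n_def)
    show "\<zero> \<in> n" using \<phi>zero b.zero_closed by (simp add: n_def)
    show "r \<otimes> x \<oplus> s \<otimes> y \<in> n" if "r \<in> carrier R" "s \<in> carrier R" "x \<in> n" "y \<in> n" for r x s y
      using that by (simp add: n_def add mult b.I_l_closed)
  qed
  \<comment> \<open>As \<open>n\<close> is contained in \<open>b\<close>, a member \<open>c\<close>
    satisfies c \<inter> b = n. Hence \<open>\<phi>\<close> vanishes on the overlap of
    \<open>b\<close> and \<open>c\<close>, as an extension by zero on \<open>c\<close>
    demands.\<close>
  define \<F> where "\<F> = {c. ideal c R \<and> n \<subseteq> c \<and> c \<inter> b \<subseteq> n}"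
  have "\<F> \<noteq> {}" using n unfolding \<F>_def by blast
  then obtain c where c: "c \<in> \<F>" and max: "\<And>c'. c' \<in> \<F> \<Longrightarrow> c \<subseteq> c' \<Longrightarrow> c' = c"
    by (rule noetherian_maximal_ideal[OF noeth]) (auto simp: \<F>_def)
  have cid: "ideal c R" and nc: "n \<subseteq> c" and cb: "\<And>x. x \<in> c \<Longrightarrow> x \<in> b \<Longrightarrow> \<phi> x = \<zero>\<^bsub>E\<^esub>"
    using c by (auto simp: \<F>_def n_def)
  interpret c: ideal c R by (rule cid)
  have rad: "\<exists>k::nat. a [^] k \<in> c" if a: "a \<in> I" for a
  proof -
    have aR: "a \<in> carrier R" by (rule I.Icarr[OF a])
    \<comment> \<open>The ideal quotients (c : a^k). They increase with \<open>k\<close>, so at a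
      maximal one they have stabilised; this is \<open>qk\<close>.\<close>
    define q where "q k = {s \<in> carrier R. s \<otimes> a [^] k \<in> c}" for k :: nat
    have q: "ideal (q k) R" for k
    proof (rule ideal_lin_combI[OF cring])
      show "r \<otimes> x \<oplus> s \<otimes> y \<in> q k" if "r \<in> carrier R" "s \<in> carrier R" "x \<in> q k" "y \<in> q k" for r x s y
        using that aR c.I_l_closed by (simp add: q_def E.R.l_distr E.R.m_assoc)
    qed (use aR in \<open>auto simp: q_def\<close>)
    have "range q \<noteq> {}" by simp
    then obtain Q where Q: "Q \<in> range q" "\<And>Q'. Q' \<in> range q \<Longrightarrow> Q \<subseteq> Q' \<Longrightarrow> Q' = Q"
      by (rule noetherian_maximal_ideal[OF noeth]) (use q in auto)
    then obtain k where "Q = q k" by blast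
    then have k: "q k' = q k" if "q k \<subseteq> q k'" for k' using Q(2)[of "q k'"] that by simp
    have qk: "s \<in> q k" if "s \<in> q (m + k)" for s m
    proof -
      have "q k \<subseteq> q (m + k)"
      proof
        fix s assume s: "s \<in> q k"
        then have "s \<otimes> a [^] k \<in> c" by (simp add: q_def)
        then have "a [^] m \<otimes> (s \<otimes> a [^] k) \<in> c"
          by (rule c.I_l_closed) (use aR in simp)
        also have "a [^] m \<otimes> (s \<otimes> a [^] k) = s \<otimes> a [^] (m + k)"
          using aR s by (simp add: q_def E.R.nat_pow_mult[symmetric] E.R.m_ac)
        finally show "s \<in> q (m + k)" using s by (simp add: q_def)
      qed
      then show ?thesis using k that by blast
    qed
    let ?u = "a [^] k"
    let ?c' = "c <+>\<^bsub>R\<^esub> PIdl ?u"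
    have u: "?u \<in> carrier R" using aR by simp
    note c' = ideal_add_cgenideal[OF cring cid u]
    \<comment> \<open>Let r = x + s a^k be in \<open>b\<close>. Some a^m kills \<phi>(r), so a^m r
      lies in \<open>n\<close> and hence in \<open>c\<close>. Then s a^(m+k) is in \<open>c\<close>,
      by stability s a^k is too, and r lies in c \<inter> b = n. Maximality of \<open>c\<close> now
      forces a^k into \<open>c\<close>.\<close>
    have "?c' \<inter> b \<subseteq> n"
    proof
      fix r assume "r \<in> ?c' \<inter> b"
      then obtain x s where r: "r \<in> b" "x \<in> c" "s \<in> carrier R" "r = x \<oplus> s \<otimes> ?u"
        by (auto simp: mem_ideal_add_cgenideal)
      have xR: "x \<in> carrier R" by (rule c.Icarr[OF r(2)])
      obtain m :: nat where m: "(a [^] m) \<odot>\<^bsub>E\<^esub> \<phi> r = \<zero>\<^bsub>E\<^esub>"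
        using \<phi>T[OF r(1)] a unfolding torsion_def by blast
      let ?am = "a [^] m"
      have "?am \<otimes> r \<in> n" using m r(1) aR by (simp add: n_def mult b.I_l_closed)
      then have amr: "?am \<otimes> r \<in> c" using nc by blast
      have "?am \<otimes> r \<ominus> ?am \<otimes> x \<in> c"
        using amr r(2) aR c.I_l_closed by (simp add: a_minus_def)
      also have "?am \<otimes> r \<ominus> ?am \<otimes> x = s \<otimes> (?am \<otimes> ?u)"
      proof -
        have "?am \<in> carrier R" using aR by simp
        then show ?thesis using r(3,4) xR u by algebra
      qed
      also have "?am \<otimes> ?u = a [^] (m + k)" using aR by (simp add: E.R.nat_pow_mult)
      finally have "s \<in> q (m + k)" using r(3) by (simp add: q_def)
      then have "s \<otimes> ?u \<in> c" using qk by (simp add: q_def)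
      then have "r \<in> c" using r by simp
      then show "r \<in> n" using r(1) c by (auto simp: \<F>_def)
    qed
    then have "?c' \<in> \<F>" using c' nc by (auto simp: \<F>_def)
    then have "?c' = c" using max c'(2) by blast
    then show ?thesis using c'(3) by blast
  qed
  have bR: "x \<in> carrier R" if "x \<in> b" for x using b.Icarr[OF that] .
  have cR: "x \<in> carrier R" if "x \<in> c" for x using c.Icarr[OF that] .
  \<comment> \<open>The extension to b + c by zero on \<open>c\<close>. The value is independent of
    the chosen decomposition: two \<open>b\<close>-parts differ by an element of b \<inter> c, where
    \<open>\<phi>\<close> vanishes.\<close>
  define \<psi> where "\<psi> z = \<phi> (SOME x. x \<in> b \<and> (\<exists>y\<in>c. z = x \<oplus> y))" for z
  have \<psi>: "\<psi> (x \<oplus> y) = \<phi> x" if xy: "x \<in> b" "y \<in> c" for x y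
  proof -
    define x' where "x' = (SOME x'. x' \<in> b \<and> (\<exists>y'\<in>c. x \<oplus> y = x' \<oplus> y'))"
    have "x' \<in> b \<and> (\<exists>y'\<in>c. x \<oplus> y = x' \<oplus> y')"
      unfolding x'_def by (rule someI[of _ x]) (use xy in blast)
    then obtain y' where x': "x' \<in> b" "y' \<in> c" "x \<oplus> y = x' \<oplus> y'" by blast
    define w where "w = y \<ominus> y'"
    have wc: "w \<in> c" using xy x' by (simp add: w_def a_minus_def)
    have c4: "x \<in> carrier R" "y \<in> carrier R" "x' \<in> carrier R" "y' \<in> carrier R"
      using xy x' bR cR by auto
    have w: "w = x' \<ominus> x"
    proof -
      have "y \<ominus> y' = (x \<oplus> y) \<ominus> x \<ominus> y'" using c4 by algebra
      also have "\<dots> = x' \<ominus> x" unfolding x'(3) using c4 by algebra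
      finally show ?thesis unfolding w_def .
    qed
    have wb: "w \<in> b" unfolding w using xy x' by (simp add: a_minus_def)
    have "x' = x \<oplus> w" unfolding w using c4 by algebra
    then have "\<phi> x' = \<phi> x" using add[OF xy(1) wb] cb[OF wc wb] \<phi>[OF xy(1)] by simp
    then show ?thesis unfolding \<psi>_def x'_def[symmetric] .
  qed
  define J where "J = b <+>\<^bsub>R\<^esub> c"
  have mem: "z \<in> J \<longleftrightarrow> (\<exists>x\<in>b. \<exists>y\<in>c. z = x \<oplus> y)" for z by (auto simp: J_def set_add_def')
  have J: "ideal J R" unfolding J_def by (rule E.R.add_ideals[OF b cid])
  have "\<psi> \<in> J \<rightarrow> carrier E" using \<psi> \<phi> by (auto simp: mem)
  moreover have "\<forall>z\<in>J. \<forall>z'\<in>J. \<psi> (z \<oplus> z') = \<psi> z \<oplus>\<^bsub>E\<^esub> \<psi> z'"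
  proof (intro ballI)
    fix z z' assume "z \<in> J" "z' \<in> J"
    then obtain x y x' y' where *: "x \<in> b" "y \<in> c" "x' \<in> b" "y' \<in> c" "z = x \<oplus> y" "z' = x' \<oplus> y'"
      by (auto simp: mem)
    then have "z \<oplus> z' = (x \<oplus> x') \<oplus> (y \<oplus> y')" using bR cR by (simp add: E.R.a_ac)
    then show "\<psi> (z \<oplus> z') = \<psi> z \<oplus>\<^bsub>E\<^esub> \<psi> z'" using * by (simp add: \<psi> add)
  qed
  moreover have "\<forall>r\<in>carrier R. \<forall>z\<in>J. \<psi> (r \<otimes> z) = r \<odot>\<^bsub>E\<^esub> \<psi> z"
  proof (intro ballI)
    fix r z assume r: "r \<in> carrier R" and "z \<in> J"
    then obtain x y where *: "x \<in> b" "y \<in> c" "z = x \<oplus> y" by (auto simp: mem)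
    then have "r \<otimes> z = r \<otimes> x \<oplus> r \<otimes> y" using bR cR r by (simp add: E.R.r_distr)
    then show "\<psi> (r \<otimes> z) = r \<odot>\<^bsub>E\<^esub> \<psi> z"
      using * r by (simp add: \<psi> mult b.I_l_closed c.I_l_closed)
  qed
  ultimately obtain e where e: "e \<in> carrier E" "\<And>z. z \<in> J \<Longrightarrow> \<psi> z = z \<odot>\<^bsub>E\<^esub> e"
    using J baer[unfolded baer_module_def, THEN spec, THEN spec, of J \<psi>] by auto
  have "y \<odot>\<^bsub>E\<^esub> e = \<zero>\<^bsub>E\<^esub>" if y: "y \<in> c" for y
  proof -
    have "\<zero> \<oplus> y \<in> J" unfolding mem using y b.zero_closed by blast
    then show ?thesis using e(2) \<psi>[OF b.zero_closed y] \<phi>zero cR[OF y] by simp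
  qed
  \<comment> \<open>\<open>c\<close> kills \<open>e\<close> and contains a power of every element of
    \<open>I\<close>.\<close>
  then have "e \<in> torsion R I E" using rad e(1) unfolding torsion_def by blast
  moreover have "\<phi> x = x \<odot>\<^bsub>E\<^esub> e" if x: "x \<in> b" for x
  proof -
    have "x \<oplus> \<zero> \<in> J" unfolding mem using x c.zero_closed by blast
    then show ?thesis using e(2) \<psi>[OF x c.zero_closed] bR[OF x] by simp
  qed
  ultimately show "\<exists>e\<in>carrier (E\<lparr>carrier := torsion R I E\<rparr>).
      \<forall>x\<in>b. \<phi> x = x \<odot>\<^bsub>E\<lparr>carrier := torsion R I E\<rparr>\<^esub> e" by auto
qed

section \<open>Zigzags in the double complex\<close>

lemma lin_comb_zero [simp]:
  assumes "module R M" "r \<in> carrier R" "s \<in> carrier R" "f x = \<zero>\<^bsub>M\<^esub>" "g x = \<zero>\<^bsub>M\<^esub>"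
  shows "lin_comb M r f s g x = \<zero>\<^bsub>M\<^esub>"
proof -
  interpret M: module R M by fact
  show ?thesis using assms by (simp add: lin_comb_def)
qed

lemma lin_comb_submodule:
  assumes "module R M" "submodule C R M" "r \<in> carrier R" "s \<in> carrier R" "f x \<in> C" "g x \<in> C"
  shows "lin_comb M r f s g x \<in> C"
proof -
  interpret M: module R M by fact
  show ?thesis using assms M.submoduleE(4,5)[OF assms(2)] by (simp add: lin_comb_def)
qed

lemma module_hom_into_submodule:
  assumes "C \<subseteq> carrier N"
  shows "f \<in> module_hom R M (N\<lparr>carrier := C\<rparr>) \<longleftrightarrow>
    f \<in> module_hom R M N \<and> (\<forall>x\<in>carrier M. f x \<in> C)"
  using assms by (auto simp: module_hom_def)

lemma module_hom_from_submodule: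
  assumes "f \<in> module_hom R M N" "C \<subseteq> carrier M"
  shows "f \<in> module_hom R (M\<lparr>carrier := C\<rparr>) N"
  using assms(2) module_homD[OF assms(1)] by (intro module_homI) (auto simp: subset_eq)

text \<open>\<open>I\<close> is a subcomplex of \<open>E\<close>, kept as a family of subsets so
  that all maps share the operations of \<open>E\<close>. Its cohomology enters only as modules
  \<open>H j\<close> with surjections \<open>q j\<close> from the cycles whose kernel is the
  boundaries, so zigzags are handled without cosets.\<close>

locale zigzag =
  fixes R :: "('a, 'r) ring_scheme" (structure)
    and P :: "nat \<Rightarrow> ('a, 'f) module" and \<delta> :: "nat \<Rightarrow> 'f \<Rightarrow> 'f"
    and E :: "nat \<Rightarrow> ('a, 'c) module" and d :: "nat \<Rightarrow> 'c \<Rightarrow> 'c"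
    and I :: "nat \<Rightarrow> 'c set"
    and H :: "nat \<Rightarrow> ('a, 'h) module" and q :: "nat \<Rightarrow> 'c \<Rightarrow> 'h"
    and t :: nat
  assumes cring: "cring R"
    and P_projective: "\<And>i. projective_module R (P i)"
    and \<delta>: "\<And>i. \<delta> i \<in> module_hom R (P (Suc i)) (P i)"
    and \<delta>\<delta>: "\<And>i x. x \<in> carrier (P (Suc (Suc i))) \<Longrightarrow> \<delta> i (\<delta> (Suc i) x) = \<zero>\<^bsub>P i\<^esub>"
    and E: "\<And>j. module R (E j)"
    and d: "\<And>j. d j \<in> module_hom R (E j) (E (Suc j))"
    and dd: "\<And>j x. x \<in> carrier (E j) \<Longrightarrow> d (Suc j) (d j x) = \<zero>\<^bsub>E (Suc (Suc j))\<^esub>"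
    and I: "\<And>j. submodule (I j) R (E j)"
    and dI: "\<And>j x. x \<in> I j \<Longrightarrow> d j x \<in> I (Suc j)"
    and H: "\<And>j. module R (H j)"
    and q: "\<And>j. q j \<in> module_hom R ((E j)\<lparr>carrier := {x \<in> I j. d j x = \<zero>\<^bsub>E (Suc j)\<^esub>}\<rparr>) (H j)"
    and q_onto: "\<And>j y. y \<in> carrier (H j) \<Longrightarrow> \<exists>x\<in>I j. d j x = \<zero>\<^bsub>E (Suc j)\<^esub> \<and> q j x = y"
    and q_zero: "\<And>j x. x \<in> I j \<Longrightarrow> d j x = \<zero>\<^bsub>E (Suc j)\<^esub> \<Longrightarrow>
      q j x = \<zero>\<^bsub>H j\<^esub> \<longleftrightarrow> x \<in> (case j of 0 \<Rightarrow> {\<zero>\<^bsub>E 0\<^esub>} | Suc m \<Rightarrow> d m ` I m)"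
begin

section \<open>Cycles, boundaries and partial zigzags\<close>

definition Z :: "nat \<Rightarrow> 'c set" where
  "Z j = {x \<in> I j. d j x = \<zero>\<^bsub>E (Suc j)\<^esub>}"

definition B :: "nat \<Rightarrow> 'c set" where
  "B j = (case j of 0 \<Rightarrow> {\<zero>\<^bsub>E 0\<^esub>} | Suc m \<Rightarrow> d m ` I m)"

abbreviation "P_hom i N \<equiv> module_hom R (P i) N"

lemma P: "module R (P i)"
  using P_projective by (simp add: projective_module_def)

lemmas \<delta>_closed = module_homD(1)[OF \<delta>]
lemmas d_closed = module_homD(1)[OF d]

lemma I_closed: "x \<in> I j \<Longrightarrow> x \<in> carrier (E j)"
  using module.submoduleE(1)[OF E I] by blast

lemma IM: "module R ((E j)\<lparr>carrier := I j\<rparr>)"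
  by (rule submodule.submodule_is_module[OF I E])

lemma Z: "submodule (Z j) R (E j)"
proof (rule submodule_lin_combI[OF E])
  interpret E': module R "E j" by (rule E)
  interpret E'': module R "E (Suc j)" by (rule E)
  show "Z j \<subseteq> carrier (E j)" using I_closed by (auto simp: Z_def)
  show "\<zero>\<^bsub>E j\<^esub> \<in> Z j" using submodule_zero[OF I] module_hom_zero[OF E E d] by (simp add: Z_def)
  show "r \<odot>\<^bsub>E j\<^esub> x \<oplus>\<^bsub>E j\<^esub> s \<odot>\<^bsub>E j\<^esub> y \<in> Z j"
    if "r \<in> carrier R" "s \<in> carrier R" "x \<in> Z j" "y \<in> Z j" for r x s y
    using that I_closed module_homD(2,3)[OF d] E'.submoduleE(4,5)[OF I] by (simp add: Z_def)
qed

lemma Z_closed: "x \<in> Z j \<Longrightarrow> x \<in> carrier (E j)"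
  using I_closed by (simp add: Z_def)

lemma ZM: "module R ((E j)\<lparr>carrier := Z j\<rparr>)"
  by (rule submodule.submodule_is_module[OF Z E])

lemma qZ: "q j \<in> module_hom R ((E j)\<lparr>carrier := Z j\<rparr>) (H j)"
  using q by (simp add: Z_def)

lemma q_closed: "x \<in> Z j \<Longrightarrow> q j x \<in> carrier (H j)"
  using module_homD(1)[OF qZ] by simp

lemma q_lin:
  assumes "r \<in> carrier R" "s \<in> carrier R" "x \<in> Z j" "y \<in> Z j"
  shows "q j (r \<odot>\<^bsub>E j\<^esub> x \<oplus>\<^bsub>E j\<^esub> s \<odot>\<^bsub>E j\<^esub> y) = r \<odot>\<^bsub>H j\<^esub> q j x \<oplus>\<^bsub>H j\<^esub> s \<odot>\<^bsub>H j\<^esub> q j y"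
proof -
  interpret E': module R "E j" by (rule E)
  show ?thesis
    using assms module_homD(2,3)[OF qZ] E'.submoduleE(4)[OF Z] by simp
qed

lemma q_zero_iff: "x \<in> Z j \<Longrightarrow> q j x = \<zero>\<^bsub>H j\<^esub> \<longleftrightarrow> x \<in> B j"
  using q_zero by (simp add: Z_def B_def)

lemma B_subset_Z: "B j \<subseteq> Z j"
proof (cases j)
  case 0
  then show ?thesis using submodule_zero[OF Z] by (auto simp: B_def)
next
  case (Suc m)
  then show ?thesis using dI dd I_closed by (auto simp: B_def Z_def)
qed

lemma B: "submodule (B j) R (E j)"
proof (cases j)
  case 0
  interpret E': module R "E 0" by (rule E)
  show ?thesis by (auto simp: 0 B_def intro: submodule_lin_combI[OF E])
next
  case (Suc m)
  have "d m \<in> module_hom R ((E m)\<lparr>carrier := I m\<rparr>) (E (Suc m))"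
    by (rule module_hom_from_submodule[OF d]) (use I_closed in blast)
  from image_submodule[OF IM E this] show ?thesis by (simp add: B_def Suc)
qed

text \<open>Only \<open>f 0, \<dots>, f (min k t)\<close> matter; \<open>k = t + 1\<close> adds \<open>f t \<circ> \<delta> t = 0\<close>.\<close>

definition chain :: "nat \<Rightarrow> (nat \<Rightarrow> 'f \<Rightarrow> 'c) \<Rightarrow> bool" where
  "chain k f \<longleftrightarrow>
     (\<forall>i\<le>k. i \<le> t \<longrightarrow> f i \<in> P_hom i (E (t - i)) \<and> (\<forall>x\<in>carrier (P i). f i x \<in> I (t - i))) \<and>
     (\<forall>x\<in>carrier (P 0). d t (f 0 x) = \<zero>\<^bsub>E (Suc t)\<^esub>) \<and>
     (\<forall>i<k. i < t \<longrightarrow> (\<forall>x\<in>carrier (P (Suc i)). d (t - Suc i) (f (Suc i) x) = f i (\<delta> i x))) \<and>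
     (t < k \<longrightarrow> (\<forall>x\<in>carrier (P (Suc t)). f t (\<delta> t x) = \<zero>\<^bsub>E 0\<^esub>))"

lemma chainD:
  assumes "chain k f"
  shows "i \<le> k \<Longrightarrow> i \<le> t \<Longrightarrow> f i \<in> P_hom i (E (t - i))"
    and "i \<le> k \<Longrightarrow> i \<le> t \<Longrightarrow> x \<in> carrier (P i) \<Longrightarrow> f i x \<in> I (t - i)"
    and "x \<in> carrier (P 0) \<Longrightarrow> f 0 x \<in> Z t"
    and "i < k \<Longrightarrow> i < t \<Longrightarrow> x \<in> carrier (P (Suc i)) \<Longrightarrow> d (t - Suc i) (f (Suc i) x) = f i (\<delta> i x)"
    and "t < k \<Longrightarrow> x \<in> carrier (P (Suc t)) \<Longrightarrow> f t (\<delta> t x) = \<zero>\<^bsub>E 0\<^esub>"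
  using assms by (fastforce simp: chain_def Z_def)+

text \<open>For i > 0 the reason is d f_i \<delta> = f_{i-1} \<delta> \<delta> = 0; for i = 0,
  \<open>f 0\<close> itself is cycle-valued. So q(f_i \<delta>) is defined, and it is the
  obstruction to the next step.\<close>

lemma chain_end:
  assumes "chain k f" "i \<le> k" "i \<le> t" "x \<in> carrier (P (Suc i))"
  shows "f i (\<delta> i x) \<in> Z (t - i)"
proof (cases i)
  case 0
  then show ?thesis using chainD(3)[OF assms(1) \<delta>_closed] assms(4) by simp
next
  case (Suc m)
  have "d (t - i) (f i (\<delta> i x)) = f m (\<delta> m (\<delta> i x))"
    using chainD(4)[OF assms(1), of m "\<delta> i x"] Suc assms \<delta>_closed[of x i] by simp
  also have "\<dots> = \<zero>\<^bsub>E (t - m)\<^esub>"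
    using \<delta>\<delta>[of x m] assms(4) Suc assms(2,3) module_hom_zero[OF P E chainD(1)[OF assms(1), of m]] by simp
  also have "t - m = Suc (t - i)" using Suc assms(3) by simp
  finally show ?thesis using chainD(2)[OF assms(1-3) \<delta>_closed[OF assms(4)]] by (simp add: Z_def)
qed

lemma chain_lin_comb:
  assumes f: "chain k f" and g: "chain k g" and rs: "r \<in> carrier R" "s \<in> carrier R"
  shows "chain k (\<lambda>i. lin_comb (E (t - i)) r (f i) s (g i))"
  unfolding chain_def
proof (intro conjI allI impI ballI)
  fix i assume i: "i \<le> k" "i \<le> t"
  show "lin_comb (E (t - i)) r (f i) s (g i) \<in> P_hom i (E (t - i))"
    by (rule lin_comb_module_hom[OF P E chainD(1)[OF f i] chainD(1)[OF g i] rs])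
  fix x assume "x \<in> carrier (P i)"
  then show "lin_comb (E (t - i)) r (f i) s (g i) x \<in> I (t - i)"
    by (intro lin_comb_submodule[OF E I rs] chainD(2)[OF f i] chainD(2)[OF g i])
next
  fix x assume "x \<in> carrier (P 0)"
  then show "d t (lin_comb (E (t - 0)) r (f 0) s (g 0) x) = \<zero>\<^bsub>E (Suc t)\<^esub>"
    using lin_comb_submodule[where f = "f 0" and g = "g 0" and x = x, OF E Z rs] chainD(3)[OF f] chainD(3)[OF g]
    by (simp add: Z_def)
next
  fix i x assume i: "i < k" "i < t" and x: "x \<in> carrier (P (Suc i))"
  have c: "f (Suc i) x \<in> carrier (E (t - Suc i))" "g (Suc i) x \<in> carrier (E (t - Suc i))"
    using i x chainD(2)[OF f, of "Suc i"] chainD(2)[OF g, of "Suc i"] I_closed by auto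
  show "d (t - Suc i) (lin_comb (E (t - Suc i)) r (f (Suc i)) s (g (Suc i)) x) =
      lin_comb (E (t - i)) r (f i) s (g i) (\<delta> i x)"
    using module_hom_lin_comb[OF E d rs, of "f (Suc i)" x "t - Suc i" "g (Suc i)"] c
      chainD(4)[OF f i x] chainD(4)[OF g i x] Suc_diff_Suc[OF i(2)]
    by (simp add: lin_comb_def)
next
  fix x assume "t < k" "x \<in> carrier (P (Suc t))"
  then show "lin_comb (E (t - t)) r (f t) s (g t) (\<delta> t x) = \<zero>\<^bsub>E 0\<^esub>"
    using lin_comb_zero[OF E rs, of "f t" "\<delta> t x" 0 "g t"] chainD(5)[OF f] chainD(5)[OF g] by simp
qed

lemma chain_zero: "chain k (\<lambda>i x. \<zero>\<^bsub>E (t - i)\<^esub>)"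
  unfolding chain_def
  using const_zero_module_hom[OF E] submodule_zero[OF I] module_hom_zero[OF E E d]
  by (auto simp: Suc_diff_Suc)

lemma chain_mono: "chain k f \<Longrightarrow> l \<le> k \<Longrightarrow> chain l f"
  by (auto simp: chain_def)

text \<open>For s < t the next component is a lift of f_s \<delta> along d : I_{t-s-1} \<rightarrow>
  E_{t-s}, whose image is \<open>B (t - s)\<close>. For s = t nothing is added to \<open>f\<close>:
  as \<open>B 0\<close> is zero, the hypothesis is the closing equation itself.\<close>

lemma chain_extend:
  assumes f: "chain s f" "s \<le> t" and B: "\<And>x. x \<in> carrier (P (Suc s)) \<Longrightarrow> f s (\<delta> s x) \<in> B (t - s)"
  obtains f' where "chain (Suc s) f'" "\<And>i. i \<le> s \<Longrightarrow> f' i = f i"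
proof (cases "s = t")
  case True
  have "chain (Suc s) f"
    using f B True unfolding chain_def by (auto simp: B_def le_Suc_eq less_Suc_eq)
  then show thesis by (rule that) simp
next
  case False
  with f have s: "s < t" by simp
  let ?j = "t - Suc s"
  have j: "t - s = Suc ?j" using s by simp
  have dj: "d ?j \<in> module_hom R ((E ?j)\<lparr>carrier := I ?j\<rparr>) (E (t - s))"
    unfolding j by (rule module_hom_from_submodule[OF d]) (use I_closed in blast)
  have fs: "(\<lambda>x. f s (\<delta> s x)) \<in> P_hom (Suc s) (E (t - s))"
    by (rule module_hom_comp[OF \<delta> chainD(1)[OF f(1) _ f(2)]]) simp
  obtain h where h: "h \<in> P_hom (Suc s) ((E ?j)\<lparr>carrier := I ?j\<rparr>)"
    "\<And>x. x \<in> carrier (P (Suc s)) \<Longrightarrow> d ?j (h x) = f s (\<delta> s x)"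
    by (rule projective_lift[OF P_projective IM E dj fs]) (use B in \<open>auto simp: B_def j\<close>)
  have h': "h \<in> P_hom (Suc s) (E ?j)" "\<And>x. x \<in> carrier (P (Suc s)) \<Longrightarrow> h x \<in> I ?j"
    using h(1) module_hom_into_submodule[of "I ?j" "E ?j" h R "P (Suc s)"] I_closed by blast+
  have "chain (Suc s) (f(Suc s := h))"
    using f(1) h h' s unfolding chain_def by (auto simp: le_Suc_eq less_Suc_eq)
  then show thesis by (rule that) simp
qed

end

lemma lin_comb_minus_one:
  fixes R (structure)
  assumes "module R M" "f x \<in> carrier M" "g x \<in> carrier M"
  shows "lin_comb M \<one> f (\<ominus> \<one>) g x = f x \<ominus>\<^bsub>M\<^esub> g x"
proof -
  interpret M: module R M by fact
  show ?thesis using assms by (simp add: lin_comb_def M.smult_l_minus a_minus_def)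
qed

lemma lin_comb_minus_self:
  fixes R (structure)
  assumes "module R M" "r \<in> carrier R" "f x \<in> carrier M" "g x = r \<odot>\<^bsub>M\<^esub> f x"
  shows "lin_comb M r f (\<ominus> \<one>) g x = \<zero>\<^bsub>M\<^esub>"
proof -
  interpret M: module R M by fact
  show ?thesis using assms by (simp add: lin_comb_def M.smult_l_minus M.M.r_neg)
qed

lemma lin_comb_right_zero:
  assumes "module R M" "r \<in> carrier R" "s \<in> carrier R" "f x \<in> carrier M" "g x = \<zero>\<^bsub>M\<^esub>"
  shows "lin_comb M r f s g x = r \<odot>\<^bsub>M\<^esub> f x"
proof -
  interpret M: module R M by fact
  show ?thesis using assms by (simp add: lin_comb_def)
qed

lemma ext_cocycles_lin_comb:
  assumes "\<And>i. module R (P i)" "module R N" "r \<in> carrier R" "s \<in> carrier R"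
    and "u \<in> ext_cocycles R P \<delta> n N" "v \<in> ext_cocycles R P \<delta> n N"
  shows "lin_comb N r u s v \<in> ext_cocycles R P \<delta> n N"
  using assms lin_comb_module_hom[OF assms(1,2) _ _ assms(3,4)] lin_comb_zero[OF assms(2-4)]
  by (simp add: ext_cocycles_def)

lemma ext_cocycles_smult:
  assumes "\<And>i. module R (P i)" "module R N" "r \<in> carrier R" "u \<in> ext_cocycles R P \<delta> n N"
  shows "(\<lambda>x. r \<odot>\<^bsub>N\<^esub> u x) \<in> ext_cocycles R P \<delta> n N"
proof -
  interpret N: module R N by fact
  show ?thesis using assms smult_module_hom[OF assms(1,2) _ assms(3)] by (simp add: ext_cocycles_def)
qed

section \<open>Liftable maps and their obstruction classes\<close>

context zigzag
begin

abbreviation "cocycles \<equiv> ext_cocycles R P \<delta>"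

abbreviation "Ext \<equiv> Ext_module R P \<delta>"

abbreviation Ass_Ext :: "nat \<Rightarrow> ('a, 'n) module \<Rightarrow> ('f \<Rightarrow> 'n) set set \<Rightarrow> 'a set set" where
  "Ass_Ext n N L \<equiv> associated_primes R (quotient_module (Ext n N) L)"

text \<open>Between \<open>lifts s u\<close> and \<open>lifts (Suc s) u\<close> stands an
  obstruction in Ext^(s+1)(S/a, H_{t-s}); \<open>lifts (Suc t) u\<close> means that a complete
  zigzag exists.\<close>

definition lifts :: "nat \<Rightarrow> ('f \<Rightarrow> 'h) \<Rightarrow> bool" where
  "lifts k u \<longleftrightarrow> (\<exists>f. chain k f \<and> (\<forall>x\<in>carrier (P 0). q t (f 0 x) = u x))"

lemma minus_one_closed: "\<one> \<in> carrier R" "\<ominus> \<one> \<in> carrier R"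
proof -
  interpret cring R by (rule cring)
  show "\<one> \<in> carrier R" "\<ominus> \<one> \<in> carrier R" by simp_all
qed

lemma q_lin_comb:
  assumes "r \<in> carrier R" "s \<in> carrier R" "f x \<in> Z j" "g x \<in> Z j"
  shows "q j (lin_comb (E j) r f s g x) = lin_comb (H j) r (\<lambda>x. q j (f x)) s (\<lambda>x. q j (g x)) x"
  unfolding lin_comb_def by (rule q_lin[OF assms])

lemma q_0: "q j \<zero>\<^bsub>E j\<^esub> = \<zero>\<^bsub>H j\<^esub>"
  using q_zero_iff[OF submodule_zero[OF Z]] submodule_zero[OF B] by simp

lemma q_lift:
  assumes "v \<in> P_hom i (H j)"
  obtains h where "h \<in> P_hom i (E j)" "\<And>x. x \<in> carrier (P i) \<Longrightarrow> h x \<in> Z j"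
    "\<And>x. x \<in> carrier (P i) \<Longrightarrow> q j (h x) = v x"
proof -
  obtain h where h: "h \<in> P_hom i ((E j)\<lparr>carrier := Z j\<rparr>)"
    "\<And>x. x \<in> carrier (P i) \<Longrightarrow> q j (h x) = v x"
  proof (rule projective_lift[OF P_projective ZM H qZ assms])
    fix x assume "x \<in> carrier (P i)"
    then show "v x \<in> q j ` carrier ((E j)\<lparr>carrier := Z j\<rparr>)"
      using q_onto[OF module_homD(1)[OF assms \<open>x \<in> carrier (P i)\<close>]]
      unfolding Z_def by (simp add: image_iff Bex_def) metis
  qed blast
  then show thesis
    using that module_hom_into_submodule[of "Z j" "E j" h R "P i"] Z_closed by blast
qed

text \<open>The first obstruction is the class of f_0 \<delta>, which is u \<delta> = 0. This is why
  the stages begin with s = 1 and only the \<open>H j\<close> with j < t contribute to the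
  union.\<close>

lemma lifts_one:
  assumes u: "u \<in> P_hom 0 (H t)" and u0: "\<And>x. x \<in> carrier (P 1) \<Longrightarrow> u (\<delta> 0 x) = \<zero>\<^bsub>H t\<^esub>"
  shows "lifts 1 u"
proof -
  obtain h where h: "h \<in> P_hom 0 (E t)" "\<And>x. x \<in> carrier (P 0) \<Longrightarrow> h x \<in> Z t"
    "\<And>x. x \<in> carrier (P 0) \<Longrightarrow> q t (h x) = u x" by (rule q_lift[OF u]) blast
  have c: "chain 0 (\<lambda>_. h)" using h by (auto simp: chain_def Z_def)
  have hB: "h (\<delta> 0 x) \<in> B (t - 0)" if "x \<in> carrier (P (Suc 0))" for x
    using q_zero_iff[OF h(2)[OF \<delta>_closed[OF that]]] h(3)[OF \<delta>_closed[OF that]] u0 that by simp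
  show ?thesis
  proof (rule chain_extend[OF c le0 hB])
    fix f assume f: "chain (Suc 0) f" "\<And>i. i \<le> 0 \<Longrightarrow> f i = h"
    have "f 0 = h" by (rule f(2)) simp
    then show ?thesis using f(1) h(3) unfolding lifts_def by auto
  qed
qed

text \<open>Converse to \<open>chain_extend\<close>: a zigzag that continues has zero
  obstruction.\<close>

lemma chain_boundary:
  assumes "chain (Suc s) f" "s \<le> t" "x \<in> carrier (P (Suc s))"
  shows "f s (\<delta> s x) \<in> B (t - s)"
proof (cases "s = t")
  case True
  then show ?thesis using chainD(5)[OF assms(1)] assms(3) by (simp add: B_def)
next
  case False
  with assms(2) have s: "s < t" by simp
  have "f s (\<delta> s x) = d (t - Suc s) (f (Suc s) x)" using chainD(4)[OF assms(1) _ s assms(3)] by simp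
  moreover have "f (Suc s) x \<in> I (t - Suc s)" using chainD(2)[OF assms(1) _ _ assms(3)] s by simp
  ultimately show ?thesis using Suc_diff_Suc[OF s] by (auto simp: B_def simp flip: Suc_diff_Suc[OF s])
qed

lemma chain_class_cocycle:
  assumes f: "chain s f" "s \<le> t"
  shows "(\<lambda>x. q (t - s) (f s (\<delta> s x))) \<in> cocycles (Suc s) (H (t - s))"
proof -
  have fs: "f s \<in> P_hom s (E (t - s))" by (rule chainD(1)[OF f(1) _ f(2)]) simp
  have "(\<lambda>x. f s (\<delta> s x)) \<in> P_hom (Suc s) ((E (t - s))\<lparr>carrier := Z (t - s)\<rparr>)"
    using module_hom_into_submodule[of "Z (t - s)" "E (t - s)"] Z_closed
      module_hom_comp[OF \<delta> fs] chain_end[OF f(1) _ f(2)] by blast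
  from module_hom_comp[OF this qZ] show ?thesis
    using module_hom_zero[OF P E fs] by (simp add: ext_cocycles_def \<delta>\<delta> q_0)
qed

text \<open>The last component enters the equations of \<open>chain s\<close> only through
  \<open>d\<close>, so it may be changed by a cycle-valued \<open>h\<close>. This moves the
  obstruction by the coboundary of q h. The bound 1 \<le> s keeps \<open>f 0\<close>, and with it
  the lifted map, fixed.\<close>

lemma chain_modify_end:
  assumes f: "chain s f" and s: "1 \<le> s" "s \<le> t"
    and h: "h \<in> P_hom s (E (t - s))" "\<And>x. x \<in> carrier (P s) \<Longrightarrow> h x \<in> Z (t - s)"
  shows "chain s (f(s := lin_comb (E (t - s)) \<one> (f s) (\<ominus> \<one>) h))"
proof -
  interpret cring R by (rule cring)
  let ?f = "lin_comb (E (t - s)) \<one> (f s) (\<ominus> \<one>) h"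
  obtain m where m: "s = Suc m" using s by (cases s) auto
  note one = minus_one_closed
  have fs: "f s \<in> P_hom s (E (t - s))" by (rule chainD(1)[OF f _ s(2)]) simp
  have fI: "f s x \<in> I (t - s)" if "x \<in> carrier (P s)" for x by (rule chainD(2)[OF f _ s(2) that]) simp
  have hom: "?f \<in> P_hom s (E (t - s))" by (rule lin_comb_module_hom[OF P E fs h(1) one])
  have into: "?f x \<in> I (t - s)" if "x \<in> carrier (P s)" for x
    by (rule lin_comb_submodule[where f = "f s" and g = h and x = x, OF E I one fI[OF that]]) (use h(2)[OF that] in \<open>simp add: Z_def\<close>)
  have "d (t - s) (?f x) = f m (\<delta> m x)" if x: "x \<in> carrier (P s)" for x
  proof -
    have "d (t - s) (?f x) = lin_comb (E (Suc (t - s))) \<one> (\<lambda>x. d (t - s) (f s x)) (\<ominus> \<one>) (\<lambda>x. d (t - s) (h x)) x"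
      by (rule module_hom_lin_comb[OF E d one]) (use fI[OF x] h(2)[OF x] I_closed Z_closed in auto)
    also have "\<dots> = \<one> \<odot>\<^bsub>E (Suc (t - s))\<^esub> d (t - s) (f s x)"
      by (rule lin_comb_right_zero[OF E one])
        (use d_closed[OF I_closed[OF fI[OF x]]] h(2)[OF x] in \<open>auto simp: Z_def\<close>)
    also have "\<dots> = d (t - s) (f s x)"
      by (rule module.smult_one[OF E d_closed[OF I_closed[OF fI[OF x]]]])
    also have "\<dots> = f m (\<delta> m x)" using chainD(4)[OF f, of m x] m s x by simp
    finally show ?thesis .
  qed
  then show ?thesis
    using f hom into m s unfolding chain_def by (auto simp: le_Suc_eq less_Suc_eq)
qed

text \<open>Two zigzags for the same map differ by one whose start has class zero. So the
  obstruction is well defined modulo \<open>T\<close>, the obstructions of zigzags starting in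
  boundaries together with all coboundaries. The point is that r e \<in> T holds exactly if some
  zigzag for r u takes the next step.\<close>

lemma Ext_stage:
  assumes s: "1 \<le> s" "s \<le> t"
  obtains L where "submodule L R (Ext (Suc s) (H (t - s)))"
    and "\<And>u p. lifts s u \<Longrightarrow> primeideal p R \<Longrightarrow>
      p = {r \<in> carrier R. lifts (Suc s) (\<lambda>x. r \<odot>\<^bsub>H t\<^esub> u x)} \<Longrightarrow>
      p \<in> Ass_Ext (Suc s) (H (t - s)) L"
proof -
  interpret cring R by (rule cring)
  let ?j = "t - s"
  interpret Hj: module R "H ?j" by (rule H)
  interpret Ht: module R "H t" by (rule H)
  have m1: "\<ominus> \<one> \<in> carrier R" by simp
  define T where "T = {e \<in> cocycles (Suc s) (H ?j). \<exists>f v. chain s f \<and>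
    (\<forall>x\<in>carrier (P 0). f 0 x \<in> B t) \<and> v \<in> P_hom s (H ?j) \<and>
    (\<forall>x\<in>carrier (P (Suc s)). e x = q ?j (f s (\<delta> s x)) \<oplus>\<^bsub>H ?j\<^esub> v (\<delta> s x))}"
  have TI: "e \<in> T" if "e \<in> cocycles (Suc s) (H ?j)" "chain s f"
    "\<And>x. x \<in> carrier (P 0) \<Longrightarrow> f 0 x \<in> B t" "v \<in> P_hom s (H ?j)"
    "\<And>x. x \<in> carrier (P (Suc s)) \<Longrightarrow> e x = q ?j (f s (\<delta> s x)) \<oplus>\<^bsub>H ?j\<^esub> v (\<delta> s x)" for e f v
    using that unfolding T_def by blast
  let ?z = "\<lambda>i x. \<zero>\<^bsub>E (t - i)\<^esub>"
  have zB: "\<zero>\<^bsub>E (t - 0)\<^esub> \<in> B t" using submodule_zero[OF B[of t]] by simp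
  have coc_v: "(\<lambda>x. v (\<delta> s x)) \<in> cocycles (Suc s) (H ?j)" if v: "v \<in> P_hom s (H ?j)" for v
    using module_hom_comp[OF \<delta> v] module_hom_zero[OF P H v] by (simp add: ext_cocycles_def \<delta>\<delta>)
  have bdT: "(\<lambda>x. v (\<delta> s x)) \<in> T" if v: "v \<in> P_hom s (H ?j)" for v
    by (rule TI[OF coc_v[OF v] chain_zero zB v]) (use module_homD(1)[OF v] \<delta>_closed in \<open>simp add: q_0\<close>)
  have T_comb: "lin_comb (H ?j) r e s' e' \<in> T"
    if rs: "r \<in> carrier R" "s' \<in> carrier R" and "e \<in> T" "e' \<in> T" for r s' e e'
  proof -
    obtain f v where f: "chain s f" "\<And>x. x \<in> carrier (P 0) \<Longrightarrow> f 0 x \<in> B t" "v \<in> P_hom s (H ?j)"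
      "\<And>x. x \<in> carrier (P (Suc s)) \<Longrightarrow> e x = q ?j (f s (\<delta> s x)) \<oplus>\<^bsub>H ?j\<^esub> v (\<delta> s x)"
      using \<open>e \<in> T\<close> unfolding T_def by blast
    obtain f' v' where f': "chain s f'" "\<And>x. x \<in> carrier (P 0) \<Longrightarrow> f' 0 x \<in> B t" "v' \<in> P_hom s (H ?j)"
      "\<And>x. x \<in> carrier (P (Suc s)) \<Longrightarrow> e' x = q ?j (f' s (\<delta> s x)) \<oplus>\<^bsub>H ?j\<^esub> v' (\<delta> s x)"
      using \<open>e' \<in> T\<close> unfolding T_def by blast
    show ?thesis
    proof (rule TI)
      show "lin_comb (H ?j) r e s' e' \<in> cocycles (Suc s) (H ?j)"
        by (rule ext_cocycles_lin_comb[OF P H rs]) (use \<open>e \<in> T\<close> \<open>e' \<in> T\<close> in \<open>auto simp: T_def\<close>)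
      show "chain s (\<lambda>i. lin_comb (E (t - i)) r (f i) s' (f' i))" by (rule chain_lin_comb[OF f(1) f'(1) rs])
      show "lin_comb (E (t - 0)) r (f 0) s' (f' 0) x \<in> B t" if "x \<in> carrier (P 0)" for x
        using lin_comb_submodule[OF E B rs, of "f 0" x t "f' 0"] f(2)[OF that] f'(2)[OF that] by simp
      show "lin_comb (H ?j) r v s' v' \<in> P_hom s (H ?j)"
        by (rule lin_comb_module_hom[OF P H f(3) f'(3) rs])
      fix x assume x: "x \<in> carrier (P (Suc s))"
      note c = q_closed[OF chain_end[OF f(1) _ s(2) x]] q_closed[OF chain_end[OF f'(1) _ s(2) x]]
        module_homD(1)[OF f(3) \<delta>_closed[OF x]] module_homD(1)[OF f'(3) \<delta>_closed[OF x]]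
      show "lin_comb (H ?j) r e s' e' x = q ?j (lin_comb (E ?j) r (f s) s' (f' s) (\<delta> s x)) \<oplus>\<^bsub>H ?j\<^esub>
          lin_comb (H ?j) r v s' v' (\<delta> s x)"
        using q_lin_comb[OF rs, of "f s" "\<delta> s x" ?j "f' s"] chain_end[OF f(1) _ s(2) x]
          chain_end[OF f'(1) _ s(2) x] f(4)[OF x] f'(4)[OF x] c rs
        by (simp add: lin_comb_def Hj.smult_r_distr Hj.M.a_ac)
    qed
  qed
  obtain L where L: "submodule L R (Ext (Suc s) (H ?j))"
    "\<And>e p. e \<in> cocycles (Suc s) (H ?j) \<Longrightarrow> primeideal p R \<Longrightarrow>
      p = {r \<in> carrier R. (\<lambda>x. r \<odot>\<^bsub>H ?j\<^esub> e x) \<in> T} \<Longrightarrow>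
      p \<in> Ass_Ext (Suc s) (H ?j) L"
  proof (rule Ext_associated_primes[of R P \<delta> "H ?j" T "Suc s", OF P \<delta> _ H])
    show "\<forall>x\<in>carrier (P (Suc (Suc i))). \<delta> i (\<delta> (Suc i) x) = \<zero>\<^bsub>P i\<^esub>" for i
      using \<delta>\<delta> by blast
    show "T \<subseteq> cocycles (Suc s) (H ?j)" by (auto simp: T_def)
    show "(\<lambda>x. \<zero>\<^bsub>H ?j\<^esub>) \<in> T" using bdT[OF const_zero_module_hom[OF H]] by simp
    show "(\<lambda>x. v (\<delta> m x)) \<in> T" if "Suc s = Suc m" "v \<in> P_hom m (H ?j)" for m v
      using bdT that by simp
    show "v \<in> T" if "u \<in> T" "v \<in> P_hom (Suc s) (H ?j)"
      "\<And>x. x \<in> carrier (P (Suc s)) \<Longrightarrow> u x = v x" for u v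
    proof -
      have "v \<in> cocycles (Suc s) (H ?j)"
        using that \<delta>_closed by (auto simp: T_def ext_cocycles_def)
      then show ?thesis using that unfolding T_def by auto
    qed
  qed (auto intro: T_comb)
  show thesis
  proof (rule that[OF L(1)])
    fix u p assume u: "lifts s u" and p: "primeideal p R"
      "p = {r \<in> carrier R. lifts (Suc s) (\<lambda>x. r \<odot>\<^bsub>H t\<^esub> u x)}"
    obtain f where f: "chain s f" "\<And>x. x \<in> carrier (P 0) \<Longrightarrow> q t (f 0 x) = u x"
      using u unfolding lifts_def by blast
    have uc: "u x \<in> carrier (H t)" if "x \<in> carrier (P 0)" for x
      using q_closed[OF chainD(3)[OF f(1) that]] f(2)[OF that] by simp
    define e where "e x = q ?j (f s (\<delta> s x))" for x
    have e: "e \<in> cocycles (Suc s) (H ?j)"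
      using chain_class_cocycle[OF f(1) s(2)] unfolding e_def by simp
    have "(\<lambda>x. r \<odot>\<^bsub>H ?j\<^esub> e x) \<in> T \<longleftrightarrow> lifts (Suc s) (\<lambda>x. r \<odot>\<^bsub>H t\<^esub> u x)" if r: "r \<in> carrier R" for r
    proof
      assume "(\<lambda>x. r \<odot>\<^bsub>H ?j\<^esub> e x) \<in> T"
      then obtain f' v where f': "chain s f'" "\<And>x. x \<in> carrier (P 0) \<Longrightarrow> f' 0 x \<in> B t"
        "v \<in> P_hom s (H ?j)"
        "\<And>x. x \<in> carrier (P (Suc s)) \<Longrightarrow> r \<odot>\<^bsub>H ?j\<^esub> e x = q ?j (f' s (\<delta> s x)) \<oplus>\<^bsub>H ?j\<^esub> v (\<delta> s x)"
        unfolding T_def by blast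
      obtain h where h: "h \<in> P_hom s (E ?j)" "\<And>x. x \<in> carrier (P s) \<Longrightarrow> h x \<in> Z ?j"
        "\<And>x. x \<in> carrier (P s) \<Longrightarrow> q ?j (h x) = v x" by (rule q_lift[OF f'(3)]) blast
      \<comment> \<open>As \<open>f'\<close> starts in boundaries, \<open>g\<close> still starts
        with class r u, while its obstruction has dropped from r e to the coboundary v \<delta>.
        Subtracting the lift \<open>h\<close> of \<open>v\<close> from the last component removes
        the rest.\<close>
      define g where "g i = lin_comb (E (t - i)) r (f i) (\<ominus> \<one>) (f' i)" for i
      have g: "chain s g" unfolding g_def by (rule chain_lin_comb[OF f(1) f'(1) r m1])
      let ?g = "g(s := lin_comb (E ?j) \<one> (g s) (\<ominus> \<one>) h)"
      have g': "chain s ?g" by (rule chain_modify_end[OF g s h(1,2)])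
      have "?g s (\<delta> s x) \<in> B ?j" if x: "x \<in> carrier (P (Suc s))" for x
      proof -
        note zf = chain_end[OF f(1) order_refl s(2) x] and zf' = chain_end[OF f'(1) order_refl s(2) x]
          and zg = chain_end[OF g order_refl s(2) x] and zh = h(2)[OF \<delta>_closed[OF x]]
        have "q ?j (?g s (\<delta> s x)) = q ?j (g s (\<delta> s x)) \<ominus>\<^bsub>H ?j\<^esub> v (\<delta> s x)"
          using q_lin_comb[OF one_closed m1, of "g s" "\<delta> s x" ?j h] zg zh h(3)[OF \<delta>_closed[OF x]]
            lin_comb_minus_one[OF H, of "\<lambda>x. q ?j (g s x)" "\<delta> s x" ?j "\<lambda>x. q ?j (h x)"]
            q_closed[OF zg] q_closed[OF zh] by simp
        also have "q ?j (g s (\<delta> s x)) = r \<odot>\<^bsub>H ?j\<^esub> e x \<ominus>\<^bsub>H ?j\<^esub> q ?j (f' s (\<delta> s x))"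
          unfolding g_def using q_lin_comb[OF r m1, of "f s" "\<delta> s x" ?j "f' s"] zf zf' q_closed
          by (simp add: lin_comb_def e_def Hj.smult_l_minus a_minus_def)
        also have "\<dots> \<ominus>\<^bsub>H ?j\<^esub> v (\<delta> s x) = \<zero>\<^bsub>H ?j\<^esub>"
          unfolding f'(4)[OF x] using q_closed[OF zf'] module_homD(1)[OF f'(3) \<delta>_closed[OF x]]
          by (simp add: a_minus_def Hj.M.a_ac Hj.M.r_neg Hj.M.r_neg1 Hj.M.r_neg2)
        finally show ?thesis using q_zero_iff[OF chain_end[OF g' _ s(2) x]] by simp
      qed
      then obtain f'' where f'': "chain (Suc s) f''" "\<And>i. i \<le> s \<Longrightarrow> f'' i = ?g i"
        by (rule chain_extend[OF g' s(2)]) blast+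
      have "q t (f'' 0 x) = r \<odot>\<^bsub>H t\<^esub> u x" if x: "x \<in> carrier (P 0)" for x
      proof -
        have "f'' 0 x = lin_comb (E t) r (f 0) (\<ominus> \<one>) (f' 0) x" using f''(2)[of 0] s by (simp add: g_def)
        then have "q t (f'' 0 x) = lin_comb (H t) r (\<lambda>x. q t (f 0 x)) (\<ominus> \<one>) (\<lambda>x. q t (f' 0 x)) x"
          using q_lin_comb[OF r m1, of "f 0" x t "f' 0"] chainD(3)[OF f(1) x] chainD(3)[OF f'(1) x] by simp
        also have "\<dots> = r \<odot>\<^bsub>H t\<^esub> q t (f 0 x)"
          by (rule lin_comb_right_zero[OF H r m1])
            (use q_closed[OF chainD(3)[OF f(1) x]] q_zero_iff[OF chainD(3)[OF f'(1) x]] f'(2)[OF x] in auto)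
        finally show ?thesis using f(2)[OF x] by simp
      qed
      then show "lifts (Suc s) (\<lambda>x. r \<odot>\<^bsub>H t\<^esub> u x)" using f''(1) unfolding lifts_def by blast
    next
      assume "lifts (Suc s) (\<lambda>x. r \<odot>\<^bsub>H t\<^esub> u x)"
      then obtain f' where f': "chain (Suc s) f'" "\<And>x. x \<in> carrier (P 0) \<Longrightarrow> q t (f' 0 x) = r \<odot>\<^bsub>H t\<^esub> u x"
        unfolding lifts_def by blast
      have f's: "chain s f'" by (rule chain_mono[OF f'(1)]) simp
      \<comment> \<open>Both r f and \<open>f'\<close> start with class r u, so \<open>g\<close>
        starts in boundaries; since \<open>f'\<close> continues, the obstruction of \<open>g\<close>
        is still r e. Thus \<open>g\<close> and v = 0 witness membership in
        \<open>T\<close>.\<close>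
      define g where "g i = lin_comb (E (t - i)) r (f i) (\<ominus> \<one>) (f' i)" for i
      have g: "chain s g" unfolding g_def by (rule chain_lin_comb[OF f(1) f's r m1])
      show "(\<lambda>x. r \<odot>\<^bsub>H ?j\<^esub> e x) \<in> T"
      proof (rule TI[OF ext_cocycles_smult[OF P H r e] g _ const_zero_module_hom[OF H]])
        fix x assume x: "x \<in> carrier (P 0)"
        have "q t (g 0 x) = lin_comb (H t) r (\<lambda>x. q t (f 0 x)) (\<ominus> \<one>) (\<lambda>x. q t (f' 0 x)) x"
          unfolding g_def using q_lin_comb[OF r m1, of "f 0" x t "f' 0"] chainD(3)[OF f(1) x] chainD(3)[OF f's x] by simp
        also have "\<dots> = \<zero>\<^bsub>H t\<^esub>"
          by (rule lin_comb_minus_self[OF H r]) (use f(2)[OF x] f'(2)[OF x] uc[OF x] in auto)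
        finally show "g 0 x \<in> B t" using q_zero_iff[OF chainD(3)[OF g x]] by simp
      next
        fix x assume x: "x \<in> carrier (P (Suc s))"
        note zf = chain_end[OF f(1) order_refl s(2) x] and zf' = chain_end[OF f's order_refl s(2) x]
        have "q ?j (g s (\<delta> s x)) = lin_comb (H ?j) r (\<lambda>x. q ?j (f s x)) (\<ominus> \<one>) (\<lambda>x. q ?j (f' s x)) (\<delta> s x)"
          unfolding g_def using q_lin_comb[OF r m1, of "f s" "\<delta> s x" ?j "f' s"] zf zf' by simp
        also have "\<dots> = r \<odot>\<^bsub>H ?j\<^esub> e x"
          unfolding e_def
          by (rule lin_comb_right_zero[OF H r m1])
            (use q_closed[OF zf] q_zero_iff[OF zf'] chain_boundary[OF f'(1) s(2) x] in auto)
        finally show "r \<odot>\<^bsub>H ?j\<^esub> e x = q ?j (g s (\<delta> s x)) \<oplus>\<^bsub>H ?j\<^esub> \<zero>\<^bsub>H ?j\<^esub>"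
          using q_closed[OF zf] r by (simp add: e_def)
      qed
    qed
    then have "p = {r \<in> carrier R. (\<lambda>x. r \<odot>\<^bsub>H ?j\<^esub> e x) \<in> T}" using p(2) by blast
    then show "p \<in> Ass_Ext (Suc s) (H ?j) L"
      by (rule L(2)[OF e p(1)])
  qed
qed

end

section \<open>Comparison with the Ext modules of \<open>K\<close>\<close>

lemma module_hom_cong:
  assumes "module R M" "f \<in> module_hom R M N" "\<And>x. x \<in> carrier M \<Longrightarrow> f x = g x"
  shows "g \<in> module_hom R M N"
proof -
  interpret M: module R M by fact
  have g: "g x = f x" if "x \<in> carrier M" for x using assms(3)[OF that] by simp
  show ?thesis using module_homD[OF assms(2)] by (intro module_homI) (simp_all add: g)
qed

text \<open>\<open>baer_E\<close>, \<open>baer_I\<close> and \<open>saturated\<close> encode the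
  vanishing of Ext(S/a, E j / I j). \<open>saturated\<close> is its degree 0: a map from the
  cokernel of \<open>\<delta> 0\<close> to E j / I j, lifted to \<open>P 0\<close>, is zero. Phrased
  through \<open>P 1\<close> and \<open>P 0\<close>, it keeps the ideal out of the locale.\<close>

locale zigzag_exact = zigzag R P \<delta> E d I H q t
  for R :: "('a, 'r) ring_scheme" (structure) and P :: "nat \<Rightarrow> ('a, 'f) module" and \<delta>
    and E :: "nat \<Rightarrow> ('a, 'c) module" and d I and H :: "nat \<Rightarrow> ('a, 'h) module" and q t +
  fixes K :: "('a, 'b) module" and \<epsilon> :: "'b \<Rightarrow> 'c"
  assumes K: "module R K"
    and \<epsilon>: "\<epsilon> \<in> module_hom R K (E 0)"
    and \<epsilon>_inj: "inj_on \<epsilon> (carrier K)"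
    and d\<epsilon>: "\<And>y. y \<in> carrier K \<Longrightarrow> d 0 (\<epsilon> y) = \<zero>\<^bsub>E 1\<^esub>"
    and \<epsilon>_exact: "\<And>x. x \<in> carrier (E 0) \<Longrightarrow> d 0 x = \<zero>\<^bsub>E 1\<^esub> \<Longrightarrow> x \<in> \<epsilon> ` carrier K"
    and d_exact: "\<And>j x. x \<in> carrier (E (Suc j)) \<Longrightarrow> d (Suc j) x = \<zero>\<^bsub>E (Suc (Suc j))\<^esub> \<Longrightarrow>
      x \<in> d j ` carrier (E j)"
    and \<delta>_exact: "\<And>i x. x \<in> carrier (P (Suc i)) \<Longrightarrow> \<delta> i x = \<zero>\<^bsub>P i\<^esub> \<Longrightarrow>
      x \<in> \<delta> (Suc i) ` carrier (P (Suc (Suc i)))"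
    and baer_E: "\<And>j. baer_module R (E j)"
    and baer_I: "\<And>j. baer_module R ((E j)\<lparr>carrier := I j\<rparr>)"
    and saturated: "\<And>j g x. g \<in> module_hom R (P 0) (E j) \<Longrightarrow>
      (\<And>y. y \<in> carrier (P 1) \<Longrightarrow> g (\<delta> 0 y) \<in> I j) \<Longrightarrow> x \<in> carrier (P 0) \<Longrightarrow> g x \<in> I j"
begin

text \<open>In other words \<open>Ext\<^sup>p\<^sup>+\<^sup>1(S/\<aa>, E j / I j) = 0\<close>, because \<open>E j / I j\<close> is injective.\<close>

lemma torsion_split:
  assumes g: "g \<in> P_hom (Suc p) (E j)"
    and gI: "\<And>x. x \<in> carrier (P (Suc (Suc p))) \<Longrightarrow> g (\<delta> (Suc p) x) \<in> I j"
  obtains w where "w \<in> P_hom p (E j)"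
    "\<And>x. x \<in> carrier (P (Suc p)) \<Longrightarrow> g x \<ominus>\<^bsub>E j\<^esub> w (\<delta> p x) \<in> I j"
proof -
  interpret E': module R "E j" by (rule E)
  have IE: "I j \<subseteq> carrier (E j)" using I_closed by blast
  have g\<delta>: "(\<lambda>x. g (\<delta> (Suc p) x)) \<in> P_hom (Suc (Suc p)) ((E j)\<lparr>carrier := I j\<rparr>)"
    using module_hom_into_submodule[OF IE] module_hom_comp[OF \<delta> g] gI by blast
  \<comment> \<open>By injectivity of \<open>I j\<close>, the map g \<delta>, which kills the kernel
    of \<open>\<delta> (Suc p)\<close>, equals h \<delta> for a map \<open>h\<close> with values in
    \<open>I j\<close>.\<close>
  obtain h where h: "h \<in> P_hom (Suc p) ((E j)\<lparr>carrier := I j\<rparr>)"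
    "\<And>x. x \<in> carrier (P (Suc (Suc p))) \<Longrightarrow> h (\<delta> (Suc p) x) = g (\<delta> (Suc p) x)"
    by (rule baer_extend[OF baer_I P P IM \<delta> g\<delta>]) (use module_hom_zero[OF P E g] in auto)
  have h': "h \<in> P_hom (Suc p) (E j)" "\<And>x. x \<in> carrier (P (Suc p)) \<Longrightarrow> h x \<in> I j"
    using h(1) module_hom_into_submodule[OF IE, of h R "P (Suc p)"] by simp_all
  let ?c = "lin_comb (E j) \<one> g (\<ominus> \<one>) h"
  have c: "?c x = g x \<ominus>\<^bsub>E j\<^esub> h x" if "x \<in> carrier (P (Suc p))" for x
    by (rule lin_comb_minus_one[where f = g and g = h and x = x,
        OF E module_homD(1)[OF g that] module_homD(1)[OF h'(1) that]])
  \<comment> \<open>g - h kills the image of \<open>\<delta> (Suc p)\<close>, which is the kernel of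
    \<open>\<delta> p\<close>. By injectivity of \<open>E j\<close> it is w \<delta> for some
    \<open>w\<close>.\<close>
  obtain w where w: "w \<in> P_hom p (E j)"
    "\<And>x. x \<in> carrier (P (Suc p)) \<Longrightarrow> w (\<delta> p x) = ?c x"
  proof (rule baer_extend[OF baer_E P P E \<delta> lin_comb_module_hom[OF P E g h'(1) minus_one_closed]])
    fix x assume x: "x \<in> carrier (P (Suc p))" "\<delta> p x = \<zero>\<^bsub>P p\<^esub>"
    then obtain y where y: "y \<in> carrier (P (Suc (Suc p)))" "x = \<delta> (Suc p) y" using \<delta>_exact by blast
    show "?c x = \<zero>\<^bsub>E j\<^esub>"
      unfolding c[OF x(1)] unfolding y(2) h(2)[OF y(1)]
      using gI[OF y(1)] I_closed by (simp add: a_minus_def E'.M.r_neg)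
  qed blast
  have "g x \<ominus>\<^bsub>E j\<^esub> w (\<delta> p x) \<in> I j" if x: "x \<in> carrier (P (Suc p))" for x
  proof -
    have "g x \<ominus>\<^bsub>E j\<^esub> w (\<delta> p x) = h x"
      unfolding w(2)[OF x] c[OF x] using module_homD(1)[OF g x] module_homD(1)[OF h'(1) x]
      by (simp add: a_minus_def E'.minus_add E'.M.r_neg2)
    then show ?thesis using h'(2)[OF x] by simp
  qed
  with w(1) show thesis by (rule that)
qed

text \<open>The part g_{i-1} \<delta> of a total coboundary, set to zero for i = 0 so that f_i = d
  g_i + g_{i-1} \<delta> has one form for all i. No signs occur: the two differentials commute, and
  a zigzag is a cocycle in the sense d f_{i+1} = f_i \<delta>, which every such sum
  satisfies.\<close>

definition prev :: "(nat \<Rightarrow> 'f \<Rightarrow> 'c) \<Rightarrow> nat \<Rightarrow> 'f \<Rightarrow> 'c" where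
  "prev g i x = (case i of 0 \<Rightarrow> \<zero>\<^bsub>E t\<^esub> | Suc m \<Rightarrow> g m (\<delta> m x))"

definition partial_rel :: "nat \<Rightarrow> (nat \<Rightarrow> 'f \<Rightarrow> 'c) \<Rightarrow> (nat \<Rightarrow> 'f \<Rightarrow> 'c) \<Rightarrow> bool" where
  "partial_rel m f g \<longleftrightarrow> (\<forall>i<m. g i \<in> P_hom i (E (t - Suc i)) \<and>
     (\<forall>x\<in>carrier (P i). f i x = d (t - Suc i) (g i x) \<oplus>\<^bsub>E (t - i)\<^esub> prev g i x))"

text \<open>\<open>f\<close> and \<open>\<epsilon> \<circ> k\<close> are cohomologous, by means of \<open>g\<close>, in the total complex of \<open>Hom(P\<^sub>i, E\<^sub>j)\<close>.\<close>

definition rel :: "(nat \<Rightarrow> 'f \<Rightarrow> 'c) \<Rightarrow> (nat \<Rightarrow> 'f \<Rightarrow> 'c) \<Rightarrow> ('f \<Rightarrow> 'b) \<Rightarrow> bool" where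
  "rel f g k \<longleftrightarrow> partial_rel t f g \<and> k \<in> P_hom t K \<and>
     (\<forall>x\<in>carrier (P t). f t x = \<epsilon> (k x) \<oplus>\<^bsub>E 0\<^esub> prev g t x)"

lemma prev_closed:
  assumes "partial_rel m f g" "i \<le> m" "m \<le> t" "x \<in> carrier (P i)"
  shows "prev g i x \<in> carrier (E (t - i))"
proof (cases i)
  case 0
  interpret E': module R "E t" by (rule E)
  show ?thesis by (simp add: prev_def 0)
next
  case (Suc l)
  have "g l \<in> P_hom l (E (t - Suc l))" using assms(1,2) Suc by (simp add: partial_rel_def)
  from module_homD(1)[OF this \<delta>_closed] show ?thesis using assms(4) by (simp add: prev_def Suc)
qed

lemma prev_\<delta>:
  assumes "partial_rel m f g" "i \<le> m" "x \<in> carrier (P (Suc i))"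
  shows "prev g i (\<delta> i x) = \<zero>\<^bsub>E (t - i)\<^esub>"
proof (cases i)
  case 0
  then show ?thesis by (simp add: prev_def)
next
  case (Suc l)
  have "g l \<in> P_hom l (E (t - Suc l))" using assms(1,2) Suc by (simp add: partial_rel_def)
  then show ?thesis using module_hom_zero[OF P E] \<delta>\<delta> assms(3) by (simp add: prev_def Suc)
qed

lemma prev_module_hom:
  assumes "partial_rel m f g" "i \<le> m"
  shows "prev g i \<in> P_hom i (E (t - i))"
proof (cases i)
  case 0
  then show ?thesis using const_zero_module_hom[OF E] by (simp add: prev_def[abs_def])
next
  case (Suc l)
  have "g l \<in> P_hom l (E (t - Suc l))" using assms Suc by (simp add: partial_rel_def)
  then show ?thesis using module_hom_comp[OF \<delta>] by (simp add: prev_def[abs_def] Suc)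
qed

lemma prev_lin_comb:
  assumes "r \<in> carrier R" "s \<in> carrier R"
  shows "prev (\<lambda>i. lin_comb (E (t - Suc i)) r (g i) s (g' i)) i x = lin_comb (E (t - i)) r (prev g i) s (prev g' i) x"
  using lin_comb_zero[OF E assms, of "prev g 0" x t "prev g' 0"]
  by (cases i) (auto simp: prev_def lin_comb_def)

lemma rel_lin_comb:
  assumes rel: "rel f g k" "rel f' g' k'" and rs: "r \<in> carrier R" "s \<in> carrier R"
  shows "rel (\<lambda>i. lin_comb (E (t - i)) r (f i) s (f' i)) (\<lambda>i. lin_comb (E (t - Suc i)) r (g i) s (g' i))
    (lin_comb K r k s k')"
proof -
  have pr: "partial_rel t f g" "partial_rel t f' g'" using rel by (auto simp: rel_def)
  have comb: "lin_comb (E n) r F s F' x = lin_comb (E n) r A s A' x \<oplus>\<^bsub>E n\<^esub> lin_comb (E n) r C s C' x"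
    if "F x = A x \<oplus>\<^bsub>E n\<^esub> C x" "F' x = A' x \<oplus>\<^bsub>E n\<^esub> C' x"
      "A x \<in> carrier (E n)" "A' x \<in> carrier (E n)" "C x \<in> carrier (E n)" "C' x \<in> carrier (E n)"
    for n x and F F' A A' C C' :: "'f \<Rightarrow> 'c"
  proof -
    interpret E': module R "E n" by (rule E)
    show ?thesis using that rs by (simp add: lin_comb_def E'.smult_r_distr E'.M.a_ac)
  qed
  have "partial_rel t (\<lambda>i. lin_comb (E (t - i)) r (f i) s (f' i)) (\<lambda>i. lin_comb (E (t - Suc i)) r (g i) s (g' i))"
    unfolding partial_rel_def
  proof (intro allI impI conjI ballI)
    fix i assume i: "i < t"
    have g: "g i \<in> P_hom i (E (t - Suc i))" "g' i \<in> P_hom i (E (t - Suc i))"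
      using pr i by (auto simp: partial_rel_def)
    show "lin_comb (E (t - Suc i)) r (g i) s (g' i) \<in> P_hom i (E (t - Suc i))"
      by (rule lin_comb_module_hom[OF P E g rs])
    fix x assume x: "x \<in> carrier (P i)"
    note gc = module_homD(1)[OF g(1) x] module_homD(1)[OF g(2) x]
    have dE: "d (t - Suc i) y \<in> carrier (E (t - i))" if "y \<in> carrier (E (t - Suc i))" for y
      using d_closed[OF that] Suc_diff_Suc[OF i] by simp
    have "d (t - Suc i) (lin_comb (E (t - Suc i)) r (g i) s (g' i) x) =
        lin_comb (E (t - i)) r (\<lambda>x. d (t - Suc i) (g i x)) s (\<lambda>x. d (t - Suc i) (g' i x)) x"
      using module_hom_lin_comb[where f = "g i" and g = "g' i" and x = x, OF E d rs gc] Suc_diff_Suc[OF i] by simp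
    moreover have "lin_comb (E (t - i)) r (f i) s (f' i) x =
        lin_comb (E (t - i)) r (\<lambda>x. d (t - Suc i) (g i x)) s (\<lambda>x. d (t - Suc i) (g' i x)) x \<oplus>\<^bsub>E (t - i)\<^esub>
        lin_comb (E (t - i)) r (prev g i) s (prev g' i) x"
      by (rule comb) (use pr i x dE[OF gc(1)] dE[OF gc(2)] prev_closed[OF pr(1) _ _ x] prev_closed[OF pr(2) _ _ x]
          in \<open>auto simp: partial_rel_def\<close>)
    ultimately show "lin_comb (E (t - i)) r (f i) s (f' i) x =
      d (t - Suc i) (lin_comb (E (t - Suc i)) r (g i) s (g' i) x) \<oplus>\<^bsub>E (t - i)\<^esub>
      prev (\<lambda>i. lin_comb (E (t - Suc i)) r (g i) s (g' i)) i x"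
      by (simp add: prev_lin_comb[OF rs])
  qed
  moreover have k: "k \<in> P_hom t K" "k' \<in> P_hom t K" using rel by (auto simp: rel_def)
  then have "lin_comb K r k s k' \<in> P_hom t K" by (intro lin_comb_module_hom[OF P K _ _ rs])
  moreover have "lin_comb (E (t - t)) r (f t) s (f' t) x = \<epsilon> (lin_comb K r k s k' x) \<oplus>\<^bsub>E 0\<^esub>
      prev (\<lambda>i. lin_comb (E (t - Suc i)) r (g i) s (g' i)) t x" if x: "x \<in> carrier (P t)" for x
  proof -
    note kc = module_homD(1)[OF k(1) x] module_homD(1)[OF k(2) x]
    have "lin_comb (E 0) r (f t) s (f' t) x =
        lin_comb (E 0) r (\<lambda>x. \<epsilon> (k x)) s (\<lambda>x. \<epsilon> (k' x)) x \<oplus>\<^bsub>E 0\<^esub> lin_comb (E 0) r (prev g t) s (prev g' t) x"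
      by (rule comb) (use rel x kc module_homD(1)[OF \<epsilon>] prev_closed[OF pr(1) _ _ x] prev_closed[OF pr(2) _ _ x]
          in \<open>auto simp: rel_def\<close>)
    then show ?thesis using module_hom_lin_comb[where f = k and g = k' and x = x, OF K \<epsilon> rs kc] by (simp add: prev_lin_comb[OF rs])
  qed
  ultimately show ?thesis unfolding rel_def by blast
qed

text \<open>For m > 0, the equation at m - 1 gives d g_{m-1} \<delta> = f_{m-1} \<delta>, because
  the term g_{m-2} \<delta> \<delta> vanishes; and f_{m-1} \<delta> = d f_m.\<close>

lemma cor_cocycle:
  assumes f: "chain (Suc t) f" and pr: "partial_rel m f g" and m: "m \<le> t" and x: "x \<in> carrier (P m)"
  shows "d (t - m) (f m x \<ominus>\<^bsub>E (t - m)\<^esub> prev g m x) = \<zero>\<^bsub>E (Suc (t - m))\<^esub>"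
proof -
  interpret E': module R "E (t - m)" by (rule E)
  interpret E'': module R "E (Suc (t - m))" by (rule E)
  have fc: "f m x \<in> carrier (E (t - m))" using chainD(2)[OF f _ m x] I_closed m by simp
  have pc: "prev g m x \<in> carrier (E (t - m))" by (rule prev_closed[OF pr order_refl m x])
  have "d (t - m) (prev g m x) = d (t - m) (f m x)"
  proof (cases m)
    case 0
    then show ?thesis using chainD(3)[OF f] x module_hom_zero[OF E E d] by (simp add: Z_def prev_def)
  next
    case (Suc l)
    have \<delta>x: "\<delta> l x \<in> carrier (P l)" using \<delta>_closed x Suc by simp
    have g: "g l \<in> P_hom l (E (t - m))"
      "f l (\<delta> l x) = d (t - m) (g l (\<delta> l x)) \<oplus>\<^bsub>E (t - l)\<^esub> prev g l (\<delta> l x)"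
      using pr Suc \<delta>x by (auto simp: partial_rel_def)
    have Et: "t - l = Suc (t - m)" using Suc m by simp
    have "prev g l (\<delta> l x) = \<zero>\<^bsub>E (Suc (t - m))\<^esub>" using prev_\<delta>[OF pr, of l x] x Suc Et by simp
    then have "f l (\<delta> l x) = d (t - m) (g l (\<delta> l x))"
      using g(2) d_closed[OF module_homD(1)[OF g(1) \<delta>x]] by (simp add: Et)
    then show ?thesis using chainD(4)[OF f, of l x] Suc m x by (simp add: prev_def)
  qed
  then show ?thesis
    using fc pc module_homD(2)[OF d fc] module_hom_minus[OF E E d pc] d_closed[OF fc]
    by (simp add: a_minus_def E''.M.r_neg)
qed

text \<open>Each row Hom(P_m, E) is exact, as P_m is projective. So the remainder f_m - g_{m-1}
  \<delta>, a cycle of the row by \<open>cor_cocycle\<close>, is d g_m for a new g_m when m < t. For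
  m = t it lies in the kernel of \<open>d 0\<close> and comes from \<open>K\<close>.\<close>

lemma rel_exists:
  assumes f: "chain (Suc t) f"
  obtains g k where "rel f g k" "k \<in> cocycles t K"
proof -
  have cor: "(\<lambda>x. f m x \<ominus>\<^bsub>E (t - m)\<^esub> prev g m x) \<in> P_hom m (E (t - m))"
    if "partial_rel m f g" "m \<le> t" for m g
  proof -
    have fm: "f m \<in> P_hom m (E (t - m))" by (rule chainD(1)[OF f _ that(2)]) (use that in simp)
    note pm = prev_module_hom[OF that(1) order_refl]
    have "lin_comb (E (t - m)) \<one> (f m) (\<ominus> \<one>) (prev g m) \<in> P_hom m (E (t - m))"
      by (rule lin_comb_module_hom[OF P E fm pm minus_one_closed])
    moreover have "lin_comb (E (t - m)) \<one> (f m) (\<ominus> \<one>) (prev g m) x = f m x \<ominus>\<^bsub>E (t - m)\<^esub> prev g m x"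
      if "x \<in> carrier (P m)" for x
      by (rule lin_comb_minus_one[where f = "f m" and g = "prev g m" and x = x,
          OF E module_homD(1)[OF fm that] module_homD(1)[OF pm that]])
    ultimately show ?thesis by (rule module_hom_cong[OF P])
  qed
  have eq: "f m x = (f m x \<ominus>\<^bsub>E (t - m)\<^esub> prev g m x) \<oplus>\<^bsub>E (t - m)\<^esub> prev g m x"
    if "partial_rel m f g" "m \<le> t" "x \<in> carrier (P m)" for m g x
  proof -
    interpret E': module R "E (t - m)" by (rule E)
    have "f m x \<in> carrier (E (t - m))" using chainD(2)[OF f _ that(2,3)] I_closed that(2) by simp
    then show ?thesis using prev_closed[OF that(1) order_refl that(2,3)]
      by (simp add: a_minus_def E'.M.a_assoc E'.M.l_neg)
  qed
  have "\<exists>g. partial_rel m f g" if "m \<le> t" for m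
    using that
  proof (induction m)
    case 0
    show ?case by (simp add: partial_rel_def)
  next
    case (Suc m)
    then obtain g where g: "partial_rel m f g" by auto
    have m: "m < t" "m \<le> t" using Suc by simp_all
    let ?j = "t - Suc m"
    have j: "t - m = Suc ?j" using m by simp
    have dj: "d ?j \<in> module_hom R (E ?j) (E (t - m))" using d[of ?j] j by simp
    obtain h where h: "h \<in> P_hom m (E ?j)"
      "\<And>x. x \<in> carrier (P m) \<Longrightarrow> d ?j (h x) = f m x \<ominus>\<^bsub>E (t - m)\<^esub> prev g m x"
    proof (rule projective_lift[OF P_projective E E dj cor[OF g m(2)]])
      fix x assume x: "x \<in> carrier (P m)"
      show "f m x \<ominus>\<^bsub>E (t - m)\<^esub> prev g m x \<in> d ?j ` carrier (E ?j)"
        using d_exact[of _ ?j] cor_cocycle[OF f g m(2) x] module_homD(1)[OF cor[OF g m(2)] x]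
        unfolding j by simp
    qed blast
    have "partial_rel (Suc m) f (g(m := h))"
      unfolding partial_rel_def
    proof (intro allI impI)
      fix i assume i: "i < Suc m"
      have pe: "prev (g(m := h)) i = prev g i" using i by (auto simp: prev_def split: nat.split)
      show "(g(m := h)) i \<in> P_hom i (E (t - Suc i)) \<and>
        (\<forall>x\<in>carrier (P i). f i x = d (t - Suc i) ((g(m := h)) i x) \<oplus>\<^bsub>E (t - i)\<^esub> prev (g(m := h)) i x)"
      proof (cases "i = m")
        case True
        then show ?thesis using h eq[OF g m(2)] unfolding pe by simp
      next
        case False
        then show ?thesis using g i unfolding pe by (simp add: partial_rel_def)
      qed
    qed
    then show ?case by blast
  qed
  then obtain g where g: "partial_rel t f g" by blast
  have c: "(\<lambda>x. f t x \<ominus>\<^bsub>E 0\<^esub> prev g t x) \<in> P_hom t (E 0)" using cor[OF g] by simp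
  obtain k where k: "k \<in> P_hom t K"
    "\<And>x. x \<in> carrier (P t) \<Longrightarrow> \<epsilon> (k x) = f t x \<ominus>\<^bsub>E 0\<^esub> prev g t x"
  proof (rule projective_lift[OF P_projective K E \<epsilon> c])
    fix x assume x: "x \<in> carrier (P t)"
    show "f t x \<ominus>\<^bsub>E 0\<^esub> prev g t x \<in> \<epsilon> ` carrier K"
      using \<epsilon>_exact cor_cocycle[OF f g order_refl x] module_homD(1)[OF c x] by simp
  qed blast
  interpret E0: module R "E 0" by (rule E)
  have rel: "rel f g k" unfolding rel_def using g k eq[OF g] by simp
  \<comment> \<open>Under the injective \<open>\<epsilon>\<close> this is f_t \<delta> - g_{t-1}
    \<delta> \<delta>, where the first term vanishes by the closing equation of the zigzag.\<close>
  have "k (\<delta> t x) = \<zero>\<^bsub>K\<^esub>" if x: "x \<in> carrier (P (Suc t))" for x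
  proof -
    interpret K: module R K by (rule K)
    have "\<epsilon> (k (\<delta> t x)) = \<zero>\<^bsub>E 0\<^esub>"
      using k(2)[OF \<delta>_closed[OF x]] chainD(5)[OF f _ x] prev_\<delta>[OF g order_refl x]
      by (simp add: a_minus_def)
    also have "\<dots> = \<epsilon> \<zero>\<^bsub>K\<^esub>" using module_hom_zero[OF K E \<epsilon>] by simp
    finally show ?thesis
      using inj_onD[OF \<epsilon>_inj] module_homD(1)[OF k(1) \<delta>_closed[OF x]] by simp
  qed
  then have "k \<in> cocycles t K" using k(1) by (simp add: ext_cocycles_def)
  with rel show thesis by (rule that)
qed

end

section \<open>From Hom(P, E) back to the torsion subcomplex\<close>

context zigzag_exact
begin

text \<open>Moves \<open>g (Suc l)\<close> into the torsion submodule without changing \<open>f\<close>.\<close>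

lemma partial_rel_modify:
  assumes pr: "partial_rel t f g" and l: "Suc l < t"
    and w: "w \<in> P_hom l (E (t - Suc (Suc l)))"
  obtains g' where "partial_rel t f g'"
    and "\<And>x. x \<in> carrier (P t) \<Longrightarrow> prev g' t x = prev g t x"
    and "\<And>x. x \<in> carrier (P (Suc l)) \<Longrightarrow> g' (Suc l) x = g (Suc l) x \<ominus>\<^bsub>E (t - Suc (Suc l))\<^esub> w (\<delta> l x)"
    and "\<And>i. i \<noteq> Suc l \<Longrightarrow> i \<noteq> l \<Longrightarrow> g' i = g i"
proof -
  let ?j = "t - Suc (Suc l)"
  \<comment> \<open>A change by the total coboundary of \<open>w\<close>: -w \<delta> at l + 1 and d
    w at l. Their contributions to f_{l+1} cancel; those to f_l and f_{l+2} vanish by d d = 0 and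
    \<delta> \<delta> = 0.\<close>
  define g' where "g' = g(Suc l := lin_comb (E ?j) \<one> (g (Suc l)) (\<ominus> \<one>) (\<lambda>x. w (\<delta> l x)),
    l := lin_comb (E (t - Suc l)) \<one> (g l) \<one> (\<lambda>x. d ?j (w x)))"
  have j: "t - Suc l = Suc ?j" "t - l = Suc (Suc ?j)" using l by simp_all
  interpret Ej: module R "E ?j" by (rule E)
  interpret E1: module R "E (Suc ?j)" by (rule E)
  interpret E2: module R "E (Suc (Suc ?j))" by (rule E)
  have g: "g (Suc l) \<in> P_hom (Suc l) (E ?j)" "g l \<in> P_hom l (E (Suc ?j))"
    using pr l unfolding partial_rel_def j(1)[symmetric] by auto
  note w\<delta> = module_hom_comp[OF \<delta>[of l] w] and dw = module_hom_comp[OF w d]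
  have gm: "g' (Suc l) x = g (Suc l) x \<ominus>\<^bsub>E ?j\<^esub> w (\<delta> l x)" if x: "x \<in> carrier (P (Suc l))" for x
    using lin_comb_minus_one[where f = "g (Suc l)" and g = "\<lambda>x. w (\<delta> l x)" and x = x,
        OF E module_homD(1)[OF g(1) x] module_homD(1)[OF w\<delta> x]] by (simp add: g'_def)
  have gl: "g' l x = g l x \<oplus>\<^bsub>E (Suc ?j)\<^esub> d ?j (w x)" if x: "x \<in> carrier (P l)" for x
    using module_homD(1)[OF g(2) x] module_homD(1)[OF dw x] by (simp add: g'_def lin_comb_def j)
  have prev: "prev g' i x = prev g i x" if i: "i \<noteq> Suc l" and x: "x \<in> carrier (P i)" for i x
  proof (cases "i = Suc (Suc l)")
    case True
    have \<delta>x: "\<delta> (Suc l) x \<in> carrier (P (Suc l))" using \<delta>_closed x True by simp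
    have "g' (Suc l) (\<delta> (Suc l) x) = g (Suc l) (\<delta> (Suc l) x)"
      using gm[OF \<delta>x] \<delta>\<delta>[of x l] x True module_hom_zero[OF P E w] module_homD(1)[OF g(1) \<delta>x]
      by (simp add: a_minus_def)
    then show ?thesis by (simp add: prev_def True)
  next
    case False
    then show ?thesis using i by (cases i) (auto simp: prev_def g'_def)
  qed
  have hom: "g' i \<in> P_hom i (E (t - Suc i))" if i: "i < t" for i
  proof -
    have "lin_comb (E ?j) \<one> (g (Suc l)) (\<ominus> \<one>) (\<lambda>x. w (\<delta> l x)) \<in> P_hom (Suc l) (E ?j)"
      by (rule lin_comb_module_hom[OF P E g(1) w\<delta> minus_one_closed])
    moreover have "lin_comb (E (Suc ?j)) \<one> (g l) \<one> (\<lambda>x. d ?j (w x)) \<in> P_hom l (E (Suc ?j))"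
      by (rule lin_comb_module_hom[OF P E g(2) dw minus_one_closed(1) minus_one_closed(1)])
    ultimately show ?thesis using pr i unfolding partial_rel_def by (simp add: g'_def j)
  qed
  have eqn: "f i x = d (t - Suc i) (g' i x) \<oplus>\<^bsub>E (t - i)\<^esub> prev g' i x"
    if i: "i < t" and x: "x \<in> carrier (P i)" for i x
  proof -
    have old: "f i x = d (t - Suc i) (g i x) \<oplus>\<^bsub>E (t - i)\<^esub> prev g i x"
      using pr i x by (simp add: partial_rel_def)
    consider "i = Suc l" | "i = l" | "i \<noteq> Suc l" "i \<noteq> l" by blast
    then show ?thesis
    proof cases
      case 1
      have x': "x \<in> carrier (P (Suc l))" using x 1 by simp
      note gx = module_homD(1)[OF g(1) x'] and glx = module_homD(1)[OF g(2) \<delta>_closed[OF x']]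
        and wx = module_homD(1)[OF w\<delta> x']
      have "d ?j (g' (Suc l) x) = d ?j (g (Suc l) x) \<ominus>\<^bsub>E (Suc ?j)\<^esub> d ?j (w (\<delta> l x))"
        unfolding gm[OF x'] a_minus_def
        using module_homD(2)[OF d gx] module_hom_minus[OF E E d wx] wx by simp
      moreover have "prev g' (Suc l) x = g l (\<delta> l x) \<oplus>\<^bsub>E (Suc ?j)\<^esub> d ?j (w (\<delta> l x))"
        using gl[OF \<delta>_closed[OF x']] by (simp add: prev_def)
      moreover have "f (Suc l) x = d ?j (g (Suc l) x) \<oplus>\<^bsub>E (Suc ?j)\<^esub> g l (\<delta> l x)"
        using old 1 j by (simp add: prev_def)
      ultimately show ?thesis using d_closed[OF gx] d_closed[OF wx] glx
        unfolding 1 j by (simp add: a_minus_def E1.M.a_ac E1.M.r_neg E1.M.r_neg1 E1.M.r_neg2)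
    next
      case 2
      have x': "x \<in> carrier (P l)" using x 2 by simp
      note glx = module_homD(1)[OF g(2) x'] and wx = module_homD(1)[OF w x']
      have "d (Suc ?j) (g' l x) = d (Suc ?j) (g l x)"
        unfolding gl[OF x'] using module_homD(2)[OF d glx d_closed[OF wx]] dd[OF wx] d_closed[OF glx] by simp
      then show ?thesis using old prev[OF _ x] 2 j by simp
    next
      case 3
      then show ?thesis using old prev[OF 3(1) x] by (simp add: g'_def)
    qed
  qed
  have "partial_rel t f g'" unfolding partial_rel_def using hom eqn by blast
  then show thesis
    by (rule that) (use prev[of t] l gm in \<open>auto simp: g'_def\<close>)
qed

text \<open>The components of \<open>g\<close> are made torsion-valued from the highest index down.
  If g_{m+1} is, then f_{m+1} = d g_{m+1} + g_m \<delta> puts g_m \<delta> into \<open>I\<close>,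
  and \<open>torsion_split\<close> corrects g_m at the expense of g_{m-1} only. At m = 0 there is
  nothing below to change, and \<open>saturated\<close> applies. Then f_0 = d g_0 is a boundary of
  \<open>I\<close>.\<close>

lemma rel_zero_boundary:
  assumes f: "chain (Suc t) f" and rel: "rel f g k"
    and k: "\<And>x. x \<in> carrier (P t) \<Longrightarrow> k x = \<zero>\<^bsub>K\<^esub>" and x: "x \<in> carrier (P 0)"
  shows "f 0 x \<in> B t"
proof (cases "t = 0")
  case True
  interpret E0: module R "E 0" by (rule E)
  have xt: "x \<in> carrier (P t)" unfolding True by (rule x)
  have "prev g t x = \<zero>\<^bsub>E t\<^esub>" unfolding prev_def by (simp split: nat.split add: True)
  also have "\<zero>\<^bsub>E t\<^esub> = \<zero>\<^bsub>E 0\<^esub>" unfolding True by (rule refl)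
  finally have "prev g t x = \<zero>\<^bsub>E 0\<^esub>" .
  moreover have "f t x = \<epsilon> (k x) \<oplus>\<^bsub>E 0\<^esub> prev g t x" using rel xt unfolding rel_def by blast
  ultimately have "f t x = \<zero>\<^bsub>E 0\<^esub>" using k[OF xt] module_hom_zero[OF K E \<epsilon>] by simp
  moreover have "B t = {\<zero>\<^bsub>E 0\<^esub>}" unfolding B_def by (simp split: nat.split add: True)
  moreover have "f t x = f 0 x" unfolding True by (rule refl)
  ultimately show ?thesis by simp
next
  case False
  \<comment> \<open>With k = 0 the equation at index t reads f_t = g_{t-1} \<delta>. This equation
    is preserved by \<open>partial_rel_modify\<close> and starts the descent.\<close>
  define D where "D m \<longleftrightarrow> (\<exists>g. partial_rel t f g \<and> (\<forall>x\<in>carrier (P t). f t x = prev g t x) \<and>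
    (\<forall>i. m \<le> i \<longrightarrow> i < t \<longrightarrow> (\<forall>x\<in>carrier (P i). g i x \<in> I (t - Suc i))))" for m
  have "D t"
  proof -
    interpret E0: module R "E 0" by (rule E)
    have pr: "partial_rel t f g" using rel by (simp add: rel_def)
    have "f t x = prev g t x" if x: "x \<in> carrier (P t)" for x
      using rel x k[OF x] module_hom_zero[OF K E \<epsilon>] prev_closed[OF pr order_refl order_refl x]
      by (simp add: rel_def)
    with pr show ?thesis unfolding D_def by auto
  qed
  have step: "D m" if "D (Suc m)" "m < t" for m
  proof -
    have m: "m < t" by fact
    obtain g where pr: "partial_rel t f g" and last: "\<And>x. x \<in> carrier (P t) \<Longrightarrow> f t x = prev g t x"
      and gI: "\<And>i x. Suc m \<le> i \<Longrightarrow> i < t \<Longrightarrow> x \<in> carrier (P i) \<Longrightarrow> g i x \<in> I (t - Suc i)"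
      using \<open>D (Suc m)\<close> unfolding D_def by blast
    let ?j = "t - Suc m"
    interpret Ej: module R "E ?j" by (rule E)
    have gm: "g m \<in> P_hom m (E ?j)" using pr m by (simp add: partial_rel_def)
    have gmI: "g m (\<delta> m x) \<in> I ?j" if x: "x \<in> carrier (P (Suc m))" for x
    proof -
      have fI: "f (Suc m) x \<in> I ?j" using chainD(2)[OF f _ _ x] m by simp
      show ?thesis
      proof (cases "Suc m = t")
        case True
        then show ?thesis using last[of x] x fI by (auto simp: prev_def)
      next
        case False
        then have m': "Suc m < t" using m by simp
        let ?y = "d (t - Suc (Suc m)) (g (Suc m) x)"
        have yI: "?y \<in> I ?j" using dI[OF gI[OF order_refl m' x]] Suc_diff_Suc[OF m'] by simp
        have eq: "f (Suc m) x = ?y \<oplus>\<^bsub>E ?j\<^esub> g m (\<delta> m x)"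
          using pr m' x by (simp add: partial_rel_def prev_def)
        have c: "g m (\<delta> m x) \<in> carrier (E ?j)" by (rule module_homD(1)[OF gm \<delta>_closed[OF x]])
        have "\<ominus>\<^bsub>E ?j\<^esub> ?y \<oplus>\<^bsub>E ?j\<^esub> f (Suc m) x \<in> I ?j"
          using Ej.submoduleE(3,5)[OF I] yI fI by blast
        also have "\<ominus>\<^bsub>E ?j\<^esub> ?y \<oplus>\<^bsub>E ?j\<^esub> f (Suc m) x = g m (\<delta> m x)"
          unfolding eq using c I_closed[OF yI] by (simp add: Ej.M.r_neg1)
        finally show ?thesis .
      qed
    qed
    show "D m"
    proof (cases m)
      case 0
      have "g 0 x \<in> I ?j" if "x \<in> carrier (P 0)" for x
        by (rule saturated[OF _ _ that]) (use gm gmI 0 in auto)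
      then have "g i x \<in> I (t - Suc i)" if "m \<le> i" "i < t" "x \<in> carrier (P i)" for i x
        using that gI[of i x] 0 by (cases i) auto
      with pr last show ?thesis unfolding D_def by blast
    next
      case (Suc l)
      have m': "Suc l < t" using m Suc by simp
      obtain w where w: "w \<in> P_hom l (E ?j)"
        "\<And>x. x \<in> carrier (P (Suc l)) \<Longrightarrow> g (Suc l) x \<ominus>\<^bsub>E ?j\<^esub> w (\<delta> l x) \<in> I ?j"
      proof (rule torsion_split)
        show "g (Suc l) \<in> P_hom (Suc l) (E ?j)" using gm Suc by simp
        show "g (Suc l) (\<delta> (Suc l) x) \<in> I ?j" if "x \<in> carrier (P (Suc (Suc l)))" for x
          using gmI that Suc by simp
      qed blast
      have w1: "w \<in> P_hom l (E (t - Suc (Suc l)))" using w(1) Suc by simp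
      obtain g' where mod: "partial_rel t f g'" "\<And>x. x \<in> carrier (P t) \<Longrightarrow> prev g' t x = prev g t x"
        "\<And>x. x \<in> carrier (P (Suc l)) \<Longrightarrow> g' (Suc l) x = g (Suc l) x \<ominus>\<^bsub>E (t - Suc (Suc l))\<^esub> w (\<delta> l x)"
        "\<And>i. i \<noteq> Suc l \<Longrightarrow> i \<noteq> l \<Longrightarrow> g' i = g i" by (rule partial_rel_modify[OF pr m' w1]) blast
      have "g' i x \<in> I (t - Suc i)" if i: "m \<le> i" "i < t" and x: "x \<in> carrier (P i)" for i x
      proof (cases "i = Suc l")
        case True
        then show ?thesis using mod(3)[of x] w(2)[of x] x Suc by simp
      next
        case False
        then show ?thesis using gI[of i x] mod(4)[of i] i x Suc by simp
      qed
      moreover have "f t x = prev g' t x" if "x \<in> carrier (P t)" for x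
        using last[OF that] mod(2)[OF that] by simp
      ultimately show ?thesis unfolding D_def using mod(1) by blast
    qed
  qed
  have "D (t - n)" for n
  proof (induction n)
    case 0
    show ?case using \<open>D t\<close> by simp
  next
    case (Suc n)
    show ?case
    proof (cases "n < t")
      case True
      then show ?thesis using step[of "t - Suc n"] Suc by (simp add: Suc_diff_Suc)
    next
      case False
      then show ?thesis using Suc by simp
    qed
  qed
  from this[of t] have "D 0" by simp
  then obtain g where pr: "partial_rel t f g"
    and "\<forall>i. 0 \<le> i \<longrightarrow> i < t \<longrightarrow> (\<forall>x\<in>carrier (P i). g i x \<in> I (t - Suc i))"
    unfolding D_def by (elim exE conjE)
  then have gI: "g 0 x \<in> I (t - Suc 0)" using False x by (metis le0 neq0_conv)
  interpret Et: module R "E t" by (rule E)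
  have t: "Suc (t - Suc 0) = t" using False by simp
  have "d (t - Suc 0) (g 0 x) \<in> carrier (E t)" using I_closed[OF dI[OF gI]] unfolding t .
  then have "f 0 x = d (t - Suc 0) (g 0 x)"
    using pr x False by (simp add: partial_rel_def prev_def)
  moreover have "B (Suc (t - Suc 0)) = d (t - Suc 0) ` I (t - Suc 0)" by (simp add: B_def)
  ultimately show ?thesis using gI unfolding t by blast
qed

end

section \<open>The last stage and the cover of the associated primes\<close>

context zigzag_exact
begin

text \<open>\<open>T\<close> collects the cocycles attached to complete zigzags that start in
  boundaries. If \<open>f'\<close> is such a zigzag for r k, then r f - f' belongs to the zero
  cocycle, so it starts in boundaries by \<open>rel_zero_boundary\<close>; hence r f does too, and r
  u = 0. Conversely, if r u = 0, then r f itself witnesses r k \<in> T.\<close>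

lemma Ext_final:
  obtains L where "submodule L R (Ext t K)"
    and "\<And>u p. lifts (Suc t) u \<Longrightarrow> primeideal p R \<Longrightarrow>
      p = {r \<in> carrier R. \<forall>x\<in>carrier (P 0). r \<odot>\<^bsub>H t\<^esub> u x = \<zero>\<^bsub>H t\<^esub>} \<Longrightarrow>
      p \<in> Ass_Ext t K L"
proof -
  interpret cring R by (rule cring)
  interpret K: module R K by (rule K)
  interpret E0: module R "E 0" by (rule E)
  interpret Ht: module R "H t" by (rule H)
  note m1 = minus_one_closed(2)
  define T where "T = {k \<in> cocycles t K.
    \<exists>f g. chain (Suc t) f \<and> (\<forall>x\<in>carrier (P 0). f 0 x \<in> B t) \<and> rel f g k}"
  have T_comb: "lin_comb K r k s k' \<in> T" if rs: "r \<in> carrier R" "s \<in> carrier R" and k: "k \<in> T" "k' \<in> T" for r k s k'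
  proof -
    obtain f g where f: "chain (Suc t) f" "\<And>x. x \<in> carrier (P 0) \<Longrightarrow> f 0 x \<in> B t" "rel f g k"
      using k(1) unfolding T_def by blast
    obtain f' g' where f': "chain (Suc t) f'" "\<And>x. x \<in> carrier (P 0) \<Longrightarrow> f' 0 x \<in> B t" "rel f' g' k'"
      using k(2) unfolding T_def by blast
    have "lin_comb (E (t - 0)) r (f 0) s (f' 0) x \<in> B t" if "x \<in> carrier (P 0)" for x
      using lin_comb_submodule[where f = "f 0" and g = "f' 0" and x = x, OF E B rs f(2)[OF that] f'(2)[OF that]]
      by simp
    moreover have "lin_comb K r k s k' \<in> cocycles t K"
      by (rule ext_cocycles_lin_comb[OF P K rs]) (use k in \<open>auto simp: T_def\<close>)
    ultimately show ?thesis
      using chain_lin_comb[OF f(1) f'(1) rs] rel_lin_comb[OF f(3) f'(3) rs] unfolding T_def by blast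
  qed
  let ?zf = "\<lambda>i x. \<zero>\<^bsub>E (t - i)\<^esub>"
  have zf: "chain (Suc t) ?zf" "\<And>x. ?zf 0 x \<in> B t" using chain_zero submodule_zero[OF B[of t]] by simp_all
  have zT: "(\<lambda>x. \<zero>\<^bsub>K\<^esub>) \<in> T"
  proof -
    have z: "\<zero>\<^bsub>E n\<^esub> \<oplus>\<^bsub>E n\<^esub> \<zero>\<^bsub>E n\<^esub> = \<zero>\<^bsub>E n\<^esub>" for n
    proof -
      interpret E': module R "E n" by (rule E)
      show ?thesis by simp
    qed
    have p: "prev (\<lambda>i x. \<zero>\<^bsub>E (t - Suc i)\<^esub>) i x = \<zero>\<^bsub>E (t - i)\<^esub>" for i x
      by (cases i) (simp_all add: prev_def)
    have "partial_rel t ?zf (\<lambda>i x. \<zero>\<^bsub>E (t - Suc i)\<^esub>)"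
      unfolding partial_rel_def p
      by (simp add: Suc_diff_Suc z const_zero_module_hom[OF E] module_hom_zero[OF E E d])
    then have "rel ?zf (\<lambda>i x. \<zero>\<^bsub>E (t - Suc i)\<^esub>) (\<lambda>x. \<zero>\<^bsub>K\<^esub>)"
      unfolding rel_def p by (simp add: z const_zero_module_hom[OF K] module_hom_zero[OF K E \<epsilon>])
    then show ?thesis
      unfolding T_def ext_cocycles_def using zf by (auto simp: const_zero_module_hom[OF K])
  qed
  have bT: "(\<lambda>x. v (\<delta> m x)) \<in> T" if m: "t = Suc m" and v: "v \<in> P_hom m K" for m v
  proof -
    \<comment> \<open>The coboundary v \<delta> is attached to the zero zigzag by means of a
      \<open>g\<close> concentrated at m = t - 1 with value -\<epsilon> v there. Indeed d \<epsilon>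
      v = 0, and at index t the two terms \<epsilon> v \<delta> and -\<epsilon> v \<delta>
      cancel.\<close>
    define w where "w x = (\<ominus> \<one>) \<odot>\<^bsub>E 0\<^esub> \<epsilon> (v x)" for x
    have v\<epsilon>: "(\<lambda>x. \<epsilon> (v x)) \<in> P_hom m (E 0)" by (rule module_hom_comp[OF v \<epsilon>])
    have w: "w \<in> P_hom m (E 0)" unfolding w_def[abs_def] by (rule smult_module_hom[OF P E v\<epsilon> m1])
    have dw: "d 0 (w x) = \<zero>\<^bsub>E 1\<^esub>" if "x \<in> carrier (P m)" for x
    proof -
      interpret E1: module R "E (Suc 0)" by (rule E)
      show ?thesis unfolding w_def
        using module_homD(3)[OF d m1, of "\<epsilon> (v x)" 0] module_homD(1)[OF v\<epsilon> that]
          d\<epsilon>[OF module_homD(1)[OF v that]] E1.smult_r_null[OF m1] by simp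
    qed
    define g where "g i = (if i = m then w else (\<lambda>x. \<zero>\<^bsub>E (t - Suc i)\<^esub>))" for i
    have p: "prev g i x = \<zero>\<^bsub>E (t - i)\<^esub>" if "i < t" for i x
    proof (cases i)
      case (Suc l)
      then have "l \<noteq> m" using that m by simp
      then show ?thesis by (simp add: prev_def g_def Suc)
    qed (simp add: prev_def)
    have tm: "t - m = 1" "t - Suc m = 0" using m by simp_all
    have "partial_rel t ?zf g"
      unfolding partial_rel_def
    proof (intro allI impI conjI ballI)
      fix i assume i: "i < t"
      show "g i \<in> P_hom i (E (t - Suc i))"
        using w by (simp add: g_def tm const_zero_module_hom[OF E])
      fix x assume x: "x \<in> carrier (P i)"
      interpret E': module R "E (t - i)" by (rule E)
      have "d (t - Suc i) (g i x) = \<zero>\<^bsub>E (t - i)\<^esub>"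
      proof (cases "i = m")
        case True
        then show ?thesis using dw[of x] x by (simp add: g_def tm)
      next
        case False
        then show ?thesis using module_hom_zero[OF E E d, of "t - Suc i"] i by (simp add: g_def Suc_diff_Suc)
      qed
      then show "\<zero>\<^bsub>E (t - i)\<^esub> = d (t - Suc i) (g i x) \<oplus>\<^bsub>E (t - i)\<^esub> prev g i x" by (simp add: p[OF i])
    qed
    moreover have "(\<lambda>x. v (\<delta> m x)) \<in> P_hom t K"
      using module_hom_comp[OF \<delta> v] by (simp add: m)
    moreover have "?zf t x = \<epsilon> (v (\<delta> m x)) \<oplus>\<^bsub>E 0\<^esub> prev g t x" if x: "x \<in> carrier (P t)" for x
    proof -
      have \<delta>x: "\<delta> m x \<in> carrier (P m)" using \<delta>_closed[of x m] x m by simp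
      have "prev g t x = \<ominus>\<^bsub>E 0\<^esub> \<epsilon> (v (\<delta> m x))"
        using module_homD(1)[OF v\<epsilon> \<delta>x] unfolding prev_def
        by (simp add: g_def w_def E0.smult_l_minus m)
      then show ?thesis using module_homD(1)[OF v\<epsilon> \<delta>x] by (simp add: E0.M.r_neg)
    qed
    ultimately have "rel ?zf g (\<lambda>x. v (\<delta> m x))" unfolding rel_def by blast
    moreover have "(\<lambda>x. v (\<delta> m x)) \<in> cocycles t K"
      using module_hom_comp[OF \<delta> v] \<delta>\<delta> module_hom_zero[OF P K v] by (simp add: ext_cocycles_def m)
    ultimately show ?thesis unfolding T_def using zf by blast
  qed
  obtain L where L: "submodule L R (Ext t K)"
    "\<And>e p. e \<in> cocycles t K \<Longrightarrow> primeideal p R \<Longrightarrow>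
      p = {r \<in> carrier R. (\<lambda>x. r \<odot>\<^bsub>K\<^esub> e x) \<in> T} \<Longrightarrow>
      p \<in> Ass_Ext t K L"
  proof (rule Ext_associated_primes[of R P \<delta> K T t, OF P \<delta> _ K])
    show "\<forall>x\<in>carrier (P (Suc (Suc i))). \<delta> i (\<delta> (Suc i) x) = \<zero>\<^bsub>P i\<^esub>" for i
      using \<delta>\<delta> by blast
    show "T \<subseteq> cocycles t K" by (auto simp: T_def)
    show "v \<in> T" if u: "u \<in> T" and v: "v \<in> P_hom t K"
      "\<And>x. x \<in> carrier (P t) \<Longrightarrow> u x = v x" for u v
    proof -
      have "v \<in> cocycles t K"
        using that \<delta>_closed by (auto simp: T_def ext_cocycles_def)
      moreover have "rel f g v" if "rel f g u" for f g
        using that v by (simp add: rel_def)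
      ultimately show ?thesis using u unfolding T_def by blast
    qed
  qed (auto intro: T_comb zT bT)
  show thesis
  proof (rule that[OF L(1)])
    fix u p assume u: "lifts (Suc t) u" and p: "primeideal p R"
      "p = {r \<in> carrier R. \<forall>x\<in>carrier (P 0). r \<odot>\<^bsub>H t\<^esub> u x = \<zero>\<^bsub>H t\<^esub>}"
    obtain f where f: "chain (Suc t) f" "\<And>x. x \<in> carrier (P 0) \<Longrightarrow> q t (f 0 x) = u x"
      using u unfolding lifts_def by blast
    obtain g k where k: "rel f g k" "k \<in> cocycles t K" by (rule rel_exists[OF f(1)])
    have kc: "k x \<in> carrier K" if "x \<in> carrier (P t)" for x
      using k(2) that by (auto simp: ext_cocycles_def module_hom_def)
    have "(\<lambda>x. r \<odot>\<^bsub>K\<^esub> k x) \<in> T \<longleftrightarrow> (\<forall>x\<in>carrier (P 0). r \<odot>\<^bsub>H t\<^esub> u x = \<zero>\<^bsub>H t\<^esub>)" if r: "r \<in> carrier R" for r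
    proof
      assume "(\<lambda>x. r \<odot>\<^bsub>K\<^esub> k x) \<in> T"
      then obtain f' g' where f': "chain (Suc t) f'" "\<And>x. x \<in> carrier (P 0) \<Longrightarrow> f' 0 x \<in> B t"
        "rel f' g' (\<lambda>x. r \<odot>\<^bsub>K\<^esub> k x)" unfolding T_def by blast
      note ch = chain_lin_comb[OF f(1) f'(1) r m1] and re = rel_lin_comb[OF k(1) f'(3) r m1]
      show "\<forall>x\<in>carrier (P 0). r \<odot>\<^bsub>H t\<^esub> u x = \<zero>\<^bsub>H t\<^esub>"
      proof
        fix x assume x: "x \<in> carrier (P 0)"
        note zf = chainD(3)[OF f(1) x] and zf' = chainD(3)[OF f'(1) x]
        have "lin_comb (E (t - 0)) r (f 0) (\<ominus> \<one>) (f' 0) x \<in> B t"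
          by (rule rel_zero_boundary[OF ch re _ x]) (rule lin_comb_minus_self[OF K r], use kc in auto)
        then have b: "lin_comb (E t) r (f 0) (\<ominus> \<one>) (f' 0) x \<in> B t" by simp
        have "\<zero>\<^bsub>H t\<^esub> = q t (lin_comb (E t) r (f 0) (\<ominus> \<one>) (f' 0) x)"
          using q_zero_iff b B_subset_Z by (metis subsetD)
        also have "\<dots> = lin_comb (H t) r (\<lambda>x. q t (f 0 x)) (\<ominus> \<one>) (\<lambda>x. q t (f' 0 x)) x"
          by (rule q_lin_comb[where f = "f 0" and g = "f' 0" and x = x, OF r m1 zf zf'])
        also have "\<dots> = r \<odot>\<^bsub>H t\<^esub> q t (f 0 x)"
          by (rule lin_comb_right_zero[OF H r m1]) (use q_closed[OF zf] q_zero_iff[OF zf'] f'(2)[OF x] in auto)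
        finally show "r \<odot>\<^bsub>H t\<^esub> u x = \<zero>\<^bsub>H t\<^esub>" using f(2)[OF x] by simp
      qed
    next
      assume ru: "\<forall>x\<in>carrier (P 0). r \<odot>\<^bsub>H t\<^esub> u x = \<zero>\<^bsub>H t\<^esub>"
      \<comment> \<open>The multiple r f, written with a second coefficient zero so that the closure
        lemmas for linear combinations cover it.\<close>
      let ?f = "\<lambda>i. lin_comb (E (t - i)) r (f i) \<zero> (f i)"
      have ch: "chain (Suc t) ?f" by (rule chain_lin_comb[OF f(1,1) r]) simp
      have re: "rel ?f (\<lambda>i. lin_comb (E (t - Suc i)) r (g i) \<zero> (g i)) (lin_comb K r k \<zero> k)"
        by (rule rel_lin_comb[OF k(1,1) r]) simp
      have "rel ?f (\<lambda>i. lin_comb (E (t - Suc i)) r (g i) \<zero> (g i)) (\<lambda>x. r \<odot>\<^bsub>K\<^esub> k x)"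
        using re kc r smult_module_hom[OF P K _ r, of k t] k(1) unfolding rel_def by (simp add: lin_comb_def)
      moreover have "?f 0 x \<in> B t" if x: "x \<in> carrier (P 0)" for x
      proof -
        note zf = chainD(3)[OF f(1) x]
        have "q t (lin_comb (E t) r (f 0) \<zero> (f 0) x) = \<zero>\<^bsub>H t\<^esub>"
          using q_lin_comb[where f = "f 0" and g = "f 0" and x = x, OF r zero_closed zf zf]
            q_closed[OF zf] ru x f(2)[OF x] by (simp add: lin_comb_def)
        moreover have "lin_comb (E t) r (f 0) \<zero> (f 0) x \<in> Z t" using chainD(3)[OF ch x] by simp
        ultimately show ?thesis using q_zero_iff by simp
      qed
      ultimately show "(\<lambda>x. r \<odot>\<^bsub>K\<^esub> k x) \<in> T"
        using ch ext_cocycles_smult[OF P K r k(2)] unfolding T_def by blast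
    qed
    then have "p = {r \<in> carrier R. (\<lambda>x. r \<odot>\<^bsub>K\<^esub> k x) \<in> T}" using p(2) by blast
    then show "p \<in> Ass_Ext t K L"
      by (rule L(2)[OF k(2) p(1)])
  qed
qed

lemma lifts_cong:
  assumes "lifts k u" "\<And>x. x \<in> carrier (P 0) \<Longrightarrow> u x = v x"
  shows "lifts k v"
  using assms unfolding lifts_def by auto

lemma lifts_zero: "lifts k (\<lambda>x. \<zero>\<^bsub>H t\<^esub>)"
  unfolding lifts_def
  by (rule exI[of _ "\<lambda>i x. \<zero>\<^bsub>E (t - i)\<^esub>"]) (simp add: chain_zero q_0)

text \<open>Choose r outside \<open>p\<close> such that r u lifts as far as possible. Since
  \<open>p\<close> is prime, r u still has annihilator \<open>p\<close>. For s \<in> p the map s r u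
  is zero and lifts all the way; for s outside \<open>p\<close> it cannot pass the stage where r u
  stops. So \<open>p\<close> is exactly the set that this stage, or \<open>Ext_final\<close>,
  recognises as an associated prime.\<close>

theorem associated_primes_cover:
  obtains L Lj where "submodule L R (Ext t K)"
    and "\<And>j. j < t \<Longrightarrow> submodule (Lj j) R (Ext (t - j + 1) (H j))"
    and "\<And>u p. u \<in> P_hom 0 (H t) \<Longrightarrow> (\<And>x. x \<in> carrier (P 1) \<Longrightarrow> u (\<delta> 0 x) = \<zero>\<^bsub>H t\<^esub>) \<Longrightarrow>
      primeideal p R \<Longrightarrow> p = {r \<in> carrier R. \<forall>x\<in>carrier (P 0). r \<odot>\<^bsub>H t\<^esub> u x = \<zero>\<^bsub>H t\<^esub>} \<Longrightarrow>
      p \<in> (\<Union>j<t. Ass_Ext (t - j + 1) (H j) (Lj j)) \<union>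
        Ass_Ext t K L"
proof -
  interpret cring R by (rule cring)
  interpret Ht: module R "H t" by (rule H)
  obtain L where L: "submodule L R (Ext t K)"
    "\<And>u p. lifts (Suc t) u \<Longrightarrow> primeideal p R \<Longrightarrow>
      p = {r \<in> carrier R. \<forall>x\<in>carrier (P 0). r \<odot>\<^bsub>H t\<^esub> u x = \<zero>\<^bsub>H t\<^esub>} \<Longrightarrow>
      p \<in> Ass_Ext t K L"
    by (rule Ext_final) blast
  define good_submodule where "good_submodule j M \<longleftrightarrow>
      submodule M R (Ext (t - j + 1) (H j)) \<and>
      (\<forall>u p. lifts (t - j) u \<longrightarrow> primeideal p R \<longrightarrow>
        p = {r \<in> carrier R. lifts (Suc (t - j)) (\<lambda>x. r \<odot>\<^bsub>H t\<^esub> u x)} \<longrightarrow>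
        p \<in> Ass_Ext (t - j + 1) (H j) M)" for j M
  have "\<exists>M. good_submodule j M" if j: "j < t" for j
  proof -
    have s: "1 \<le> t - j" "t - j \<le> t" "t - (t - j) = j" "Suc (t - j) = t - j + 1" using j by auto
    obtain M where "submodule M R (Ext (t - j + 1) (H j))"
      "\<And>u p. lifts (t - j) u \<Longrightarrow> primeideal p R \<Longrightarrow>
        p = {r \<in> carrier R. lifts (t - j + 1) (\<lambda>x. r \<odot>\<^bsub>H t\<^esub> u x)} \<Longrightarrow>
        p \<in> Ass_Ext (t - j + 1) (H j) M"
      by (rule Ext_stage[OF s(1,2), unfolded s(3,4)]) blast
    then show ?thesis unfolding good_submodule_def s(4) by blast
  qed
  then have "\<forall>j. \<exists>M. j < t \<longrightarrow> good_submodule j M" by blast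
  then obtain Lj where "\<forall>j. j < t \<longrightarrow> good_submodule j (Lj j)" by (rule choice[THEN exE])
  then have Lj: "\<And>j. j < t \<Longrightarrow> submodule (Lj j) R (Ext (t - j + 1) (H j))"
    "\<And>j u p. j < t \<Longrightarrow> lifts (t - j) u \<Longrightarrow> primeideal p R \<Longrightarrow>
      p = {r \<in> carrier R. lifts (Suc (t - j)) (\<lambda>x. r \<odot>\<^bsub>H t\<^esub> u x)} \<Longrightarrow>
      p \<in> Ass_Ext (t - j + 1) (H j) (Lj j)"
    unfolding good_submodule_def by simp_all
  show thesis
  proof (rule that[OF L(1) Lj(1)])
    fix u p assume u: "u \<in> P_hom 0 (H t)" "\<And>x. x \<in> carrier (P 1) \<Longrightarrow> u (\<delta> 0 x) = \<zero>\<^bsub>H t\<^esub>"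
      and p: "primeideal p R" "p = {r \<in> carrier R. \<forall>x\<in>carrier (P 0). r \<odot>\<^bsub>H t\<^esub> u x = \<zero>\<^bsub>H t\<^esub>}"
    interpret p: primeideal p R by (rule p)
    note uc = module_homD(1)[OF u(1)]
    \<comment> \<open>The bound Suc t makes the maximum exist: beyond it \<open>chain k\<close>
      imposes no further conditions.\<close>
    define good where "good k \<longleftrightarrow> k \<le> Suc t \<and> (\<exists>r\<in>carrier R - p. lifts k (\<lambda>x. r \<odot>\<^bsub>H t\<^esub> u x))" for k
    have one: "\<one> \<in> carrier R - p" using p.I_notcarr p.one_imp_carrier by auto
    have "lifts 1 (\<lambda>x. \<one> \<odot>\<^bsub>H t\<^esub> u x)" by (rule lifts_cong[OF lifts_one[OF u]]) (use uc in auto)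
    then have g1: "good 1" using one unfolding good_def by auto
    define k where "k = Max {k. good k}"
    have fin: "finite {k. good k}" by (rule finite_subset[of _ "{..Suc t}"]) (auto simp: good_def)
    have k: "good k" unfolding k_def using Max_in[OF fin] g1 by blast
    have kmax: "n \<le> k" if "good n" for n unfolding k_def using Max_ge[OF fin] that by blast
    obtain r where r: "r \<in> carrier R" "r \<notin> p" "lifts k (\<lambda>x. r \<odot>\<^bsub>H t\<^esub> u x)" and kt: "k \<le> Suc t"
      using k unfolding good_def by blast
    have assoc: "s \<odot>\<^bsub>H t\<^esub> (r \<odot>\<^bsub>H t\<^esub> u x) = (s \<otimes> r) \<odot>\<^bsub>H t\<^esub> u x" if "s \<in> carrier R" "x \<in> carrier (P 0)" for s x
      using Ht.smult_assoc1 that r(1) uc by simp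
    have sr: "s \<otimes> r \<in> p \<longleftrightarrow> s \<in> p" if "s \<in> carrier R" for s
      using p.I_prime[OF that r(1)] p.I_r_closed[OF _ r(1)] r(2) by blast
    have zero_iff: "(\<forall>x\<in>carrier (P 0). s \<odot>\<^bsub>H t\<^esub> (r \<odot>\<^bsub>H t\<^esub> u x) = \<zero>\<^bsub>H t\<^esub>) \<longleftrightarrow> s \<in> p" if s: "s \<in> carrier R" for s
    proof -
      have "s \<otimes> r \<in> p \<longleftrightarrow> (\<forall>x\<in>carrier (P 0). (s \<otimes> r) \<odot>\<^bsub>H t\<^esub> u x = \<zero>\<^bsub>H t\<^esub>)"
        using s r(1) by (subst p(2)) simp
      then show ?thesis using sr[OF s] assoc[OF s] by simp
    qed
    show "p \<in> (\<Union>j<t. Ass_Ext (t - j + 1) (H j) (Lj j)) \<union>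
        Ass_Ext t K L"
    proof (cases "k = Suc t")
      case True
      have "p = {s \<in> carrier R. \<forall>x\<in>carrier (P 0). s \<odot>\<^bsub>H t\<^esub> (r \<odot>\<^bsub>H t\<^esub> u x) = \<zero>\<^bsub>H t\<^esub>}"
        using zero_iff p.Icarr by blast
      from L(2)[OF r(3)[unfolded True] p(1) this] show ?thesis by blast
    next
      case False
      with kt kmax[OF g1] have k: "1 \<le> k" "k \<le> t" by auto
      let ?j = "t - k"
      have j: "?j < t" "t - ?j = k" using k by auto
      have "lifts (Suc k) (\<lambda>x. s \<odot>\<^bsub>H t\<^esub> (r \<odot>\<^bsub>H t\<^esub> u x)) \<longleftrightarrow> s \<in> p" if s: "s \<in> carrier R" for s
      proof
        assume l: "lifts (Suc k) (\<lambda>x. s \<odot>\<^bsub>H t\<^esub> (r \<odot>\<^bsub>H t\<^esub> u x))"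
        show "s \<in> p"
        proof (rule ccontr)
          assume "s \<notin> p"
          then have "s \<otimes> r \<in> carrier R - p" using sr[OF s] s r(1) by simp
          moreover have "lifts (Suc k) (\<lambda>x. (s \<otimes> r) \<odot>\<^bsub>H t\<^esub> u x)"
            by (rule lifts_cong[OF l]) (rule assoc[OF s])
          ultimately have "good (Suc k)" using k unfolding good_def by blast
          then show False using kmax by force
        qed
      next
        assume "s \<in> p"
        then have "\<forall>x\<in>carrier (P 0). s \<odot>\<^bsub>H t\<^esub> (r \<odot>\<^bsub>H t\<^esub> u x) = \<zero>\<^bsub>H t\<^esub>" using zero_iff[OF s] by blast
        then show "lifts (Suc k) (\<lambda>x. s \<odot>\<^bsub>H t\<^esub> (r \<odot>\<^bsub>H t\<^esub> u x))"
          by (intro lifts_cong[OF lifts_zero]) simp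
      qed
      then have "p = {s \<in> carrier R. lifts (Suc (t - ?j)) (\<lambda>x. s \<odot>\<^bsub>H t\<^esub> (r \<odot>\<^bsub>H t\<^esub> u x))}"
        unfolding j(2) using p.Icarr by blast
      moreover have "lifts (t - ?j) (\<lambda>x. r \<odot>\<^bsub>H t\<^esub> u x)" unfolding j(2) by (rule r(3))
      ultimately have "p \<in> Ass_Ext (t - ?j + 1) (H ?j) (Lj ?j)"
        by (intro Lj(2)[OF j(1) _ p(1)])
      then show ?thesis using j(1) by blast
    qed
  qed
qed

end

section \<open>Local cohomology\<close>

lemma regular_module_module:
  fixes R (structure)
  assumes "cring R"
  shows "module R (regular_module R)"
proof -
  interpret R: cring R by fact
  have ab: "abelian_group (regular_module R)"
  proof (rule abelian_groupI)
    fix x assume "x \<in> carrier (regular_module R)"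
    then show "\<exists>y\<in>carrier (regular_module R). y \<oplus>\<^bsub>regular_module R\<^esub> x = \<zero>\<^bsub>regular_module R\<^esub>"
      by (intro bexI[of _ "\<ominus> x"]) (simp_all add: regular_module_def R.l_neg)
  qed (simp_all add: regular_module_def R.a_ac)
  show ?thesis
    by (rule moduleI[OF assms ab]) (simp_all add: regular_module_def R.l_distr R.r_distr R.m_assoc)
qed

lemma ideal_regular_submodule:
  assumes "cring R" "ideal I R"
  shows "submodule I R (regular_module R)"
proof -
  interpret R: cring R by fact
  interpret I: ideal I R by fact
  show ?thesis
    by (rule submodule_lin_combI[OF regular_module_module[OF assms(1)]])
      (use I.Icarr I.I_l_closed in \<open>auto simp: regular_module_def\<close>)
qed

text \<open>\<open>x\<close> is a map \<open>R/I \<rightarrow> M\<close>, and \<open>u\<close> is its composite with \<open>\<pi>\<close>.\<close>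

lemma associated_prime_cocycle:
  fixes R :: "('a, 'r) ring_scheme" (structure) and I :: "'a set"
  defines "RI \<equiv> quotient_module (regular_module R) I"
  assumes cring: "cring R" and I: "ideal I R" and M: "module R M" and Q: "module R Q"
    and x: "x \<in> carrier M" and Ix: "\<And>r. r \<in> I \<Longrightarrow> r \<odot>\<^bsub>M\<^esub> x = \<zero>\<^bsub>M\<^esub>"
    and \<pi>: "\<pi> \<in> module_hom R Q RI" "\<pi> ` carrier Q = carrier RI"
  obtains u where "u \<in> module_hom R Q M" "\<And>w. w \<in> carrier Q \<Longrightarrow> \<pi> w = \<zero>\<^bsub>RI\<^esub> \<Longrightarrow> u w = \<zero>\<^bsub>M\<^esub>"
    "annihilator R M x = {r \<in> carrier R. \<forall>w\<in>carrier Q. r \<odot>\<^bsub>M\<^esub> u w = \<zero>\<^bsub>M\<^esub>}"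
proof -
  interpret M: module R M by fact
  interpret I: ideal I R by fact
  interpret Q: module R Q by fact
  let ?R = "regular_module R"
  note reg = regular_module_module[OF cring] and sub = ideal_regular_submodule[OF cring I]
  interpret reg: module R ?R by (rule reg)
  note c = quotient_coset[OF reg sub, folded RI_def]
  have R: "carrier ?R = carrier R" "add ?R = add R" "smult ?R = monoid.mult R" "\<zero>\<^bsub>?R\<^esub> = \<zero>"
    by (simp_all add: regular_module_def)
  define co where "co s = I +>\<^bsub>?R\<^esub> s" for s
  have co_onto: "\<exists>s\<in>carrier R. \<pi> w = co s" if "w \<in> carrier Q" for w
    using imageI[OF that, of \<pi>] unfolding \<pi>(2) c(2) R co_def by blast
  \<comment> \<open>Since \<open>I\<close> kills \<open>x\<close>, the multiple s x depends only on
    the coset of s.\<close>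
  have co_eq: "s \<odot>\<^bsub>M\<^esub> x = s' \<odot>\<^bsub>M\<^esub> x" if "s \<in> carrier R" "s' \<in> carrier R" "co s = co s'" for s s'
  proof -
    define i where "i = s \<ominus>\<^bsub>?R\<^esub> s'"
    have iI: "i \<in> I" using c(6)[of s s'] that unfolding R co_def i_def by simp
    have "s \<in> carrier ?R" "s' \<in> carrier ?R" using that by (simp_all add: R)
    then have "s = i \<oplus>\<^bsub>?R\<^esub> s'" unfolding i_def
      by (simp add: a_minus_def reg.M.a_assoc reg.M.l_neg)
    then have "s = i \<oplus> s'" by (simp add: R)
    then have "s \<odot>\<^bsub>M\<^esub> x = i \<odot>\<^bsub>M\<^esub> x \<oplus>\<^bsub>M\<^esub> s' \<odot>\<^bsub>M\<^esub> x"
      using M.smult_l_distr[OF I.Icarr[OF iI] that(2) x] by simp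
    then show ?thesis using Ix[OF iI] that x by simp
  qed
  define \<sigma> where "\<sigma> w = (SOME s. s \<in> carrier R \<and> \<pi> w = co s)" for w
  have \<sigma>: "\<sigma> w \<in> carrier R" "\<pi> w = co (\<sigma> w)" if "w \<in> carrier Q" for w
    using someI_ex[of "\<lambda>s. s \<in> carrier R \<and> \<pi> w = co s"] co_onto[OF that] unfolding \<sigma>_def by blast+
  define u where "u w = \<sigma> w \<odot>\<^bsub>M\<^esub> x" for w
  have u_eq: "u w = s \<odot>\<^bsub>M\<^esub> x" if "w \<in> carrier Q" "s \<in> carrier R" "\<pi> w = co s" for w s
    unfolding u_def by (rule co_eq) (use \<sigma>[OF that(1)] that in auto)
  have "u \<in> module_hom R Q M"
  proof (rule module_homI)
    fix w assume "w \<in> carrier Q"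
    then show "u w \<in> carrier M" using \<sigma> x by (simp add: u_def)
  next
    fix w w' assume w: "w \<in> carrier Q" "w' \<in> carrier Q"
    have "\<pi> (w \<oplus>\<^bsub>Q\<^esub> w') = co (\<sigma> w \<oplus> \<sigma> w')"
      using module_homD(2)[OF \<pi>(1) w] \<sigma>[OF w(1)] \<sigma>[OF w(2)] c(3)[of "\<sigma> w" "\<sigma> w'"]
      unfolding co_def R by simp
    then have "u (w \<oplus>\<^bsub>Q\<^esub> w') = (\<sigma> w \<oplus> \<sigma> w') \<odot>\<^bsub>M\<^esub> x"
      using \<sigma>(1)[OF w(1)] \<sigma>(1)[OF w(2)] w by (intro u_eq) auto
    then show "u (w \<oplus>\<^bsub>Q\<^esub> w') = u w \<oplus>\<^bsub>M\<^esub> u w'"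
      using \<sigma>(1)[OF w(1)] \<sigma>(1)[OF w(2)] x by (simp add: u_def M.smult_l_distr)
  next
    fix r w assume r: "r \<in> carrier R" and w: "w \<in> carrier Q"
    have "\<pi> (r \<odot>\<^bsub>Q\<^esub> w) = co (r \<otimes> \<sigma> w)"
      using module_homD(3)[OF \<pi>(1) r w] \<sigma>[OF w] c(4)[OF r, of "\<sigma> w"] unfolding co_def R by simp
    then have "u (r \<odot>\<^bsub>Q\<^esub> w) = (r \<otimes> \<sigma> w) \<odot>\<^bsub>M\<^esub> x"
      using \<sigma>(1)[OF w] r w by (intro u_eq) auto
    then show "u (r \<odot>\<^bsub>Q\<^esub> w) = r \<odot>\<^bsub>M\<^esub> u w"
      using \<sigma>(1)[OF w] r x by (simp add: u_def M.smult_assoc1)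
  qed
  moreover have "u w = \<zero>\<^bsub>M\<^esub>" if "w \<in> carrier Q" "\<pi> w = \<zero>\<^bsub>RI\<^esub>" for w
  proof -
    have "\<pi> w = co \<zero>" using c(5)[of "\<zero>"] that I.zero_closed unfolding co_def R by simp
    then show ?thesis using u_eq[OF that(1), of "\<zero>"] x by simp
  qed
  moreover have "annihilator R M x = {r \<in> carrier R. \<forall>w\<in>carrier Q. r \<odot>\<^bsub>M\<^esub> u w = \<zero>\<^bsub>M\<^esub>}"
  proof -
    have "r \<odot>\<^bsub>M\<^esub> x = \<zero>\<^bsub>M\<^esub> \<longleftrightarrow> (\<forall>w\<in>carrier Q. r \<odot>\<^bsub>M\<^esub> u w = \<zero>\<^bsub>M\<^esub>)" if r: "r \<in> carrier R" for r
    proof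
      assume rx: "r \<odot>\<^bsub>M\<^esub> x = \<zero>\<^bsub>M\<^esub>"
      show "\<forall>w\<in>carrier Q. r \<odot>\<^bsub>M\<^esub> u w = \<zero>\<^bsub>M\<^esub>"
      proof
        fix w assume w: "w \<in> carrier Q"
        have "r \<odot>\<^bsub>M\<^esub> u w = \<sigma> w \<odot>\<^bsub>M\<^esub> (r \<odot>\<^bsub>M\<^esub> x)"
          using \<sigma>(1)[OF w] r x by (simp add: u_def M.smult_assoc1[symmetric] M.R.m_comm)
        then show "r \<odot>\<^bsub>M\<^esub> u w = \<zero>\<^bsub>M\<^esub>" using \<sigma>(1)[OF w] rx by simp
      qed
    next
      \<comment> \<open>Surjectivity of \<open>\<pi>\<close> gives a \<open>w\<close> over the coset
        of one, and u w = x there.\<close>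
      assume *: "\<forall>w\<in>carrier Q. r \<odot>\<^bsub>M\<^esub> u w = \<zero>\<^bsub>M\<^esub>"
      have "co \<one> \<in> carrier RI" using c(1)[of "\<one>"] unfolding co_def R by simp
      then obtain w where w: "w \<in> carrier Q" "\<pi> w = co \<one>" using \<pi>(2) by (metis imageE)
      then have "u w = x" using u_eq[OF w(1) _ w(2)] x by simp
      then show "r \<odot>\<^bsub>M\<^esub> x = \<zero>\<^bsub>M\<^esub>" using * w(1) by blast
    qed
    then show ?thesis unfolding annihilator_def by blast
  qed
  ultimately show thesis by (rule that)
qed

text \<open>This writes local cohomology as plain cycles modulo boundaries inside
  \<open>E j\<close>, the shape that \<open>q\<close> has in the locale \<open>zigzag\<close>.
  Torsion by ideal powers is replaced by elementwise torsion on the way.\<close>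

lemma local_cohomology_quotient:
  fixes E :: "nat \<Rightarrow> ('a, 'c) module"
  assumes noeth: "noetherian_ring R" and I: "ideal I R" and E: "\<And>j. module R (E j)"
    and d: "\<And>j. d j \<in> module_hom R (E j) (E (Suc j))"
    and dd: "\<And>j. \<forall>x\<in>carrier (E j). d (Suc j) (d j x) = \<zero>\<^bsub>E (Suc (Suc j))\<^esub>"
  defines "Z \<equiv> \<lambda>j. (E j)\<lparr>carrier := {x \<in> torsion R I (E j). d j x = \<zero>\<^bsub>E (Suc j)\<^esub>}\<rparr>"
    and "B \<equiv> \<lambda>j. case j of 0 \<Rightarrow> {\<zero>\<^bsub>E 0\<^esub>} | Suc m \<Rightarrow> d m ` torsion R I (E m)"
  shows "module R (Z j)" "submodule (B j) R (Z j)"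
    "local_cohomology R I E d j = quotient_module (Z j) (B j)"
proof -
  let ?C = "\<lambda>i. (E i)\<lparr>carrier := torsion R I (E i)\<rparr>"
  have T: "torsion R I (E i) \<subseteq> carrier (E i)" for i by (auto simp: torsion_def)
  have C: "module R (?C i)" for i
    by (rule submodule.submodule_is_module[OF torsion_submodule[OF I E] E])
  have dC: "d i \<in> module_hom R (?C i) (?C (Suc i))" for i
    using module_hom_from_submodule[OF d T] torsion_hom[OF I E E d]
      module_hom_into_submodule[OF T, of "d i" R "?C i" "Suc i"] by simp
  have ddC: "\<forall>x\<in>carrier (?C i). d (Suc i) (d i x) = \<zero>\<^bsub>?C (Suc (Suc i))\<^esub>" for i
    using dd T by auto
  have Z: "(?C j)\<lparr>carrier := kernel_of (?C j) (?C (Suc j)) (d j)\<rparr> = Z j" for j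
    by (simp add: kernel_of_def Z_def)
  have B: "coboundaries ?C d j = B j"
    by (cases j) (simp_all add: coboundaries_def B_def)
  note co = cohomology_submodules[where C = ?C and R = R and d = d and n = j, OF C dC ddC, unfolded Z B]
  show "module R (Z j)" "submodule (B j) R (Z j)" by (rule co)+
  show "local_cohomology R I E d j = quotient_module (Z j) (B j)"
    unfolding local_cohomology_def cohomology_def torsion_module_eq[OF noeth I E] Z B ..
qed

theorem theorem3p1:
  fixes S :: "('a, 'r) ring_scheme"
    and \<aa> :: "'a set"
    and K :: "('a, 'b) module"
    and E :: "nat \<Rightarrow> ('a, 'c) module" and d :: "nat \<Rightarrow> 'c \<Rightarrow> 'c" and \<epsilon> :: "'b \<Rightarrow> 'c"
    and P :: "nat \<Rightarrow> ('a, 'f) module" and \<delta> :: "nat \<Rightarrow> 'f \<Rightarrow> 'f" and \<pi> :: "'f \<Rightarrow> 'a set"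
    and t :: nat
  assumes "cring S" and "noetherian_ring S"
    and "ideal \<aa> S"
    and "module S K"
    and "injective_resolution S K E d \<epsilon>"
    and "projective_resolution S (quotient_module (regular_module S) \<aa>) P \<delta> \<pi>"
  shows "\<exists>L Lj.
    submodule L S (Ext_module S P \<delta> t K) \<and>
    (\<forall>j<t. submodule (Lj j) S (Ext_module S P \<delta> (t - j + 1) (local_cohomology S \<aa> E d j))) \<and>
    associated_primes S (local_cohomology S \<aa> E d t) \<subseteq>
      (\<Union>j<t. associated_primes S
         (quotient_module (Ext_module S P \<delta> (t - j + 1) (local_cohomology S \<aa> E d j)) (Lj j))) \<union>
      associated_primes S (quotient_module (Ext_module S P \<delta> t K) L)"
proof -
  note cring = assms(1) and noeth = assms(2) and ideal = assms(3) and K = assms(4)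
  interpret \<aa>: ideal \<aa> S by (rule ideal)
  let ?SI = "quotient_module (regular_module S) \<aa>"
  let ?T = "\<lambda>j. torsion S \<aa> (E j)"
  let ?Z = "\<lambda>j. (E j)\<lparr>carrier := {x \<in> ?T j. d j x = \<zero>\<^bsub>E (Suc j)\<^esub>}\<rparr>"
  let ?B = "\<lambda>j. case j of 0 \<Rightarrow> {\<zero>\<^bsub>E 0\<^esub>} | Suc m \<Rightarrow> d m ` ?T m"
  let ?H = "local_cohomology S \<aa> E d"
  let ?q = "\<lambda>j x. ?B j +>\<^bsub>?Z j\<^esub> x"
  have E_inj: "injective_module S (E j)" and d: "d j \<in> module_hom S (E j) (E (Suc j))"
    and exE: "d j ` carrier (E j) = kernel_of (E (Suc j)) (E (Suc (Suc j))) (d (Suc j))" for j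
    using assms(5) by (simp_all add: injective_resolution_def)
  have \<epsilon>: "\<epsilon> \<in> module_hom S K (E 0)" "inj_on \<epsilon> (carrier K)" "\<epsilon> ` carrier K = kernel_of (E 0) (E 1) (d 0)"
    using assms(5) by (simp_all add: injective_resolution_def)
  have P_proj: "projective_module S (P i)" and \<delta>: "\<delta> i \<in> module_hom S (P (Suc i)) (P i)"
    and exP: "\<delta> (Suc i) ` carrier (P (Suc (Suc i))) = kernel_of (P (Suc i)) (P i) (\<delta> i)" for i
    using assms(6) by (simp_all add: projective_resolution_def)
  have \<pi>: "\<pi> \<in> module_hom S (P 0) ?SI" "\<pi> ` carrier (P 0) = carrier ?SI"
    "\<delta> 0 ` carrier (P 1) = kernel_of (P 0) ?SI \<pi>"
    using assms(6) by (simp_all add: projective_resolution_def)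
  have E: "module S (E j)" for j using E_inj by (simp add: injective_module_def)
  have P: "module S (P i)" for i using P_proj by (simp add: projective_module_def)
  have dd: "d (Suc j) (d j x) = \<zero>\<^bsub>E (Suc (Suc j))\<^esub>" if "x \<in> carrier (E j)" for j x
    using imageI[OF that, of "d j"] unfolding exE by (simp add: kernel_of_def)
  have \<delta>\<delta>: "\<delta> i (\<delta> (Suc i) x) = \<zero>\<^bsub>P i\<^esub>" if "x \<in> carrier (P (Suc (Suc i)))" for i x
    using imageI[OF that, of "\<delta> (Suc i)"] unfolding exP by (simp add: kernel_of_def)
  have baer: "baer_module S (E j)" for j by (rule injective_module_baer[OF E_inj])
  have "\<forall>x\<in>carrier (E j). d (Suc j) (d j x) = \<zero>\<^bsub>E (Suc (Suc j))\<^esub>" for j using dd by blast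
  note coh = local_cohomology_quotient[of S \<aa> E d, OF noeth ideal E d this]
  have H: "module S (?H j)" for j
    unfolding coh(3) by (rule quotient_module_module[OF coh(1,2)])
  have reg: "module S (regular_module S)" by (rule regular_module_module[OF cring])
  have sub: "submodule \<aa> S (regular_module S)" by (rule ideal_regular_submodule[OF cring ideal])
  interpret SI: module S ?SI by (rule quotient_module_module[OF reg sub])
  \<comment> \<open>\<open>\<pi>\<close> maps r x into \<aa> (S/\<aa>) = 0, and its kernel is the
    image of \<open>\<delta> 0\<close>. This relation is what ties \<open>P\<close> to the ideal in
    the proof of \<open>saturated\<close>.\<close>
  have \<aa>\<pi>: "r \<odot>\<^bsub>P 0\<^esub> x \<in> \<delta> 0 ` carrier (P 1)" if r: "r \<in> \<aa>" and x: "x \<in> carrier (P 0)" for r x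
  proof -
    interpret P0: module S "P 0" by (rule P)
    have rS: "r \<in> carrier S" by (rule \<aa>.Icarr[OF r])
    have "\<pi> x \<in> carrier ?SI" by (rule module_homD(1)[OF \<pi>(1) x])
    then obtain s where s: "s \<in> carrier S" "\<pi> x = \<aa> +>\<^bsub>regular_module S\<^esub> s"
      using quotient_coset(2)[OF reg sub] by (auto simp: regular_module_def)
    have s': "s \<in> carrier (regular_module S)" and rs: "r \<odot>\<^bsub>regular_module S\<^esub> s = r \<otimes>\<^bsub>S\<^esub> s"
      "r \<otimes>\<^bsub>S\<^esub> s \<in> carrier (regular_module S)"
      using s(1) rS by (simp_all add: regular_module_def)
    have "\<pi> (r \<odot>\<^bsub>P 0\<^esub> x) = \<aa> +>\<^bsub>regular_module S\<^esub> (r \<otimes>\<^bsub>S\<^esub> s)"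
      using module_homD(3)[OF \<pi>(1) rS x] quotient_coset(4)[OF reg sub rS s'] s(2) rs by simp
    also have "\<dots> = \<zero>\<^bsub>?SI\<^esub>"
      using quotient_coset(5)[OF reg sub rs(2)] \<aa>.I_r_closed[OF r s(1)] by simp
    finally show ?thesis unfolding \<pi>(3) using x rS by (simp add: kernel_of_def)
  qed
  interpret zigzag_exact S P \<delta> E d ?T ?H ?q t K \<epsilon>
  proof (intro zigzag_exact.intro zigzag.intro
      zigzag_exact_axioms.intro)
    fix j x
    show "submodule (?T j) S (E j)" by (rule torsion_submodule[OF ideal E])
    show "d j x \<in> ?T (Suc j)" if "x \<in> ?T j" by (rule torsion_hom[OF ideal E E d that])
    show "?q j \<in> module_hom S (?Z j) (?H j)" unfolding coh(3) by (rule coset_module_hom[OF coh(1,2)])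
    show "\<exists>x\<in>?T j. d j x = \<zero>\<^bsub>E (Suc j)\<^esub> \<and> ?q j x = y" if "y \<in> carrier (?H j)" for y
      using that unfolding coh(3) quotient_coset(2)[OF coh(1,2)] by auto
    show "?q j x = \<zero>\<^bsub>?H j\<^esub> \<longleftrightarrow> x \<in> ?B j" if "x \<in> ?T j" "d j x = \<zero>\<^bsub>E (Suc j)\<^esub>"
      unfolding coh(3) by (rule quotient_coset(5)[OF coh(1,2)]) (use that in simp)
    show "x \<in> \<epsilon> ` carrier K" if "x \<in> carrier (E 0)" "d 0 x = \<zero>\<^bsub>E 1\<^esub>"
      using that unfolding \<epsilon>(3) by (simp add: kernel_of_def)
    show "d 0 (\<epsilon> y) = \<zero>\<^bsub>E 1\<^esub>" if "y \<in> carrier K" for y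
      using imageI[OF that, of \<epsilon>] unfolding \<epsilon>(3) by (simp add: kernel_of_def)
    show "x \<in> d j ` carrier (E j)" if "x \<in> carrier (E (Suc j))" "d (Suc j) x = \<zero>\<^bsub>E (Suc (Suc j))\<^esub>"
      using that unfolding exE by (simp add: kernel_of_def)
    show "y \<in> \<delta> (Suc i) ` carrier (P (Suc (Suc i)))" if "y \<in> carrier (P (Suc i))" "\<delta> i y = \<zero>\<^bsub>P i\<^esub>" for i y
      using that unfolding exP by (simp add: kernel_of_def)
    show "baer_module S ((E j)\<lparr>carrier := ?T j\<rparr>)"
      by (rule baer_torsion[OF cring noeth ideal E baer])
    fix g y assume g: "g \<in> module_hom S (P 0) (E j)" and gT: "\<And>y. y \<in> carrier (P 1) \<Longrightarrow> g (\<delta> 0 y) \<in> ?T j"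
      and y: "y \<in> carrier (P 0)"
    show "g y \<in> ?T j"
    \<comment> \<open>r y lies in the image of \<open>\<delta> 0\<close>, where \<open>g\<close> is
      torsion-valued; so r g(y) is torsion for every r in \<aa>.\<close>
    proof (rule torsion_saturated[OF ideal E module_homD(1)[OF g y]])
      fix r assume r: "r \<in> \<aa>"
      have "g (r \<odot>\<^bsub>P 0\<^esub> y) \<in> ?T j" using \<aa>\<pi>[OF r y] gT by auto
      then show "r \<odot>\<^bsub>E j\<^esub> g y \<in> ?T j" using module_homD(3)[OF g \<aa>.Icarr[OF r] y] by simp
    qed
  qed (fact cring P_proj \<delta> \<delta>\<delta> E d dd H K \<epsilon>(1,2) baer)+
  obtain L Lj where L: "submodule L S (Ext_module S P \<delta> t K)"
    "\<And>j. j < t \<Longrightarrow> submodule (Lj j) S (Ext_module S P \<delta> (t - j + 1) (?H j))"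
    "\<And>u p. u \<in> module_hom S (P 0) (?H t) \<Longrightarrow> (\<And>x. x \<in> carrier (P 1) \<Longrightarrow> u (\<delta> 0 x) = \<zero>\<^bsub>?H t\<^esub>) \<Longrightarrow>
      primeideal p S \<Longrightarrow> p = {r \<in> carrier S. \<forall>x\<in>carrier (P 0). r \<odot>\<^bsub>?H t\<^esub> u x = \<zero>\<^bsub>?H t\<^esub>} \<Longrightarrow>
      p \<in> (\<Union>j<t. associated_primes S (quotient_module (Ext_module S P \<delta> (t - j + 1) (?H j)) (Lj j))) \<union>
        associated_primes S (quotient_module (Ext_module S P \<delta> t K) L)"
    by (rule associated_primes_cover) blast
  let ?U = "(\<Union>j<t. associated_primes S (quotient_module (Ext_module S P \<delta> (t - j + 1) (?H j)) (Lj j))) \<union>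
      associated_primes S (quotient_module (Ext_module S P \<delta> t K) L)"
  have "associated_primes S (?H t) \<subseteq> ?U"
  proof
    fix p assume "p \<in> associated_primes S (?H t)"
    then obtain x where p: "primeideal p S" and x: "x \<in> carrier (?H t)" "p = annihilator S (?H t) x"
      by (auto simp: associated_primes_def)
    interpret Ht: module S "?H t" by (rule H)
    \<comment> \<open>\<open>x\<close> is the class of a torsion element, so some power of r kills
      it and lies in its annihilator p. As p is prime, r itself lies in p.\<close>
    have \<aa>x: "r \<odot>\<^bsub>?H t\<^esub> x = \<zero>\<^bsub>?H t\<^esub>" if r: "r \<in> \<aa>" for r
    proof -
      have rS: "r \<in> carrier S" by (rule \<aa>.Icarr[OF r])
      obtain z where z: "z \<in> ?T t" "d t z = \<zero>\<^bsub>E (Suc t)\<^esub>" "?q t z = x" using q_onto[OF x(1)] by blast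
      obtain n :: nat where n: "(r [^]\<^bsub>S\<^esub> n) \<odot>\<^bsub>E t\<^esub> z = \<zero>\<^bsub>E t\<^esub>"
        using z(1) r unfolding torsion_def by blast
      have rn: "r [^]\<^bsub>S\<^esub> n \<in> carrier S" using rS by simp
      have "(r [^]\<^bsub>S\<^esub> n) \<odot>\<^bsub>?H t\<^esub> ?q t z = ?q t ((r [^]\<^bsub>S\<^esub> n) \<odot>\<^bsub>E t\<^esub> z)"
        using module_homD(3)[OF q[of t] rn, of z] z by simp
      also have "\<dots> = \<zero>\<^bsub>?H t\<^esub>" unfolding n by (rule q_0)
      finally have "r [^]\<^bsub>S\<^esub> n \<in> p" unfolding x(2) z(3) annihilator_def using rn by simp
      then have "r \<in> p" by (rule primeideal_nat_pow[OF cring p rS])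
      then show ?thesis unfolding x(2) annihilator_def by simp
    qed
    obtain u where u: "u \<in> module_hom S (P 0) (?H t)"
      "\<And>w. w \<in> carrier (P 0) \<Longrightarrow> \<pi> w = \<zero>\<^bsub>?SI\<^esub> \<Longrightarrow> u w = \<zero>\<^bsub>?H t\<^esub>"
      "annihilator S (?H t) x = {r \<in> carrier S. \<forall>w\<in>carrier (P 0). r \<odot>\<^bsub>?H t\<^esub> u w = \<zero>\<^bsub>?H t\<^esub>}"
      by (rule associated_prime_cocycle[OF cring ideal H P x(1) \<aa>x \<pi>(1,2)]) auto
    have "u (\<delta> 0 y) = \<zero>\<^bsub>?H t\<^esub>" if "y \<in> carrier (P 1)" for y
      using imageI[OF that, of "\<delta> 0"] u(2) unfolding \<pi>(3) by (simp add: kernel_of_def)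
    from L(3)[OF u(1) this p] show "p \<in> ?U"
      using u(3) x(2) by simp
  qed
  with L(1,2) show ?thesis by blast
qed

end
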